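(* Assume the discrete inf-sup condition with constant $\gamma>0$ (see context), let $\eta_{Re},\eta_{Im}\in(0,1)$ be such that $\gamma_2:=\gamma-2\eta_{Re}-2hk\,\eta_{Im}>0$, and set $$C(\eta_{Re},\eta_{Im},\gamma_2)=\frac{2\eta_{Re}+2hk\,\eta_{Im}}{\gamma_2}.$$ Then $$\max_{v_h\in V_h\setminus\{0\}}\frac{\|P_3^{-1}Bv_h\|_{\mathcal H}}{\|v_h\|_{\mathcal H}}\le 1+C(\eta_{Re},\eta_{Im},\gamma_2).$$ Moreover, if $\eta_{Re}$ and $\eta_{Im}$ are chosen such that $C(\eta_{Re},\eta_{Im},\gamma_2)<1$, then $$\min_{v_h\in V_h\setminus\{0\}}\frac{|(v_h,P_3^{-1}Bv_h)_{\mathcal H}|}{\|v_h\|_{\mathcal H}^2}\ge 1-C(\eta_{Re},\eta_{Im},\gamma_2).$$ Here $P_3^{-1}$ is the preconditioner defined in the context.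
   Context: Setting. $\Omega\subset\mathbb{R}^d$, $d\in\{2,3\}$, is a bounded convex polygonal/polyhedral domain, $k\ge k_0>0$, and $$b(u,v)=\int_\Omega\nabla u\cdot\nabla\overline v\,dx-k^2\int_\Omega u\overline v\,dx+ik\int_{\partial\Omega}u\overline v\,ds .$$ $\overline\Omega=\bigcup_{i=1}^N\overline\Omega_i$ is a decomposition into pairwise disjoint polygonal/polyhedral subdomains; each subdomain is a union of elements of a shape-regular mesh $\mathcal T_h$ of size $h$, and $V_h\subset H^1(\Omega)$ is the (complex) conforming piecewise linear finite element space with the real nodal basis. Functions in $V_h$ are identified with their nodal vectors; $B$ is the matrix of $b$ on $V_h$, i.e. $b(u,v)=v^HBu$. $\Gamma_i=\partial\Omega_i$, $\Gamma=\bigcup_i\Gamma_i$ (so $\partial\Omega\subset\Gamma$), $I_i=\Omega_i$ (interior), $I=\bigcup_i I_i$; the same symbols index the nodes in these sets, and $u_h=(u_\Gamma,u_I)$. $V_h(\Gamma)$, $V_h(\Gamma_i)$, $V_h(I_i)$ are the spaces of nodal vectors on these sets. $R_{\Gamma_i\Gamma}$ and $R_{I_iI}$ are the restriction matrices from nodal vectors on $\Gamma$ to $\Gamma_i$ and from $I$ to $I_i$; their transposes are the zero extensions. Superscripts $T$, $H$ are transpose and conjugate transpose; $\Re$, $\Im$ of a matrix are entrywise. Norm: $\|v\|_{\mathcal H}^2=|v|_{H^1(\Omega)}^2+k^2\|v\|_{L^2(\Omega)}^2$, with associated inner product $(u,v)_{\mathcal H}=\int_\Omega\nabla u\cdot\nabla\overline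 v\,dx+k^2\int_\Omega u\overline v\,dx$; $\|\cdot\|_{\mathcal H,\Omega_i}$ is the analogous norm on $\Omega_i$. Local matrices, in block form with respect to the nodes of $\Gamma_i$ and $I_i$: $$B^{(i)}=\begin{bmatrix}B^{(i)}_{\Gamma\Gamma}&B^{(i)}_{\Gamma I}\\ B^{(i)}_{I\Gamma}&B^{(i)}_{II}\end{bmatrix},\qquad H^{(i)}=\begin{bmatrix}H^{(i)}_{\Gamma\Gamma}&H^{(i)}_{\Gamma I}\\ H^{(i)}_{I\Gamma}&H^{(i)}_{II}\end{bmatrix}$$ are the matrices of $b^{(i)}(u,v)=\int_{\Omega_i}(\nabla u\cdot\nabla\overline v-k^2u\overline v)dx+ik\int_{\partial\Omega_i\cap\partial\Omega}u\overline v\,ds$ and of the inner product of $\|\cdot\|_{\mathcal H,\Omega_i}$ on $V_h(\overline\Omega_i)$. $B^{(i)}_{\Gamma I},B^{(i)}_{I\Gamma},B^{(i)}_{II}$ are real. Discrete inf-sup condition (standing assumption): there is $\gamma>0$ with $$\inf_{u\in V_h\setminus\{0\}}\sup_{v\in V_h\setminus\{0\}}\frac{|b(u,v)|}{\|u\|_{\mathcal H}\|v\|_{\mathcal H}}\ge\gamma .$$ Spaces. For each $i$ solve $B^{(i)}_{II}\phi^{(i)}_j=\mu^{(i)}_jH^{(i)}_{II}\phi^{(i)}_j$, $j=1,\dots,n_i$, with real eigenvectors orthonormal with respect to $H^{(i)}_{II}$. Given a fixed $\beta>0$, the columns of $Q_S^{(i)}$ are the $k_i$ eigenvectors with $|\mu_j^{(i)}|<\beta$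 and the columns of $Q_L^{(i)}$ are the remaining ones. Set $B_i=Q_L^{(i)T}B_{II}^{(i)}Q_L^{(i)}$ and $$B_L^{(i)}=Q_L^{(i)}B_i^{-1}Q_L^{(i)T},\qquad H_L^{(i)}=Q_L^{(i)}\big(Q_L^{(i)T}H_{II}^{(i)}Q_L^{(i)}\big)^{-1}Q_L^{(i)T}.$$ $V_0$ is the space of vectors $u_0=(u_\Gamma,\alpha_S)$, $u_\Gamma\in V_h(\Gamma)$, $\alpha_S=(\alpha_S^{(1)},\dots,\alpha_S^{(N)})$, $\alpha_S^{(i)}\in\mathbb C^{k_i}$; $R_S^{(i)}\alpha_S=\alpha_S^{(i)}$; $V_0^{(i)}=V_h(\Gamma_i)\oplus\mathbb C^{k_i}$ and $R_{\Gamma,S}^{(i)}:V_0\to V_0^{(i)}$, $R_{\Gamma,S}^{(i)}(u_\Gamma,\alpha_S)=(R_{\Gamma_i\Gamma}u_\Gamma,\alpha_S^{(i)})$. The extension $R_0^T:V_0\to V_h$ is $$R_0^Tu_0=\begin{bmatrix}u_\Gamma\\ \sum_{i}R_{I_iI}^T\big(-B_L^{(i)}B_{I\Gamma}^{(i)}R_{\Gamma_i\Gamma}u_\Gamma+Q_S^{(i)}R_S^{(i)}\alpha_S\big)\end{bmatrix},$$ and $R_0$ is its (matrix) transpose. $R_i$ is the restriction of nodal vectors of $V_h$ to the nodes of $I_i$, and $R_i^T$ is zero extension from $I_i$. Local coarse matrices: $$B_0^{(i)}=\begin{bmatrix}B_{\Gamma\Gamma}^{(i)}-B_{\Gamma I}^{(i)}B_L^{(i)}B_{I\Gamma}^{(i)}&B_{\Gamma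 I}^{(i)}Q_S^{(i)}\\ Q_S^{(i)T}B_{I\Gamma}^{(i)}&Q_S^{(i)T}B_{II}^{(i)}Q_S^{(i)}\end{bmatrix},\quad H_0^{(i)}=\begin{bmatrix}\hat H_{\Gamma\Gamma}^{(i)}&H_{\Gamma I}^{(i)}Q_S^{(i)}\\ Q_S^{(i)T}H_{I\Gamma}^{(i)}&Q_S^{(i)T}H_{II}^{(i)}Q_S^{(i)}\end{bmatrix},$$ with $\hat H_{\Gamma\Gamma}^{(i)}=H_{\Gamma\Gamma}^{(i)}-H_{\Gamma I}^{(i)}H_L^{(i)}H_{I\Gamma}^{(i)}$, and $$C_0^{(i)}=\begin{bmatrix}\hat C_{\Gamma\Gamma}^{(i)}&0\\ 0&Q_S^{(i)T}H_{II}^{(i)}Q_S^{(i)}\end{bmatrix},$$ where $\hat C_{\Gamma\Gamma}^{(i)}$ is the block-diagonal part of $\hat H_{\Gamma\Gamma}^{(i)}$ obtained by setting to zero all entries coupling nodes of $\Gamma_i$ that belong to different subdomain vertices/edges (open edges; for $d=3$ also open faces). Both $H_0^{(i)}$ and $C_0^{(i)}$ are symmetric positive definite. Real-part selection, threshold $\eta_{Re}\in(0,1)$. (1) Solve $\Re B_0^{(i)}\xi_j=\lambda_jH_0^{(i)}\xi_j$ with real eigenvectors orthonormal with respect to $H_0^{(i)}$; the columns of $Q_1^{(i)}$ are the eigenvectors with $\lambda_j<1-\eta_{Re}$ or $\lambda_j>1+\eta_{Re}$, those of $Q_1^{(i)\perp}$ the remaining ones. (2) Solve $(Q_1^{(i)\perp})^TC_0^{(i)}Q_1^{(i)\perp}\phi_j=\lambda_j(Q_1^{(i)\perp})^TH_0^{(i)}Q_1^{(i)\perp}\phi_j$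 with eigenvectors orthonormal with respect to $(Q_1^{(i)\perp})^TH_0^{(i)}Q_1^{(i)\perp}$; the columns of $Q_2^{(i)}$ are the vectors $Q_1^{(i)\perp}\phi_j$ with $\lambda_j<1-\eta_{Re}$ or $\lambda_j>1+\eta_{Re}$. Put $Q_{Re}^{(i)}=[Q_1^{(i)},Q_2^{(i)}]$, $\Pi_{Re}^{(i)}=Q_{Re}^{(i)}Q_{Re}^{(i)T}H_0^{(i)}$. Imaginary-part selection, threshold $\eta_{Im}\in(0,1)$. Let $\Pi_i=\partial\Omega_i\cap\partial\Omega$ and let the index $R$ denote the remaining nodes of $\overline\Omega_i$, i.e. those in $I_i\cup(\partial\Omega_i\setminus\partial\Omega)$; $S_{\Pi\Pi}^{(i)}=H_{\Pi\Pi}^{(i)}-H_{\Pi R}^{(i)}(H_{RR}^{(i)})^{-1}H_{R\Pi}^{(i)}$ is the corresponding Schur complement of $H^{(i)}$. For linear elements $\Im B_0^{(i)}$ is $\Im B_{\Gamma\Gamma}^{(i)}$ (padded by zeros), and this is supported on the nodes of $\Pi_i$; it is identified with its $\Pi_i$-block. $C_{\mathrm{Diag}}^{(i)}$ is the diagonal (or block-diagonal, for a fixed partition of the nodes) part of $\Im B_{\Gamma\Gamma}^{(i)}$. (1) Solve $\Im B_{\Gamma\Gamma}^{(i)}\xi_j=\lambda_j\,hk\,S_{\Pi\Pi}^{(i)}\xi_j$ on the nodes of $\Pi_i$ with real eigenvectors orthonormal with respect to $S_{\Pi\Pi}^{(i)}$; the columns of $\hat Q_1^{(i)}$ are those with $\lambda_j<1-\eta_{Im}$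 or $\lambda_j>1+\eta_{Im}$, those of $\hat Q_1^{(i)\perp}$ the remaining ones. (2) Solve $(\hat Q_1^{(i)\perp})^TC_{\mathrm{Diag}}^{(i)}\hat Q_1^{(i)\perp}\phi_j=\lambda_j(\hat Q_1^{(i)\perp})^Thk\,S_{\Pi\Pi}^{(i)}\hat Q_1^{(i)\perp}\phi_j$ with eigenvectors orthonormal with respect to $(\hat Q_1^{(i)\perp})^TS_{\Pi\Pi}^{(i)}\hat Q_1^{(i)\perp}$; the columns of $\hat Q_2^{(i)}$ are the vectors $\hat Q_1^{(i)\perp}\phi_j$ with $\lambda_j<1-\eta_{Im}$ or $\lambda_j>1+\eta_{Im}$. Put $Q_{Im}^{(i)}=[\hat Q_1^{(i)},\hat Q_2^{(i)}]$, $\Pi_{Im}^{(i)}=Q_{Im}^{(i)}Q_{Im}^{(i)T}S_{\Pi\Pi}^{(i)}$. The matrices $C_{\mathrm{Diag}}^{(i)}$ and $\Pi_{Im}^{(i)}$ act on $V_0^{(i)}$ through the components at the nodes of $\Pi_i$ (padded by zeros); if $\Pi_i$ is empty they are zero. Preconditioner: $B_{P_3}=\sum_{i=1}^NR_{\Gamma,S}^{(i)T}B_{P_3}^{(i)}R_{\Gamma,S}^{(i)}$ with $$\begin{aligned}B_{P_3}^{(i)}={}&\Re B_0^{(i)}+\mathbf i\,\Im B_0^{(i)}-(I-\Pi_{Re}^{(i)})^T\Re B_0^{(i)}(I-\Pi_{Re}^{(i)})+(I-\Pi_{Re}^{(i)})^TC_0^{(i)}(I-\Pi_{Re}^{(i)})\\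 &-\mathbf i(I-\Pi_{Im}^{(i)})^T\Im B_0^{(i)}(I-\Pi_{Im}^{(i)})+\mathbf i(I-\Pi_{Im}^{(i)})^TC_{\mathrm{Diag}}^{(i)}(I-\Pi_{Im}^{(i)}),\end{aligned}$$ which is invertible when $\gamma_2>0$, and $$P_3^{-1}=R_0^TB_{P_3}^{-1}R_0+\sum_{i=1}^NR_i^TQ_L^{(i)}B_i^{-1}Q_L^{(i)T}R_i .$$ *)

theory Defs
  imports "HOL-Analysis.Analysis" "HOL-Library.Function_Algebras" "HOL-Library.Disjoint_Sets"
begin

section \<open>Matrices over finite index sets\<close>

text \<open>
  A matrix is a function of its row and column index; the (finite) index sets are supplied where
  they matter, namely as the summation set of a product and as the index set of an inverse. A block
  of a matrix is therefore the same function, used with smaller index sets. Sums, differences and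
  negatives of matrices are the pointwise ones.
\<close>

type_synonym ('r, 'c) mtx = "'r \<Rightarrow> 'c \<Rightarrow> complex"

definition mprod :: "('r, 'j) mtx \<Rightarrow> 'j set \<Rightarrow> ('j, 'c) mtx \<Rightarrow> ('r, 'c) mtx"
    (\<open>_ \<odot>\<^bsub>_\<^esub> _\<close> [70, 0, 71] 70)
  where "A \<odot>\<^bsub>J\<^esub> B = (\<lambda>x y. \<Sum>j\<in>J. A x j * B j y)"

definition mapply :: "('r, 'j) mtx \<Rightarrow> 'j set \<Rightarrow> ('j \<Rightarrow> complex) \<Rightarrow> 'r \<Rightarrow> complex"
  where "mapply A J u = (\<lambda>x. \<Sum>j\<in>J. A x j * u j)"

definition tr :: "('r, 'c) mtx \<Rightarrow> ('c, 'r) mtx"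
  where "tr A = (\<lambda>x y. A y x)"

definition scl :: "complex \<Rightarrow> ('r, 'c) mtx \<Rightarrow> ('r, 'c) mtx"
  where "scl c A = (\<lambda>x y. c * A x y)"

definition reM :: "('r, 'c) mtx \<Rightarrow> ('r, 'c) mtx"
  where "reM A = (\<lambda>x y. complex_of_real (Re (A x y)))"

definition imM :: "('r, 'c) mtx \<Rightarrow> ('r, 'c) mtx"
  where "imM A = (\<lambda>x y. complex_of_real (Im (A x y)))"

definition idM :: "('r, 'r) mtx"
  where "idM = (\<lambda>x y. of_bool (x = y))"

text \<open>The restriction matrix to the index set \<open>Y\<close>; its transpose is extension by zero from \<open>Y\<close>.\<close>

definition restr :: "'r set \<Rightarrow> ('r, 'r) mtx"
  where "restr Y = (\<lambda>x y. of_bool (x \<in> Y \<and> x = y))"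

text \<open>Only the entries of the inverse with both indices in \<open>J\<close> are meaningful.\<close>

definition minv :: "'r set \<Rightarrow> ('r, 'r) mtx \<Rightarrow> ('r, 'r) mtx"
  where "minv J A = (SOME X. \<forall>x\<in>J. \<forall>y\<in>J. (A \<odot>\<^bsub>J\<^esub> X) x y = idM x y \<and> (X \<odot>\<^bsub>J\<^esub> A) x y = idM x y)"

definition hcat :: "('r, 'c) mtx \<Rightarrow> ('r, 'd) mtx \<Rightarrow> ('r, 'c + 'd) mtx"
  where "hcat A B = (\<lambda>x. case_sum (A x) (B x))"

text \<open>The matrix whose \<open>j\<close>-th column is the real vector \<open>v j\<close>.\<close>

definition colsM :: "(nat \<Rightarrow> 'r \<Rightarrow> real) \<Rightarrow> ('r, nat) mtx"
  where "colsM v = (\<lambda>x j. complex_of_real (v j x))"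

text \<open>
  A complete solution of \<open>A x = \<lambda> M x\<close> on the index set \<open>J\<close> by real eigenvectors
  \<open>x 0, x 1, \<dots>\<close> (as many as the dimension) that are orthonormal with respect to \<open>W\<close>.
\<close>

definition eigensystem ::
    "'r set \<Rightarrow> ('r, 'r) mtx \<Rightarrow> ('r, 'r) mtx \<Rightarrow> ('r, 'r) mtx \<Rightarrow> (nat \<Rightarrow> real) \<Rightarrow> (nat \<Rightarrow> 'r \<Rightarrow> real) \<Rightarrow> bool"
  where "eigensystem J A M W lam x \<longleftrightarrow>
    (\<forall>j<card J. \<forall>p\<in>J. (A \<odot>\<^bsub>J\<^esub> colsM x) p j = complex_of_real (lam j) * (M \<odot>\<^bsub>J\<^esub> colsM x) p j) \<and>
    (\<forall>j<card J. \<forall>l<card J. (tr (colsM x) \<odot>\<^bsub>J\<^esub> W \<odot>\<^bsub>J\<^esub> colsM x) j l = idM j l)"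

section \<open>Domain, mesh, subdomains and the finite element space\<close>

record 'a helmholtz =
  Omega :: "'a set"
  mesh :: "'a set set"
  nsub :: nat
  sub :: "nat \<Rightarrow> 'a set"
  wavenumber :: real

definition polyhedral_domain :: "'a::euclidean_space set \<Rightarrow> bool"
  where "polyhedral_domain D \<longleftrightarrow>
    open D \<and> connected D \<and> D \<noteq> {} \<and> bounded D \<and> interior (closure D) = D \<and>
    (\<exists>\<P>. finite \<P> \<and> (\<forall>P\<in>\<P>. polytope P) \<and> closure D = \<Union>\<P>)"

definition shape_regular :: "real \<Rightarrow> 'a::euclidean_space set set \<Rightarrow> bool"
  where "shape_regular \<sigma> \<T> \<longleftrightarrow>
    (\<forall>T\<in>\<T>. \<exists>c r. 0 < r \<and> cball c r \<subseteq> T \<and> diameter T \<le> \<sigma> * r)"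

definition mesh_size :: "'a::euclidean_space helmholtz \<Rightarrow> real"
  where "mesh_size D = Max (diameter ` mesh D)"

text \<open>
  \<^const>\<open>triangulation\<close> includes the conformity condition that two elements meet in a common face.
\<close>

definition helmholtz_setting :: "real \<Rightarrow> 'a::euclidean_space helmholtz \<Rightarrow> bool"
  where "helmholtz_setting \<sigma> D \<longleftrightarrow>
    polyhedral_domain (Omega D) \<and> convex (Omega D) \<and>
    triangulation (mesh D) \<and> (\<forall>T\<in>mesh D. int DIM('a) simplex T) \<and>
    \<Union>(mesh D) = closure (Omega D) \<and> shape_regular \<sigma> (mesh D) \<and>
    (\<forall>i<nsub D. polyhedral_domain (sub D i)) \<and>
    (\<forall>i<nsub D. \<forall>j<nsub D. i \<noteq> j \<longrightarrow> sub D i \<inter> sub D j = {}) \<and>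
    closure (Omega D) = (\<Union>i<nsub D. closure (sub D i)) \<and>
    (\<forall>i<nsub D. \<exists>\<S>\<subseteq>mesh D. closure (sub D i) = \<Union>\<S>)"

definition affine_on :: "'a::real_vector set \<Rightarrow> ('a \<Rightarrow> complex) \<Rightarrow> bool"
  where "affine_on T u \<longleftrightarrow>
    (\<forall>x\<in>T. \<forall>y\<in>T. \<forall>t\<in>{0..1}. u ((1 - t) *\<^sub>R x + t *\<^sub>R y) = (1 - t) *\<^sub>R u x + t *\<^sub>R u y)"

text \<open>Members of \<open>V\<^sub>h\<close> are functions on the closure of the domain, represented as total functions
  that are zero elsewhere.\<close>

definition Vh :: "'a::euclidean_space helmholtz \<Rightarrow> ('a \<Rightarrow> complex) set"
  where "Vh D = {u. continuous_on (closure (Omega D)) u \<and> (\<forall>T\<in>mesh D. affine_on T u) \<and>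
                    (\<forall>x. x \<notin> closure (Omega D) \<longrightarrow> u x = 0)}"

definition nodes :: "'a::euclidean_space helmholtz \<Rightarrow> 'a set"
  where "nodes D = {p. \<exists>T\<in>mesh D. p extreme_point_of T}"

definition hat :: "'a::euclidean_space helmholtz \<Rightarrow> 'a \<Rightarrow> 'a \<Rightarrow> complex"
  where "hat D p = (THE u. u \<in> Vh D \<and> (\<forall>q\<in>nodes D. u q = of_bool (q = p)))"

text \<open>
  The finite element function with a given nodal vector. Conversely, the nodal vector of
  \<open>v \<in> Vh D\<close> is \<open>v\<close> itself, read on \<^term>\<open>nodes D\<close>.
\<close>

definition fe_fun :: "'a::euclidean_space helmholtz \<Rightarrow> ('a \<Rightarrow> complex) \<Rightarrow> 'a \<Rightarrow> complex"
  where "fe_fun D u = (\<lambda>x. \<Sum>p\<in>nodes D. u p * hat D p x)"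

definition skel :: "'a::euclidean_space helmholtz \<Rightarrow> 'a set"
  where "skel D = (\<Union>i<nsub D. frontier (sub D i))"

definition nodes_skel :: "'a::euclidean_space helmholtz \<Rightarrow> 'a set"
  where "nodes_skel D = nodes D \<inter> skel D"

definition nodes_Gam :: "'a::euclidean_space helmholtz \<Rightarrow> nat \<Rightarrow> 'a set"
  where "nodes_Gam D i = nodes D \<inter> frontier (sub D i)"

definition nodes_I :: "'a::euclidean_space helmholtz \<Rightarrow> nat \<Rightarrow> 'a set"
  where "nodes_I D i = nodes D \<inter> sub D i"

definition nodes_Pi :: "'a::euclidean_space helmholtz \<Rightarrow> nat \<Rightarrow> 'a set"
  where "nodes_Pi D i = nodes D \<inter> (frontier (sub D i) \<inter> frontier (Omega D))"

definition nodes_R :: "'a::euclidean_space helmholtz \<Rightarrow> nat \<Rightarrow> 'a set"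
  where "nodes_R D i = nodes D \<inter> (sub D i \<union> (frontier (sub D i) - frontier (Omega D)))"

section \<open>Sesquilinear forms and norms\<close>

text \<open>
  The surface integral of \<open>g\<close> over a part \<open>A\<close> of the boundary of a full-dimensional polytope \<open>P\<close>,
  facet by facet. By Fubini, the surface integral over a subset of a hyperplane is the Lebesgue
  integral over its orthogonal thickening of total width 1 of the function extended constantly in
  the normal direction; \<open>\<pi>\<close> is the orthogonal projection onto the hyperplane of the facet.
\<close>

definition surface_integral :: "'a::euclidean_space set \<Rightarrow> 'a set \<Rightarrow> ('a \<Rightarrow> complex) \<Rightarrow> complex"
  where "surface_integral P A g =
    (\<Sum>F | F facet_of P. let \<pi> = closest_point (affine hull F) in
       integral {y. \<pi> y \<in> F \<inter> A \<and> dist y (\<pi> y) \<le> 1/2} (\<lambda>y. g (\<pi> y)))"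

text \<open>
  Finite element functions are differentiable off the mesh skeleton, which is a null set; there
  their classical gradient is the weak one.
\<close>

definition grad_dot :: "('a::euclidean_space \<Rightarrow> complex) \<Rightarrow> ('a \<Rightarrow> complex) \<Rightarrow> 'a \<Rightarrow> complex"
  where "grad_dot u v x =
    (\<Sum>e\<in>Basis. frechet_derivative u (at x) e * cnj (frechet_derivative v (at x) e))"

definition b_form :: "'a::euclidean_space helmholtz \<Rightarrow> ('a \<Rightarrow> complex) \<Rightarrow> ('a \<Rightarrow> complex) \<Rightarrow> complex"
  where "b_form D u v =
    integral (Omega D) (grad_dot u v)
    - (complex_of_real (wavenumber D))\<^sup>2 * integral (Omega D) (\<lambda>x. u x * cnj (v x))
    + \<i> * complex_of_real (wavenumber D) *
        surface_integral (closure (Omega D)) (frontier (Omega D)) (\<lambda>x. u x * cnj (v x))"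

definition b_form_loc ::
    "'a::euclidean_space helmholtz \<Rightarrow> nat \<Rightarrow> ('a \<Rightarrow> complex) \<Rightarrow> ('a \<Rightarrow> complex) \<Rightarrow> complex"
  where "b_form_loc D i u v =
    integral (sub D i)
      (\<lambda>x. grad_dot u v x - (complex_of_real (wavenumber D))\<^sup>2 * (u x * cnj (v x)))
    + \<i> * complex_of_real (wavenumber D) *
        surface_integral (closure (Omega D)) (frontier (sub D i) \<inter> frontier (Omega D))
          (\<lambda>x. u x * cnj (v x))"

definition H_ip ::
    "'a::euclidean_space helmholtz \<Rightarrow> 'a set \<Rightarrow> ('a \<Rightarrow> complex) \<Rightarrow> ('a \<Rightarrow> complex) \<Rightarrow> complex"
  where "H_ip D S u v =
    integral S (grad_dot u v)
    + (complex_of_real (wavenumber D))\<^sup>2 * integral S (\<lambda>x. u x * cnj (v x))"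

definition H_norm :: "'a::euclidean_space helmholtz \<Rightarrow> 'a set \<Rightarrow> ('a \<Rightarrow> complex) \<Rightarrow> real"
  where "H_norm D S v =
    sqrt (integral S (\<lambda>x. \<Sum>e\<in>Basis. (cmod (frechet_derivative v (at x) e))\<^sup>2)
          + (wavenumber D)\<^sup>2 * integral S (\<lambda>x. (cmod (v x))\<^sup>2))"

text \<open>The extended reals keep the infimum and the supremum free of boundedness side conditions.\<close>

definition inf_sup :: "'a::euclidean_space helmholtz \<Rightarrow> ereal"
  where "inf_sup D =
    (INF u\<in>Vh D - {0}. SUP v\<in>Vh D - {0}.
       ereal (cmod (b_form D u v) / (H_norm D (Omega D) u * H_norm D (Omega D) v)))"

definition Bmat :: "'a::euclidean_space helmholtz \<Rightarrow> ('a, 'a) mtx"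
  where "Bmat D = (\<lambda>p q. b_form D (hat D q) (hat D p))"

definition Bloc :: "'a::euclidean_space helmholtz \<Rightarrow> nat \<Rightarrow> ('a, 'a) mtx"
  where "Bloc D i = (\<lambda>p q. b_form_loc D i (hat D q) (hat D p))"

definition Hloc :: "'a::euclidean_space helmholtz \<Rightarrow> nat \<Rightarrow> ('a, 'a) mtx"
  where "Hloc D i = (\<lambda>p q. H_ip D (sub D i) (hat D q) (hat D p))"

section \<open>Subdomain vertices, edges and faces\<close>

text \<open>
  The directions along which the decomposition is translation invariant near \<open>x\<close>. A point of the
  interface is a subdomain vertex, lies on an open edge, or (in three dimensions) lies on an open
  face, according to whether this space has dimension 0, 1 or 2. The individual open edges and faces
  are the connected components of the sets of such points.
\<close>

definition lineality :: "'a::euclidean_space helmholtz \<Rightarrow> 'a \<Rightarrow> 'a set"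
  where "lineality D x =
    {v. \<exists>e>0. \<forall>y\<in>ball x e. \<forall>t. \<bar>t\<bar> < e \<longrightarrow>
          (\<forall>i<nsub D. y \<in> closure (sub D i) \<longleftrightarrow> y + t *\<^sub>R v \<in> closure (sub D i))}"

definition same_piece :: "'a::euclidean_space helmholtz \<Rightarrow> 'a \<Rightarrow> 'a \<Rightarrow> bool"
  where "same_piece D p q \<longleftrightarrow>
    connected_component {x \<in> skel D. dim (lineality D x) = dim (lineality D p)} p q"

section \<open>Coarse space and preconditioner\<close>

text \<open>
  Indices of nodal and coarse degrees of freedom: \<open>Inl p\<close> is the value at the interface node \<open>p\<close>,
  \<open>Inr (i, j)\<close> is the coefficient of the \<open>j\<close>-th eigenvector of subdomain \<open>i\<close>.
\<close>

type_synonym 'a cidx = "'a + nat \<times> nat"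

text \<open>
  Thresholds and the solutions of the eigenproblems, whose first argument is the subdomain. The
  components \<open>lamRe1\<close>, \<open>xiRe1\<close>, \<open>lamRe2\<close>, \<open>phiRe2\<close> belong to the two steps of the real-part
  selection, those with \<open>Im\<close> to the imaginary-part selection. The vectors \<open>phiRe2\<close>, \<open>phiIm2\<close>
  are indexed by the eigenvectors that step 1 has not selected. \<open>blocks\<close> is the partition of the
  nodes that defines the block-diagonal part (singletons give the diagonal part).
\<close>

record 'a selection =
  beta :: real
  etaRe :: real
  etaIm :: real
  muI :: "nat \<Rightarrow> nat \<Rightarrow> real"
  phiI :: "nat \<Rightarrow> nat \<Rightarrow> 'a \<Rightarrow> real"
  lamRe1 :: "nat \<Rightarrow> nat \<Rightarrow> real"
  xiRe1 :: "nat \<Rightarrow> nat \<Rightarrow> 'a cidx \<Rightarrow> real"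
  lamRe2 :: "nat \<Rightarrow> nat \<Rightarrow> real"
  phiRe2 :: "nat \<Rightarrow> nat \<Rightarrow> nat \<Rightarrow> real"
  lamIm1 :: "nat \<Rightarrow> nat \<Rightarrow> real"
  xiIm1 :: "nat \<Rightarrow> nat \<Rightarrow> 'a \<Rightarrow> real"
  lamIm2 :: "nat \<Rightarrow> nat \<Rightarrow> real"
  phiIm2 :: "nat \<Rightarrow> nat \<Rightarrow> nat \<Rightarrow> real"
  blocks :: "nat \<Rightarrow> 'a set set"

definition JS :: "'a::euclidean_space helmholtz \<Rightarrow> 'a selection \<Rightarrow> nat \<Rightarrow> nat set"
  where "JS D E i = {j. j < card (nodes_I D i) \<and> \<bar>muI E i j\<bar> < beta E}"

definition JL :: "'a::euclidean_space helmholtz \<Rightarrow> 'a selection \<Rightarrow> nat \<Rightarrow> nat set"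
  where "JL D E i = {j. j < card (nodes_I D i) \<and> \<not> \<bar>muI E i j\<bar> < beta E}"

text \<open>
  \<open>QI\<close> carries all eigenvectors; \<open>Q\<^sub>S\<close> and \<open>Q\<^sub>L\<close> are \<open>QI\<close> with the column sets
  \<^const>\<open>JS\<close> and \<^const>\<open>JL\<close>.
\<close>

definition QI :: "'a::euclidean_space selection \<Rightarrow> nat \<Rightarrow> ('a, nat) mtx"
  where "QI E i = colsM (phiI E i)"

definition Bi :: "'a::euclidean_space helmholtz \<Rightarrow> 'a selection \<Rightarrow> nat \<Rightarrow> (nat, nat) mtx"
  where "Bi D E i = tr (QI E i) \<odot>\<^bsub>nodes_I D i\<^esub> Bloc D i \<odot>\<^bsub>nodes_I D i\<^esub> QI E i"

definition BL :: "'a::euclidean_space helmholtz \<Rightarrow> 'a selection \<Rightarrow> nat \<Rightarrow> ('a, 'a) mtx"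
  where "BL D E i = QI E i \<odot>\<^bsub>JL D E i\<^esub> minv (JL D E i) (Bi D E i) \<odot>\<^bsub>JL D E i\<^esub> tr (QI E i)"

definition HL :: "'a::euclidean_space helmholtz \<Rightarrow> 'a selection \<Rightarrow> nat \<Rightarrow> ('a, 'a) mtx"
  where "HL D E i =
    QI E i \<odot>\<^bsub>JL D E i\<^esub>
      minv (JL D E i) (tr (QI E i) \<odot>\<^bsub>nodes_I D i\<^esub> Hloc D i \<odot>\<^bsub>nodes_I D i\<^esub> QI E i)
    \<odot>\<^bsub>JL D E i\<^esub> tr (QI E i)"

definition X0 :: "'a::euclidean_space helmholtz \<Rightarrow> 'a selection \<Rightarrow> 'a cidx set"
  where "X0 D E = Inl ` nodes_skel D \<union> {Inr (i, j) | i j. i < nsub D \<and> j \<in> JS D E i}"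

definition X0loc :: "'a::euclidean_space helmholtz \<Rightarrow> 'a selection \<Rightarrow> nat \<Rightarrow> 'a cidx set"
  where "X0loc D E i = Inl ` nodes_Gam D i \<union> {Inr (i, j) | j. j \<in> JS D E i}"

text \<open>
  The subdomain component of an \<open>Inr\<close> index is redundant in a local matrix.
\<close>

definition block2 ::
    "('a, 'a) mtx \<Rightarrow> ('a, nat) mtx \<Rightarrow> (nat, 'a) mtx \<Rightarrow> (nat, nat) mtx \<Rightarrow> ('a cidx, 'a cidx) mtx"
  where "block2 A B C M = (\<lambda>x y. case (x, y) of
      (Inl p, Inl q) \<Rightarrow> A p q
    | (Inl p, Inr (_, l)) \<Rightarrow> B p l
    | (Inr (_, j), Inl q) \<Rightarrow> C j q
    | (Inr (_, j), Inr (_, l)) \<Rightarrow> M j l)"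

text \<open>The local part of the extension: its rows are the nodes of \<open>I\<^sub>i\<close>, its columns \<^const>\<open>X0loc\<close>.\<close>

definition Eloc :: "'a::euclidean_space helmholtz \<Rightarrow> 'a selection \<Rightarrow> nat \<Rightarrow> ('a, 'a cidx) mtx"
  where "Eloc D E i = (\<lambda>p x. case x of
      Inl q \<Rightarrow> - (BL D E i \<odot>\<^bsub>nodes_I D i\<^esub> Bloc D i) p q
    | Inr (_, j) \<Rightarrow> QI E i p j)"

definition R0T :: "'a::euclidean_space helmholtz \<Rightarrow> 'a selection \<Rightarrow> ('a, 'a cidx) mtx"
  where "R0T D E = (\<lambda>p x.
    if p \<in> nodes_skel D then of_bool (x = Inl p)
    else (\<Sum>i<nsub D. tr (restr (nodes_I D i)) \<odot>\<^bsub>nodes_I D i\<^esub> Eloc D E i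
                       \<odot>\<^bsub>X0loc D E i\<^esub> restr (X0loc D E i)) p x)"

definition B0loc :: "'a::euclidean_space helmholtz \<Rightarrow> 'a selection \<Rightarrow> nat \<Rightarrow> ('a cidx, 'a cidx) mtx"
  where "B0loc D E i = block2
    (Bloc D i - Bloc D i \<odot>\<^bsub>nodes_I D i\<^esub> BL D E i \<odot>\<^bsub>nodes_I D i\<^esub> Bloc D i)
    (Bloc D i \<odot>\<^bsub>nodes_I D i\<^esub> QI E i)
    (tr (QI E i) \<odot>\<^bsub>nodes_I D i\<^esub> Bloc D i)
    (tr (QI E i) \<odot>\<^bsub>nodes_I D i\<^esub> Bloc D i \<odot>\<^bsub>nodes_I D i\<^esub> QI E i)"

definition Hhat :: "'a::euclidean_space helmholtz \<Rightarrow> 'a selection \<Rightarrow> nat \<Rightarrow> ('a, 'a) mtx"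
  where "Hhat D E i =
    Hloc D i - Hloc D i \<odot>\<^bsub>nodes_I D i\<^esub> HL D E i \<odot>\<^bsub>nodes_I D i\<^esub> Hloc D i"

definition H0loc :: "'a::euclidean_space helmholtz \<Rightarrow> 'a selection \<Rightarrow> nat \<Rightarrow> ('a cidx, 'a cidx) mtx"
  where "H0loc D E i = block2
    (Hhat D E i)
    (Hloc D i \<odot>\<^bsub>nodes_I D i\<^esub> QI E i)
    (tr (QI E i) \<odot>\<^bsub>nodes_I D i\<^esub> Hloc D i)
    (tr (QI E i) \<odot>\<^bsub>nodes_I D i\<^esub> Hloc D i \<odot>\<^bsub>nodes_I D i\<^esub> QI E i)"

definition C0loc :: "'a::euclidean_space helmholtz \<Rightarrow> 'a selection \<Rightarrow> nat \<Rightarrow> ('a cidx, 'a cidx) mtx"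
  where "C0loc D E i = block2
    (\<lambda>p q. if same_piece D p q then Hhat D E i p q else 0)
    0
    0
    (tr (QI E i) \<odot>\<^bsub>nodes_I D i\<^esub> Hloc D i \<odot>\<^bsub>nodes_I D i\<^esub> QI E i)"

definition selected :: "real \<Rightarrow> real \<Rightarrow> bool"
  where "selected \<eta> l \<longleftrightarrow> l < 1 - \<eta> \<or> l > 1 + \<eta>"

subsection \<open>Real-part selection\<close>

text \<open>Again \<open>Q\<^sub>1\<close> and its complement are the same matrix with column sets \<open>JRe1\<close> and \<open>JRe1c\<close>.\<close>

definition JRe1 :: "'a::euclidean_space helmholtz \<Rightarrow> 'a selection \<Rightarrow> nat \<Rightarrow> nat set"
  where "JRe1 D E i = {j. j < card (X0loc D E i) \<and> selected (etaRe E) (lamRe1 E i j)}"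

definition JRe1c :: "'a::euclidean_space helmholtz \<Rightarrow> 'a selection \<Rightarrow> nat \<Rightarrow> nat set"
  where "JRe1c D E i = {j. j < card (X0loc D E i) \<and> \<not> selected (etaRe E) (lamRe1 E i j)}"

definition JRe2 :: "'a::euclidean_space helmholtz \<Rightarrow> 'a selection \<Rightarrow> nat \<Rightarrow> nat set"
  where "JRe2 D E i = {j. j < card (JRe1c D E i) \<and> selected (etaRe E) (lamRe2 E i j)}"

definition QRe1 :: "'a::euclidean_space selection \<Rightarrow> nat \<Rightarrow> ('a cidx, nat) mtx"
  where "QRe1 E i = colsM (xiRe1 E i)"

definition QRe2 :: "'a::euclidean_space helmholtz \<Rightarrow> 'a selection \<Rightarrow> nat \<Rightarrow> ('a cidx, nat) mtx"
  where "QRe2 D E i = QRe1 E i \<odot>\<^bsub>JRe1c D E i\<^esub> colsM (phiRe2 E i)"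

definition PiRe :: "'a::euclidean_space helmholtz \<Rightarrow> 'a selection \<Rightarrow> nat \<Rightarrow> ('a cidx, 'a cidx) mtx"
  where "PiRe D E i = (let Q = hcat (QRe1 E i) (QRe2 D E i) in
    Q \<odot>\<^bsub>JRe1 D E i <+> JRe2 D E i\<^esub> tr Q \<odot>\<^bsub>X0loc D E i\<^esub> H0loc D E i)"

subsection \<open>Imaginary-part selection\<close>

definition Schur :: "'a::euclidean_space helmholtz \<Rightarrow> nat \<Rightarrow> ('a, 'a) mtx"
  where "Schur D i =
    Hloc D i - Hloc D i \<odot>\<^bsub>nodes_R D i\<^esub> minv (nodes_R D i) (Hloc D i) \<odot>\<^bsub>nodes_R D i\<^esub> Hloc D i"

definition hkS :: "'a::euclidean_space helmholtz \<Rightarrow> nat \<Rightarrow> ('a, 'a) mtx"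
  where "hkS D i = scl (complex_of_real (mesh_size D * wavenumber D)) (Schur D i)"

definition CDiag :: "'a::euclidean_space helmholtz \<Rightarrow> 'a selection \<Rightarrow> nat \<Rightarrow> ('a, 'a) mtx"
  where "CDiag D E i =
    (\<lambda>p q. if \<exists>K\<in>blocks E i. p \<in> K \<and> q \<in> K then imM (Bloc D i) p q else 0)"

definition JIm1 :: "'a::euclidean_space helmholtz \<Rightarrow> 'a selection \<Rightarrow> nat \<Rightarrow> nat set"
  where "JIm1 D E i = {j. j < card (nodes_Pi D i) \<and> selected (etaIm E) (lamIm1 E i j)}"

definition JIm1c :: "'a::euclidean_space helmholtz \<Rightarrow> 'a selection \<Rightarrow> nat \<Rightarrow> nat set"
  where "JIm1c D E i = {j. j < card (nodes_Pi D i) \<and> \<not> selected (etaIm E) (lamIm1 E i j)}"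

definition JIm2 :: "'a::euclidean_space helmholtz \<Rightarrow> 'a selection \<Rightarrow> nat \<Rightarrow> nat set"
  where "JIm2 D E i = {j. j < card (JIm1c D E i) \<and> selected (etaIm E) (lamIm2 E i j)}"

definition QIm1 :: "'a::euclidean_space selection \<Rightarrow> nat \<Rightarrow> ('a, nat) mtx"
  where "QIm1 E i = colsM (xiIm1 E i)"

definition QIm2 :: "'a::euclidean_space helmholtz \<Rightarrow> 'a selection \<Rightarrow> nat \<Rightarrow> ('a, nat) mtx"
  where "QIm2 D E i = QIm1 E i \<odot>\<^bsub>JIm1c D E i\<^esub> colsM (phiIm2 E i)"

definition PiIm :: "'a::euclidean_space helmholtz \<Rightarrow> 'a selection \<Rightarrow> nat \<Rightarrow> ('a, 'a) mtx"
  where "PiIm D E i = (let Q = hcat (QIm1 E i) (QIm2 D E i) in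
    Q \<odot>\<^bsub>JIm1 D E i <+> JIm2 D E i\<^esub> tr Q \<odot>\<^bsub>nodes_Pi D i\<^esub> Schur D i)"

definition padPi :: "'a::euclidean_space helmholtz \<Rightarrow> nat \<Rightarrow> ('a, 'a) mtx \<Rightarrow> ('a cidx, 'a cidx) mtx"
  where "padPi D i A =
    block2 (\<lambda>p q. if p \<in> nodes_Pi D i \<and> q \<in> nodes_Pi D i then A p q else 0) 0 0 0"

definition is_selection :: "'a::euclidean_space helmholtz \<Rightarrow> 'a selection \<Rightarrow> bool"
  where "is_selection D E \<longleftrightarrow>
    (\<forall>i<nsub D.
      eigensystem (nodes_I D i) (Bloc D i) (Hloc D i) (Hloc D i) (muI E i) (phiI E i) \<and>
      eigensystem (X0loc D E i) (reM (B0loc D E i)) (H0loc D E i) (H0loc D E i)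
        (lamRe1 E i) (xiRe1 E i) \<and>
      (let Q = QRe1 E i; X = X0loc D E i; QHQ = tr Q \<odot>\<^bsub>X\<^esub> H0loc D E i \<odot>\<^bsub>X\<^esub> Q in
        eigensystem (JRe1c D E i) (tr Q \<odot>\<^bsub>X\<^esub> C0loc D E i \<odot>\<^bsub>X\<^esub> Q) QHQ QHQ
          (lamRe2 E i) (phiRe2 E i)) \<and>
      partition_on (nodes_Pi D i) (blocks E i) \<and>
      eigensystem (nodes_Pi D i) (imM (Bloc D i)) (hkS D i) (Schur D i) (lamIm1 E i) (xiIm1 E i) \<and>
      (let Q = QIm1 E i; X = nodes_Pi D i in
        eigensystem (JIm1c D E i) (tr Q \<odot>\<^bsub>X\<^esub> CDiag D E i \<odot>\<^bsub>X\<^esub> Q)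
          (tr Q \<odot>\<^bsub>X\<^esub> hkS D i \<odot>\<^bsub>X\<^esub> Q) (tr Q \<odot>\<^bsub>X\<^esub> Schur D i \<odot>\<^bsub>X\<^esub> Q)
          (lamIm2 E i) (phiIm2 E i)))"

subsection \<open>The preconditioner\<close>

definition BP3loc :: "'a::euclidean_space helmholtz \<Rightarrow> 'a selection \<Rightarrow> nat \<Rightarrow> ('a cidx, 'a cidx) mtx"
  where "BP3loc D E i =
    (let X = X0loc D E i;
         B0 = B0loc D E i;
         PRe = idM - PiRe D E i;
         PIm = idM - padPi D i (PiIm D E i)
     in reM B0 + scl \<i> (imM B0)
        - tr PRe \<odot>\<^bsub>X\<^esub> reM B0 \<odot>\<^bsub>X\<^esub> PRe
        + tr PRe \<odot>\<^bsub>X\<^esub> C0loc D E i \<odot>\<^bsub>X\<^esub> PRe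
        - scl \<i> (tr PIm \<odot>\<^bsub>X\<^esub> imM B0 \<odot>\<^bsub>X\<^esub> PIm)
        + scl \<i> (tr PIm \<odot>\<^bsub>X\<^esub> padPi D i (CDiag D E i) \<odot>\<^bsub>X\<^esub> PIm))"

definition BP3 :: "'a::euclidean_space helmholtz \<Rightarrow> 'a selection \<Rightarrow> ('a cidx, 'a cidx) mtx"
  where "BP3 D E =
    (\<Sum>i<nsub D. tr (restr (X0loc D E i)) \<odot>\<^bsub>X0loc D E i\<^esub> BP3loc D E i
                  \<odot>\<^bsub>X0loc D E i\<^esub> restr (X0loc D E i))"

definition P3inv :: "'a::euclidean_space helmholtz \<Rightarrow> 'a selection \<Rightarrow> ('a, 'a) mtx"
  where "P3inv D E =
    R0T D E \<odot>\<^bsub>X0 D E\<^esub> minv (X0 D E) (BP3 D E) \<odot>\<^bsub>X0 D E\<^esub> tr (R0T D E)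
    + (\<Sum>i<nsub D. tr (restr (nodes_I D i)) \<odot>\<^bsub>nodes_I D i\<^esub>
         (QI E i \<odot>\<^bsub>JL D E i\<^esub> minv (JL D E i) (Bi D E i) \<odot>\<^bsub>JL D E i\<^esub> tr (QI E i))
         \<odot>\<^bsub>nodes_I D i\<^esub> restr (nodes_I D i))"

definition P3inv_B :: "'a::euclidean_space helmholtz \<Rightarrow> 'a selection \<Rightarrow> ('a \<Rightarrow> complex) \<Rightarrow> 'a \<Rightarrow> complex"
  where "P3inv_B D E v =
    fe_fun D (mapply (P3inv D E) (nodes D) (mapply (Bmat D) (nodes D) v))"

end

theory Submission
  imports Defs
begin

text \<open>
  Write \<open>z\<^sub>0\<close> for the coarse component of a nodal vector \<open>z\<close> and \<open>B\<^sub>0\<close> for the assembly of the matrices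
  \<open>B\<^sub>0\<^sup>(\<^sup>i\<^sup>)\<close>. The coarse space and the spans of the \<open>Q\<^sub>L\<close> are \<open>b\<close>-orthogonal, so the preconditioner with
  exact coarse matrix is \<open>B\<close> inverted, and the actual one satisfies \<open>P\<^sub>3\<inverse> B v = v + R\<^sub>0\<^sup>T w\<close> with
  \<open>B\<^sub>P\<^sub>3 w = (B\<^sub>0 - B\<^sub>P\<^sub>3) v\<^sub>0\<close>. Orthogonality also gives that \<open>b(R\<^sub>0\<^sup>T w, z)\<close> is the form of
  \<open>B\<^sub>0 - B\<^sub>P\<^sub>3\<close> at the coarse components of \<open>R\<^sub>0\<^sup>T w + v\<close> and \<open>z\<close>. The eigenvalue thresholds bound this
  perturbation on each subdomain by \<open>\<delta> = 2 \<eta>\<^sub>R\<^sub>e + 2 h k \<eta>\<^sub>I\<^sub>m\<close> times local energies, because \<open>H\<^sub>0\<^sup>(\<^sup>i\<^sup>)\<close> and the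
  Schur complement are minimal energies of extensions. The inf-sup condition then yields
  \<open>\<gamma> \<parallel>R\<^sub>0\<^sup>T w\<parallel> \<le> \<delta> (\<parallel>R\<^sub>0\<^sup>T w\<parallel> + \<parallel>v\<parallel>)\<close>, that is \<open>\<parallel>R\<^sub>0\<^sup>T w\<parallel> \<le> C \<parallel>v\<parallel>\<close>.
\<close>

section \<open>Affine functions and hyperplanes\<close>

text \<open>The factor 2 in \<open>\<delta>\<close> arises because, on what the projections leave
  over, the original form and its block-diagonal replacement both lie within the threshold of one
  reference form: the energy form of \<open>H0loc\<close> for the real part, h k times the Schur
  complement for the imaginary part. The forms are complex symmetric rather than Hermitian, so the
  algebra uses a bilinear pairing, and conjugates enter only through test functions and energies;
  real eigenvectors make conjugation commute with taking coarse components. The gap \<gamma> >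
  \<delta> acts twice: it closes the final estimate, and with v = 0 the same estimate shows that the
  perturbed coarse matrix is injective, so that \<open>minv\<close> really inverts it. On the
  analytic side the delicate point is the boundary: its integral is defined facet by facet through
  thickenings, and splitting it among the subdomains requires that distinct elements meet on a facet
  only in a null set. Maximum and minimum exist because both quotients are invariant under positive
  scaling and continuous on the compact unit sphere of nodal vectors.\<close>

lemma affine_on_combine:
  assumes "affine_on T u" "affine_on T v"
  shows "affine_on T (\<lambda>x. a * u x + b * v x)"
  using assms unfolding affine_on_def by (simp add: scaleR_right_distrib distrib_left add_ac)

lemma affine_on_cnj: "affine_on T u \<Longrightarrow> affine_on T (\<lambda>x. cnj (u x))"
  unfolding affine_on_def by simp

lemma affine_on_subset: "affine_on T u \<Longrightarrow> S \<subseteq> T \<Longrightarrow> affine_on S u"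
  unfolding affine_on_def by blast

lemma affine_on_linear:
  assumes "linear f" shows "affine_on T (\<lambda>x. c + f x)"
  unfolding affine_on_def
  by (simp add: linear_add[OF assms] linear_diff[OF assms] linear_scale[OF assms] algebra_simps)

lemma affine_on_cong: "(\<And>x. x \<in> T \<Longrightarrow> u x = v x) \<Longrightarrow> convex T \<Longrightarrow> affine_on T u \<longleftrightarrow> affine_on T v"
  unfolding affine_on_def convex_alt by (simp add: Ball_def)

text \<open>The points at which two affine functions agree form a convex set.\<close>

lemma affine_on_eq_convex_hull:
  assumes u: "affine_on (convex hull S) u" and v: "affine_on (convex hull S) v"
    and eq: "\<And>p. p \<in> S \<Longrightarrow> u p = v p" and x: "x \<in> convex hull S"
  shows "u x = v x"
proof -
  let ?E = "{x \<in> convex hull S. u x = v x}"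
  have "convex ?E"
  proof (rule convexI)
    fix x y and s t :: real assume xy: "x \<in> ?E" "y \<in> ?E" and st: "0 \<le> s" "0 \<le> t" "s + t = 1"
    then have s: "s = 1 - t" and t: "t \<in> {0..1}" by simp_all
    have "s *\<^sub>R x + t *\<^sub>R y \<in> convex hull S"
      using convexD[OF convex_convex_hull] xy st by blast
    moreover have "u (s *\<^sub>R x + t *\<^sub>R y) = v (s *\<^sub>R x + t *\<^sub>R y)"
      using u v xy t unfolding affine_on_def s by simp
    ultimately show "s *\<^sub>R x + t *\<^sub>R y \<in> ?E" by simp
  qed
  moreover have "S \<subseteq> ?E" using eq hull_subset[of S convex] by auto
  ultimately have "convex hull S \<subseteq> ?E" by (intro hull_minimal) auto
  then show ?thesis using x by auto
qed

text \<open>Moving one of the points to the origin turns affine independence into linear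
  independence, and a linear map can be prescribed freely on independent vectors.\<close>

lemma affine_interpolant_exists:
  fixes val :: "'a::euclidean_space \<Rightarrow> complex"
  assumes "\<not> affine_dependent C"
  shows "\<exists>c f. linear f \<and> (\<forall>p\<in>C. c + f p = val p)"
proof (cases "C = {}")
  case True
  then show ?thesis using linear_zero by blast
next
  case False
  then obtain a where a: "a \<in> C" by blast
  have "independent ((\<lambda>x. -a + x) ` (C - {a}))"
    using assms affine_dependent_iff_dependent2[OF a] by simp
  then obtain f where f: "linear f" "\<forall>x\<in>(\<lambda>x. -a + x) ` (C - {a}). f x = val (a + x) - val a"
    using linear_independent_extend[of "(\<lambda>x. -a + x) ` (C - {a})" "\<lambda>x. val (a + x) - val a"] by blast
  have "val a - f a + f p = val p" if "p \<in> C" for p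
  proof (cases "p = a")
    case False
    then have "f (-a + p) = val p - val a" using f(2) that by auto
    moreover have "f (-a + p) = f p - f a"
      using linear_diff[OF f(1), of p a] by simp
    ultimately have "val p - val a = f p - f a" by simp
    then show ?thesis unfolding diff_eq_eq by (simp add: algebra_simps)
  qed simp
  with f(1) show ?thesis by blast
qed

lemma continuous_on_compact_integrable:
  fixes f :: "'a::euclidean_space \<Rightarrow> complex"
  assumes "compact S" "continuous_on S f"
  shows "f integrable_on S"
  using set_borel_integral_eq_integral(1)[of S f] borel_integrable_compact[OF assms]
  unfolding set_integrable_def by blast

lemma surface_integral_cnj: "surface_integral P A (\<lambda>x. cnj (g x)) = cnj (surface_integral P A g)"
  unfolding surface_integral_def Let_def by (simp add: integral_cnj)

lemma closest_point_hyperplane_eq: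
  fixes a y :: "'a::euclidean_space"
  assumes "a \<noteq> 0"
  shows "closest_point {x. a \<bullet> x = b} y = y - ((a \<bullet> y - b) / (a \<bullet> a)) *\<^sub>R a"
proof -
  let ?p = "y - ((a \<bullet> y - b) / (a \<bullet> a)) *\<^sub>R a"
  have "?p = closest_point {x. a \<bullet> x = b} y"
  proof (rule closest_point_unique)
    show "?p \<in> {x. a \<bullet> x = b}" using assms by (simp add: inner_diff_right)
    show "\<forall>z\<in>{x. a \<bullet> x = b}. dist y ?p \<le> dist y z"
    proof
      fix z assume "z \<in> {x. a \<bullet> x = b}"
      then have "\<bar>a \<bullet> y - b\<bar> \<le> norm a * norm (y - z)"
        using Cauchy_Schwarz_ineq2[of a "y - z"] by (simp add: inner_diff_right)
      then have "\<bar>a \<bullet> y - b\<bar> / norm a \<le> norm (y - z)" using assms by (simp add: field_simps)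
      moreover have "dist y ?p = \<bar>a \<bullet> y - b\<bar> / norm a"
        using assms by (simp add: dist_norm dot_square_norm power2_eq_square)
      ultimately show "dist y ?p \<le> dist y z" by (simp add: dist_norm)
    qed
  qed (simp_all add: convex_hyperplane closed_hyperplane)
  then show ?thesis by simp
qed

text \<open>The thickening of a set of codimension two is contained in a hyperplane.\<close>

lemma negligible_hyperplane_thickening:
  fixes a :: "'a::euclidean_space"
  assumes a: "a \<noteq> 0" and dim: "aff_dim G < int DIM('a) - 1"
  shows "negligible {y. closest_point {x. a \<bullet> x = b} y \<in> G}"
proof (cases "G = {}")
  case False
  then obtain g where g: "g \<in> G" by blast
  \<comment> \<open>The extra point raises the dimension by at most one, so \<open>?L\<close> still
    lies in a hyperplane. Its normal \<open>c\<close> is orthogonal to \<open>a\<close> because both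
    \<open>g\<close> and \<open>g + a\<close> lie on it. The projection moves points along
    \<open>a\<close> only and hence preserves membership in that hyperplane.\<close>
  let ?L = "insert (g + a) G"
  have "aff_dim ?L < int DIM('a)" using dim by (simp add: aff_dim_insert)
  then obtain c d where c: "c \<noteq> 0" "?L \<subseteq> {x. c \<bullet> x = d}" using aff_lowdim_subset_hyperplane by blast
  then have ca: "c \<bullet> a = 0" using g by (auto simp: inner_add_right)
  have "{y. closest_point {x. a \<bullet> x = b} y \<in> G} \<subseteq> {x. c \<bullet> x = d}"
    using c ca unfolding closest_point_hyperplane_eq[OF a] by (auto simp: inner_diff_right)
  then show ?thesis using negligible_hyperplane[of c d] c(1) negligible_subset by blast
qed simp

section \<open>Finite element functions on a conforming mesh\<close>

locale helmholtz_mesh =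
  fixes D :: "'a::euclidean_space helmholtz" and \<sigma> :: real
  assumes setting: "helmholtz_setting \<sigma> D" and wavenumber_pos: "0 < wavenumber D"
begin

abbreviation vert :: "'a set \<Rightarrow> 'a set" where "vert T \<equiv> {p. p extreme_point_of T}"

lemma finite_mesh: "finite (mesh D)"
  and Un_mesh: "\<Union>(mesh D) = closure (Omega D)"
  and face_Int: "T \<in> mesh D \<Longrightarrow> T' \<in> mesh D \<Longrightarrow> (T \<inter> T') face_of T"
  and simplex_mesh: "T \<in> mesh D \<Longrightarrow> int DIM('a) simplex T"
  using setting unfolding helmholtz_setting_def triangulation_def by auto

lemma face_Int': "T \<in> mesh D \<Longrightarrow> T' \<in> mesh D \<Longrightarrow> (T \<inter> T') face_of T'"
  using face_Int[of T' T] by (simp add: Int_commute)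

lemma mesh_convex: "T \<in> mesh D \<Longrightarrow> convex T"
  and mesh_compact: "T \<in> mesh D \<Longrightarrow> compact T"
  and mesh_closed: "T \<in> mesh D \<Longrightarrow> closed T"
  using simplex_mesh convex_simplex compact_simplex closed_simplex by blast+

lemma mesh_aff_dim: "T \<in> mesh D \<Longrightarrow> aff_dim T = int DIM('a)"
  using simplex_mesh aff_dim_simplex by blast

lemma mesh_hull: "T \<in> mesh D \<Longrightarrow> convex hull (vert T) = T"
  using Krein_Milman_Minkowski mesh_convex mesh_compact by metis

lemma mesh_vert: assumes "T \<in> mesh D"
  shows "finite (vert T)" "\<not> affine_dependent (vert T)"
proof -
  obtain C where C: "finite C" "\<not> affine_dependent C" "T = convex hull C"
    using simplex_mesh[OF assms] unfolding simplex by blast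
  have "vert T \<subseteq> C" unfolding C(3) using extreme_point_of_convex_hull by blast
  then show "finite (vert T)" "\<not> affine_dependent (vert T)"
    using C finite_subset affine_independent_subset by blast+
qed

lemma mesh_interior_nonempty: assumes "T \<in> mesh D" shows "interior T \<noteq> {}"
proof -
  have "rel_interior T \<noteq> {}"
    using mesh_aff_dim[OF assms] mesh_convex[OF assms] rel_interior_eq_empty[of T] by auto
  then show ?thesis using mesh_aff_dim[OF assms] interior_rel_interior_gen[of T] by simp
qed

lemma finite_nodes: "finite (nodes D)"
proof -
  have "nodes D = (\<Union>T\<in>mesh D. vert T)" unfolding nodes_def by auto
  then show ?thesis using finite_mesh mesh_vert(1) by simp
qed

lemma face_hull_vert:
  assumes T: "T \<in> mesh D" and G: "G face_of T"
  shows "convex hull (vert G) = G" "vert G \<subseteq> nodes D \<inter> G"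
proof -
  have "compact G" "convex G" using G mesh_compact[OF T] mesh_convex[OF T] face_of_imp_compact face_of_imp_convex by blast+
  then show "convex hull (vert G) = G" using Krein_Milman_Minkowski by metis
  show "vert G \<subseteq> nodes D \<inter> G" using extreme_point_of_face[OF G] T unfolding nodes_def by blast
qed

lemma nodes_subset: "nodes D \<subseteq> closure (Omega D)"
  unfolding Un_mesh[symmetric] nodes_def by (auto simp: extreme_point_of_def)

lemma Vh_affine: "u \<in> Vh D \<Longrightarrow> T \<in> mesh D \<Longrightarrow> affine_on T u"
  and Vh_continuous: "u \<in> Vh D \<Longrightarrow> continuous_on (closure (Omega D)) u"
  and Vh_zero: "u \<in> Vh D \<Longrightarrow> x \<notin> closure (Omega D) \<Longrightarrow> u x = 0"
  unfolding Vh_def by auto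

lemma Vh_eq_on_face:
  assumes "u \<in> Vh D" "v \<in> Vh D" "T \<in> mesh D" "G face_of T"
    and "\<And>p. p \<in> nodes D \<Longrightarrow> p \<in> G \<Longrightarrow> u p = v p" and "x \<in> G"
  shows "u x = v x"
proof (rule affine_on_eq_convex_hull[of "vert G"])
  show "affine_on (convex hull (vert G)) u" "affine_on (convex hull (vert G)) v"
    using assms face_hull_vert(1)[OF assms(3,4)] Vh_affine affine_on_subset face_of_imp_subset by metis+
qed (use assms face_hull_vert[OF assms(3,4)] in auto)

lemma Vh_eqI:
  assumes u: "u \<in> Vh D" and v: "v \<in> Vh D" and eq: "\<And>p. p \<in> nodes D \<Longrightarrow> u p = v p"
  shows "u = v"
proof
  fix x
  show "u x = v x"
  proof (cases "x \<in> closure (Omega D)")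
    case True
    then obtain T where T: "T \<in> mesh D" "x \<in> T" using Un_mesh by blast
    then show ?thesis using Vh_eq_on_face[OF u v T(1) face_of_refl[OF mesh_convex[OF T(1)]] _ T(2)] eq by blast
  qed (use Vh_zero[OF u] Vh_zero[OF v] in simp)
qed

lemma Vh_combine: "u \<in> Vh D \<Longrightarrow> v \<in> Vh D \<Longrightarrow> (\<lambda>x. a * u x + b * v x) \<in> Vh D"
  unfolding Vh_def by (auto intro!: continuous_intros affine_on_combine)

lemma Vh_cnj: "u \<in> Vh D \<Longrightarrow> (\<lambda>x. cnj (u x)) \<in> Vh D"
  unfolding Vh_def by (auto intro!: continuous_intros affine_on_cnj)

lemma Vh_0: "(\<lambda>x. 0) \<in> Vh D"
  unfolding Vh_def affine_on_def by auto

lemma Vh_sum: "finite A \<Longrightarrow> (\<And>i. i \<in> A \<Longrightarrow> u i \<in> Vh D) \<Longrightarrow> (\<lambda>x. \<Sum>i\<in>A. c i * u i x) \<in> Vh D"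
proof (induction A rule: finite_induct)
  case empty then show ?case using Vh_0 by simp
next
  case (insert i A)
  then have "(\<lambda>x. c i * u i x + 1 * (\<Sum>i\<in>A. c i * u i x)) \<in> Vh D" by (intro Vh_combine) auto
  then show ?case using insert.hyps by simp
qed

text \<open>Affine interpolants on the single elements fit together by conformity: two of them are
  affine on the common face and coincide at its vertices, which are vertices of both
  elements.\<close>

lemma Vh_interpolant_exists: "\<exists>u\<in>Vh D. \<forall>p\<in>nodes D. u p = val p"
proof -
  have "\<forall>T\<in>mesh D. \<exists>g. (\<exists>c f. linear f \<and> g = (\<lambda>x. c + f x)) \<and> (\<forall>p\<in>vert T. g p = val p)"
  proof
    fix T assume "T \<in> mesh D"
    from affine_interpolant_exists[OF mesh_vert(2)[OF this], of val]
    show "\<exists>g. (\<exists>c f. linear f \<and> g = (\<lambda>x. c + f x)) \<and> (\<forall>p\<in>vert T. g p = val p)" by blast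
  qed
  then obtain g where g: "\<And>T. T \<in> mesh D \<Longrightarrow> \<exists>c f. linear f \<and> g T = (\<lambda>x. c + f x)"
    and gval: "\<And>T p. T \<in> mesh D \<Longrightarrow> p \<in> vert T \<Longrightarrow> g T p = val p" by metis
  have gaff: "affine_on S (g T)" if "T \<in> mesh D" for T S
    using g[OF that] affine_on_linear by metis
  have gcont: "continuous_on S (g T)" if "T \<in> mesh D" for T S
  proof -
    obtain c f where "linear f" "g T = (\<lambda>x. c + f x)" using g[OF \<open>T \<in> mesh D\<close>] by blast
    then show ?thesis using linear_continuous_on linear_conv_bounded_linear by (auto intro!: continuous_intros)
  qed
  have agree: "g T x = g T' x" if "T \<in> mesh D" "T' \<in> mesh D" "x \<in> T" "x \<in> T'" for T T' x
  proof (rule affine_on_eq_convex_hull[of "vert (T \<inter> T')"])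
    note F = face_Int[OF that(1,2)] face_Int'[OF that(1,2)]
    show "g T p = g T' p" if "p \<in> vert (T \<inter> T')" for p
      using that gval[of T p] gval[of T' p] extreme_point_of_face[OF F(1), of p] extreme_point_of_face[OF F(2), of p] \<open>T \<in> mesh D\<close> \<open>T' \<in> mesh D\<close>
      by simp
    show "x \<in> convex hull (vert (T \<inter> T'))" using face_hull_vert(1)[OF that(1) F(1)] that by simp
  qed (use gaff that in auto)
  \<comment> \<open>By \<open>agree\<close>, the element picked by \<open>SOME\<close> does not
    influence the value.\<close>
  define u where "u x = (if x \<in> closure (Omega D) then g (SOME T. T \<in> mesh D \<and> x \<in> T) x else 0)" for x
  have u: "u x = g T x" if "T \<in> mesh D" "x \<in> T" for T x
  proof -
    have "x \<in> closure (Omega D)" using that Un_mesh by blast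
    moreover have "(SOME T. T \<in> mesh D \<and> x \<in> T) \<in> mesh D \<and> x \<in> (SOME T. T \<in> mesh D \<and> x \<in> T)"
      using that by (intro someI[of "\<lambda>T. T \<in> mesh D \<and> x \<in> T" T]) simp
    moreover from this have "g (SOME T. T \<in> mesh D \<and> x \<in> T) x = g T x"
      using agree that by blast
    ultimately show ?thesis by (simp add: u_def)
  qed
  have "u \<in> Vh D"
    unfolding Vh_def
  proof (intro CollectI conjI ballI allI impI)
    have "continuous_on T u" if "T \<in> mesh D" for T
      by (subst continuous_on_cong[OF refl u[OF that]]) (simp_all add: gcont[OF that])
    then have "continuous_on (\<Union>T\<in>mesh D. T) u"
      using finite_mesh mesh_closed by (intro continuous_on_closed_Union) auto
    then show "continuous_on (closure (Omega D)) u" using Un_mesh by simp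
    show "affine_on T u" if "T \<in> mesh D" for T
      by (subst affine_on_cong[OF u[OF that] mesh_convex[OF that]]) (simp_all add: gaff[OF that])
  qed (simp add: u_def)
  moreover have "u p = val p" if p: "p \<in> nodes D" for p
  proof -
    obtain T where T: "T \<in> mesh D" "p \<in> vert T" using p unfolding nodes_def by blast
    then show ?thesis using u gval by (auto simp: extreme_point_of_def)
  qed
  ultimately show ?thesis by blast
qed

lemma hat_Vh: "hat D p \<in> Vh D"
  and hat_node: "q \<in> nodes D \<Longrightarrow> hat D p q = of_bool (q = p)"
proof -
  have ex: "\<exists>!u. u \<in> Vh D \<and> (\<forall>q\<in>nodes D. u q = of_bool (q = p))"
    using Vh_interpolant_exists[of "\<lambda>q. of_bool (q = p)"] Vh_eqI by (metis (no_types, lifting))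
  from theI'[OF this] show "hat D p \<in> Vh D" "q \<in> nodes D \<Longrightarrow> hat D p q = of_bool (q = p)"
    unfolding hat_def by auto
qed

text \<open>The conjugate has the same nodal values, hence is the same member of
  \<open>Vh D\<close>.\<close>

lemma hat_real: "cnj (hat D p x) = hat D p x"
proof -
  have "(\<lambda>x. cnj (hat D p x)) = hat D p"
    by (rule Vh_eqI) (auto intro: Vh_cnj hat_Vh simp: hat_node)
  then show ?thesis by metis
qed

lemma fe_fun_Vh: "fe_fun D c \<in> Vh D"
  unfolding fe_fun_def using Vh_sum[OF finite_nodes, of "hat D"] hat_Vh by auto

lemma fe_fun_node: "p \<in> nodes D \<Longrightarrow> fe_fun D c p = c p"
  unfolding fe_fun_def using finite_nodes by (simp add: hat_node if_distrib cong: if_cong)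

lemma fe_fun_id: "u \<in> Vh D \<Longrightarrow> fe_fun D u = u"
  by (rule Vh_eqI) (auto simp: fe_fun_Vh fe_fun_node)

text \<open>All nodes of the face differ from \<open>p\<close>, so the hat agrees with the zero
  function at the vertices of \<open>G\<close>. With \<open>G = T\<close> this gives locality of the
  hats, with \<open>G\<close> cut out by a boundary facet it gives locality on the boundary.\<close>

lemma hat_zero_on_face:
  assumes "T \<in> mesh D" "G face_of T" "p \<notin> G" "x \<in> G"
  shows "hat D p x = 0"
  using Vh_eq_on_face[OF hat_Vh Vh_0 assms(1,2) _ assms(4)] assms(3) by (metis hat_node of_bool_eq(1))

section \<open>Integrals over subdomains\<close>

definition cells :: "nat \<Rightarrow> 'a set set" where "cells i = {T \<in> mesh D. T \<subseteq> closure (sub D i)}"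

lemma cells_mesh: "T \<in> cells i \<Longrightarrow> T \<in> mesh D"
  and cells_subset: "cells i \<subseteq> mesh D"
  unfolding cells_def by auto

lemma finite_cells: "finite (cells i)"
  using finite_mesh cells_subset finite_subset by blast

lemma Omega_open: "open (Omega D)" and Omega_nonempty: "Omega D \<noteq> {}" and Omega_bounded: "bounded (Omega D)"
  and interior_closure_Omega: "interior (closure (Omega D)) = Omega D" and Omega_convex: "convex (Omega D)"
  using setting unfolding helmholtz_setting_def polyhedral_domain_def by auto

lemma sub_open: "i < nsub D \<Longrightarrow> open (sub D i)"
  and interior_closure_sub: "i < nsub D \<Longrightarrow> interior (closure (sub D i)) = sub D i"
  and sub_disjoint: "i < nsub D \<Longrightarrow> j < nsub D \<Longrightarrow> i \<noteq> j \<Longrightarrow> sub D i \<inter> sub D j = {}"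
  and closure_Omega: "closure (Omega D) = (\<Union>i<nsub D. closure (sub D i))"
  using setting unfolding helmholtz_setting_def polyhedral_domain_def by auto

lemma Un_cells: assumes "i < nsub D" shows "\<Union>(cells i) = closure (sub D i)"
proof -
  have "\<forall>i<nsub D. \<exists>S\<subseteq>mesh D. closure (sub D i) = \<Union>S"
    using setting unfolding helmholtz_setting_def by (elim conjE)
  then obtain S where S: "S \<subseteq> mesh D" "closure (sub D i) = \<Union>S"
    using assms by blast
  show ?thesis
  proof
    show "closure (sub D i) \<subseteq> \<Union>(cells i)" using S unfolding cells_def by auto
    show "\<Union>(cells i) \<subseteq> closure (sub D i)" unfolding cells_def by auto
  qed
qed

text \<open>A proper face of \<open>T\<close> misses its interior, so the common face is all of
  \<open>T\<close>. Then \<open>T\<close> is a face of \<open>T'\<close> of full dimension and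
  cannot be a proper one.\<close>

lemma mesh_interior_unique:
  assumes "T \<in> mesh D" "T' \<in> mesh D" "x \<in> interior T" "x \<in> T'" shows "T = T'"
proof -
  have "T \<inter> T' = T"
  proof (rule ccontr)
    assume "T \<inter> T' \<noteq> T"
    then have "(T \<inter> T') \<inter> interior T = {}" by (rule face_of_disjoint_interior[OF face_Int[OF assms(1,2)]])
    then show False using assms(3,4) interior_subset by blast
  qed
  then have "T face_of T'" using face_Int'[OF assms(1,2)] by simp
  then show ?thesis
    using face_of_aff_dim_lt[OF mesh_convex[OF assms(2)]] mesh_aff_dim assms by force
qed

lemma cells_interior: assumes "i < nsub D" "T \<in> cells i" shows "interior T \<subseteq> sub D i"
  using assms interior_mono[of T "closure (sub D i)"] interior_closure_sub unfolding cells_def by auto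

lemma cells_disjoint: assumes "i < nsub D" "j < nsub D" "i \<noteq> j" shows "cells i \<inter> cells j = {}"
  using cells_interior[OF assms(1)] cells_interior[OF assms(2)] sub_disjoint[OF assms] mesh_interior_nonempty cells_mesh
  by blast

lemma sub_Omega: "i < nsub D \<Longrightarrow> sub D i \<subseteq> Omega D"
  using interior_mono[of "closure (sub D i)" "closure (Omega D)"] interior_closure_sub interior_closure_Omega closure_Omega
  by blast

lemma mesh_cells: "mesh D = (\<Union>i<nsub D. cells i)"
proof
  show "(\<Union>i<nsub D. cells i) \<subseteq> mesh D" using cells_subset by blast
  show "mesh D \<subseteq> (\<Union>i<nsub D. cells i)"
  proof
    fix T assume T: "T \<in> mesh D"
    then obtain x where x: "x \<in> interior T" using mesh_interior_nonempty by blast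
    then obtain j where j: "j < nsub D" "x \<in> closure (sub D j)"
      using T Un_mesh closure_Omega interior_subset by blast
    then obtain T' where "T' \<in> cells j" "x \<in> T'" using Un_cells by blast
    then show "T \<in> (\<Union>i<nsub D. cells i)" using mesh_interior_unique[OF T _ x] cells_mesh j by blast
  qed
qed

text \<open>Then \<open>S\<close> agrees with the union of the elements in \<open>\<T>\<close> up to a null set.\<close>

definition meshed :: "'a set \<Rightarrow> 'a set set \<Rightarrow> bool"
  where "meshed S \<T> \<longleftrightarrow> \<T> \<subseteq> mesh D \<and> S \<subseteq> \<Union>\<T> \<and> (\<forall>T\<in>\<T>. interior T \<subseteq> S)"

lemma meshed_Omega: "meshed (Omega D) (mesh D)"
  using Un_mesh closure_subset[of "Omega D"] interior_mono[of _ "closure (Omega D)"] interior_closure_Omega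
  unfolding meshed_def by blast

lemma meshed_sub: "i < nsub D \<Longrightarrow> meshed (sub D i) (cells i)"
  using Un_cells[of i] closure_subset[of "sub D i"] cells_interior[of i] cells_subset[of i] unfolding meshed_def by simp

lemma mesh_overlap_negligible:
  assumes "T \<in> mesh D" "T' \<in> mesh D" "T \<noteq> T'" shows "negligible (T \<inter> T')"
proof -
  have "T \<inter> T' \<subseteq> frontier T"
    using mesh_interior_unique[OF assms(1,2)] assms(3) closure_subset[of T] unfolding frontier_def by blast
  then show ?thesis using negligible_convex_frontier[OF mesh_convex[OF assms(1)]] negligible_subset by blast
qed

text \<open>Only null sets are exchanged: the pairwise overlaps of elements, and the points of
  elements outside \<open>S\<close>, which lie on element boundaries.\<close>

lemma has_integral_meshed:
  fixes g :: "'a \<Rightarrow> complex"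
  assumes S: "meshed S \<T>" and g: "\<And>T. T \<in> \<T> \<Longrightarrow> g integrable_on T"
  shows "(g has_integral (\<Sum>T\<in>\<T>. integral T g)) S"
proof -
  have mesh: "\<T> \<subseteq> mesh D" using S unfolding meshed_def by blast
  then have fin: "finite \<T>" using finite_mesh finite_subset by blast
  have "(g has_integral (\<Sum>T\<in>\<T>. integral T g)) (\<Union>\<T>)"
    using mesh mesh_overlap_negligible by (intro has_integral_Union[OF fin] integrable_integral g) (auto simp: pairwise_def)
  moreover have "negligible (\<Union>\<T> - S)"
  proof (rule negligible_subset)
    show "negligible (\<Union>T\<in>\<T>. frontier T)"
      using fin mesh negligible_convex_frontier[OF mesh_convex] by blast
    show "\<Union>\<T> - S \<subseteq> (\<Union>T\<in>\<T>. frontier T)"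
    proof
      fix x assume "x \<in> \<Union>\<T> - S"
      then obtain T where "T \<in> \<T>" "x \<in> T" "x \<notin> interior T" using S unfolding meshed_def by blast
      then show "x \<in> (\<Union>T\<in>\<T>. frontier T)" using closure_subset[of T] unfolding frontier_def by blast
    qed
  qed
  then have "negligible {x \<in> \<Union>\<T> - S. g x \<noteq> 0}" by (rule negligible_subset) auto
  moreover have "{x \<in> S - \<Union>\<T>. g x \<noteq> 0} = {}" using S unfolding meshed_def by auto
  ultimately show ?thesis
    using has_integral_spike_set_eq[of "\<Union>\<T>" S g] by (simp only: negligible_empty)
qed

section \<open>Gradients of finite element functions\<close>

lemma Vh_derivative:
  assumes u: "u \<in> Vh D" and T: "T \<in> mesh D"
  obtains f where "\<And>x. x \<in> interior T \<Longrightarrow> (u has_derivative f) (at x)"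
proof -
  \<comment> \<open>On the whole of \<open>T\<close> the function \<open>u\<close> is this one
    affine map, so a single derivative \<open>f\<close> serves every interior point.\<close>
  obtain c f where f: "linear f" "\<forall>p\<in>vert T. c + f p = u p"
    using affine_interpolant_exists[OF mesh_vert(2)[OF T], of u] by blast
  have eq: "u x = c + f x" if "x \<in> T" for x
    using affine_on_eq_convex_hull[of "vert T" u "\<lambda>x. c + f x" x] mesh_hull[OF T] Vh_affine[OF u T]
      affine_on_linear[OF f(1)] f(2) that by auto
  have "(u has_derivative f) (at x)" if x: "x \<in> interior T" for x
  proof (rule has_derivative_transform_within_open[OF _ open_interior x])
    show "((\<lambda>x. c + f x) has_derivative f) (at x)"
      using linear_imp_has_derivative[OF f(1)] by (auto intro!: derivative_eq_intros)
    show "c + f y = u y" if "y \<in> interior T" for y using eq[of y] that interior_subset by (metis subsetD)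
  qed
  then show ?thesis using that by blast
qed

lemma Vh_frechet:
  assumes u: "u \<in> Vh D" and T: "T \<in> mesh D"
  obtains f where "\<And>x. x \<in> interior T \<Longrightarrow> frechet_derivative u (at x) = f"
  using Vh_derivative[OF assms] frechet_derivative_at by metis

lemma Vh_differentiable:
  assumes u: "u \<in> Vh D" and T: "T \<in> mesh D" and x: "x \<in> interior T"
  shows "u differentiable (at x)"
  using Vh_derivative[OF u T] x differentiableI by metis

lemma frechet_combine:
  assumes u: "u \<in> Vh D" and v: "v \<in> Vh D" and T: "T \<in> mesh D" and x: "x \<in> interior T"
  shows "frechet_derivative (\<lambda>x. a * u x + b * v x) (at x) e
    = a * frechet_derivative u (at x) e + b * frechet_derivative v (at x) e"
proof -
  have "((\<lambda>x. a * u x + b * v x) has_derivative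
      (\<lambda>e. a * frechet_derivative u (at x) e + b * frechet_derivative v (at x) e)) (at x)"
    using Vh_differentiable[OF u T x, unfolded frechet_derivative_works]
      Vh_differentiable[OF v T x, unfolded frechet_derivative_works]
    by (auto intro!: derivative_eq_intros)
  from frechet_derivative_at[OF this] show ?thesis by metis
qed

lemma frechet_cnj:
  assumes u: "u \<in> Vh D" and T: "T \<in> mesh D" and x: "x \<in> interior T"
  shows "frechet_derivative (\<lambda>x. cnj (u x)) (at x) e = cnj (frechet_derivative u (at x) e)"
proof -
  have "((\<lambda>x. cnj (u x)) has_derivative (\<lambda>e. cnj (frechet_derivative u (at x) e))) (at x)"
    using Vh_differentiable[OF u T x, unfolded frechet_derivative_works]
    by (rule bounded_linear.has_derivative[OF bounded_linear_cnj])
  from frechet_derivative_at[OF this] show ?thesis by metis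
qed

lemma grad_dot_combine:
  assumes "u \<in> Vh D" "v \<in> Vh D" and T: "T \<in> mesh D" "x \<in> interior T"
  shows "grad_dot (\<lambda>x. a * u x + b * v x) w x = a * grad_dot u w x + b * grad_dot v w x"
  unfolding grad_dot_def frechet_combine[OF assms] by (simp add: sum_distrib_left sum.distrib algebra_simps)

lemma grad_dot_swap: "grad_dot v u x = cnj (grad_dot u v x)"
  unfolding grad_dot_def by (simp add: mult.commute)

lemma grad_dot_cnj:
  assumes "u \<in> Vh D" "v \<in> Vh D" and T: "T \<in> mesh D" "x \<in> interior T"
  shows "grad_dot (\<lambda>x. cnj (u x)) (\<lambda>x. cnj (v x)) x = cnj (grad_dot u v x)"
  unfolding grad_dot_def frechet_cnj[OF assms(1) T] frechet_cnj[OF assms(2) T] by simp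

text \<open>The frontier of a convex set is null. This discards the values of
  \<open>frechet_derivative\<close> at the kinks of finite element functions, where they carry no
  information.\<close>

lemma integral_mesh_cong:
  fixes f g :: "'a \<Rightarrow> complex"
  assumes "T \<in> mesh D" "\<And>x. x \<in> interior T \<Longrightarrow> f x = g x"
  shows "integral T f = integral T g" "f integrable_on T \<longleftrightarrow> g integrable_on T"
proof -
  have neg: "negligible (frontier T)" using negligible_convex_frontier[OF mesh_convex[OF assms(1)]] .
  have eq: "f x = g x" if "x \<in> T - frontier T" for x
    using assms(2) that closure_subset[of T] unfolding frontier_def by blast
  show "integral T f = integral T g" by (rule integral_spike[OF neg]) (simp add: eq)
  show "f integrable_on T \<longleftrightarrow> g integrable_on T"
    using integrable_spike[OF _ neg, of f T g] integrable_spike[OF _ neg, of g T f] eq by metis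
qed

lemma grad_dot_integrable:
  assumes "u \<in> Vh D" "v \<in> Vh D" "T \<in> mesh D"
  shows "grad_dot u v integrable_on T"
proof -
  obtain f g where "\<And>x. x \<in> interior T \<Longrightarrow> frechet_derivative u (at x) = f"
    "\<And>x. x \<in> interior T \<Longrightarrow> frechet_derivative v (at x) = g"
    using Vh_frechet assms by metis
  then have "grad_dot u v x = (\<Sum>e\<in>Basis. f e * cnj (g e))" if "x \<in> interior T" for x
    using that unfolding grad_dot_def by simp
  from integral_mesh_cong(2)[OF assms(3) this]
  show ?thesis using integrable_on_const[OF lmeasurable_compact[OF mesh_compact[OF assms(3)]]] by simp
qed

lemma Vh_mult_integrable:
  assumes "u \<in> Vh D" "v \<in> Vh D" "T \<in> mesh D"
  shows "(\<lambda>x. u x * cnj (v x)) integrable_on T"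
proof (rule continuous_on_compact_integrable[OF mesh_compact[OF assms(3)]])
  have "T \<subseteq> closure (Omega D)" using assms(3) Un_mesh by blast
  then show "continuous_on T (\<lambda>x. u x * cnj (v x))"
    using assms by (intro continuous_intros) (auto intro: continuous_on_subset Vh_continuous)
qed

text \<open>Restricted to arguments in \<open>Vh D\<close>, because additivity of the integrals
  involved rests on integrability.\<close>

definition sesq :: "(('a \<Rightarrow> complex) \<Rightarrow> ('a \<Rightarrow> complex) \<Rightarrow> complex) \<Rightarrow> bool"
  where "sesq F \<longleftrightarrow> (\<forall>u\<in>Vh D. \<forall>v\<in>Vh D. \<forall>w\<in>Vh D. \<forall>a b.
    F (\<lambda>x. a * u x + b * v x) w = a * F u w + b * F v w \<and>
    F w (\<lambda>x. a * u x + b * v x) = cnj a * F w u + cnj b * F w v)"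

lemma sesqD:
  assumes "sesq F" "u \<in> Vh D" "v \<in> Vh D" "w \<in> Vh D"
  shows "F (\<lambda>x. a * u x + b * v x) w = a * F u w + b * F v w"
    "F w (\<lambda>x. a * u x + b * v x) = cnj a * F w u + cnj b * F w v"
  using assms unfolding sesq_def by simp_all

text \<open>Hermitian symmetry transports linearity in the first argument to antilinearity in the
  second. The local form of b is not Hermitian itself, but it is a complex combination of the
  Hermitian forms \<open>stiff\<close>, \<open>mass\<close> and \<open>surf\<close>.\<close>

lemma sesqI_hermitian:
  assumes "\<And>u v w a b. u \<in> Vh D \<Longrightarrow> v \<in> Vh D \<Longrightarrow> w \<in> Vh D \<Longrightarrow>
      F (\<lambda>x. a * u x + b * v x) w = a * F u w + b * F v w"
    and "\<And>u v. F v u = cnj (F u v)"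
  shows "sesq F"
  unfolding sesq_def
proof (intro ballI allI conjI)
  fix u v w a b assume *: "u \<in> Vh D" "v \<in> Vh D" "w \<in> Vh D"
  show "F (\<lambda>x. a * u x + b * v x) w = a * F u w + b * F v w" using assms(1)[OF *] .
  show "F w (\<lambda>x. a * u x + b * v x) = cnj a * F w u + cnj b * F w v"
    using assms(1)[OF *] assms(2)[of w] by simp
qed

lemma sesq_add_scaled: "sesq F \<Longrightarrow> sesq G \<Longrightarrow> sesq (\<lambda>u v. F u v + c * G u v)"
  unfolding sesq_def by (simp add: algebra_simps)

lemma sesq_sum: "(\<And>i. i \<in> I \<Longrightarrow> sesq (F i)) \<Longrightarrow> sesq (\<lambda>u v. \<Sum>i\<in>I. F i u v)"
  unfolding sesq_def by (simp add: sum.distrib sum_distrib_left)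

lemma sesq_cong:
  assumes "\<And>u v. u \<in> Vh D \<Longrightarrow> v \<in> Vh D \<Longrightarrow> F u v = G u v"
  shows "sesq F \<longleftrightarrow> sesq G"
  unfolding sesq_def by (simp add: assms Vh_combine cong: ball_cong)

lemma sesq_zero: assumes "sesq F" "v \<in> Vh D" shows "F (\<lambda>x. 0) v = 0" "F v (\<lambda>x. 0) = 0"
proof -
  have "F (\<lambda>x. 0 * v x + 0 * v x) v = 0 * F v v + 0 * F v v \<and> F v (\<lambda>x. 0 * v x + 0 * v x) = cnj 0 * F v v + cnj 0 * F v v"
    using assms unfolding sesq_def by blast
  then show "F (\<lambda>x. 0) v = 0" "F v (\<lambda>x. 0) = 0" by simp_all
qed

lemma sesq_sum_left:
  assumes F: "sesq F" and v: "v \<in> Vh D"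
  shows "finite A \<Longrightarrow> (\<And>i. i \<in> A \<Longrightarrow> u i \<in> Vh D) \<Longrightarrow> F (\<lambda>x. \<Sum>i\<in>A. c i * u i x) v = (\<Sum>i\<in>A. c i * F (u i) v)"
proof (induction A rule: finite_induct)
  case empty then show ?case using sesq_zero[OF F v] by simp
next
  case (insert i A)
  then have "F (\<lambda>x. c i * u i x + 1 * (\<Sum>i\<in>A. c i * u i x)) v = c i * F (u i) v + 1 * F (\<lambda>x. \<Sum>i\<in>A. c i * u i x) v"
    by (intro sesqD(1) F v Vh_sum insert.prems insert.hyps) simp_all
  then show ?case using insert by simp
qed

lemma sesq_sum_right:
  assumes F: "sesq F" and v: "v \<in> Vh D"
  shows "finite A \<Longrightarrow> (\<And>i. i \<in> A \<Longrightarrow> u i \<in> Vh D) \<Longrightarrow> F v (\<lambda>x. \<Sum>i\<in>A. c i * u i x) = (\<Sum>i\<in>A. cnj (c i) * F v (u i))"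
proof (induction A rule: finite_induct)
  case empty then show ?case using sesq_zero[OF F v] by simp
next
  case (insert i A)
  then have "F v (\<lambda>x. c i * u i x + 1 * (\<Sum>i\<in>A. c i * u i x)) = cnj (c i) * F v (u i) + cnj 1 * F v (\<lambda>x. \<Sum>i\<in>A. c i * u i x)"
    by (intro sesqD(2) F v Vh_sum insert.prems insert.hyps) simp_all
  then show ?case using insert by simp
qed

lemma sesq_fe_fun:
  assumes F: "sesq F"
  shows "F (fe_fun D c) (fe_fun D d) = (\<Sum>p\<in>nodes D. \<Sum>q\<in>nodes D. cnj (d p) * F (hat D q) (hat D p) * c q)"
proof -
  have "F (fe_fun D c) (fe_fun D d) = (\<Sum>q\<in>nodes D. c q * F (hat D q) (fe_fun D d))"
    using sesq_sum_left[OF F fe_fun_Vh finite_nodes, of "hat D" c d] hat_Vh unfolding fe_fun_def by simp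
  also have "\<dots> = (\<Sum>q\<in>nodes D. c q * (\<Sum>p\<in>nodes D. cnj (d p) * F (hat D q) (hat D p)))"
    using sesq_sum_right[OF F hat_Vh finite_nodes, of "hat D"] hat_Vh unfolding fe_fun_def by simp
  also have "\<dots> = (\<Sum>q\<in>nodes D. \<Sum>p\<in>nodes D. cnj (d p) * F (hat D q) (hat D p) * c q)"
    by (simp add: sum_distrib_left sum_distrib_right mult_ac)
  finally show ?thesis by (subst sum.swap)
qed

definition stiff :: "'a set \<Rightarrow> ('a \<Rightarrow> complex) \<Rightarrow> ('a \<Rightarrow> complex) \<Rightarrow> complex"
  where "stiff T u v = integral T (grad_dot u v)"

definition mass :: "'a set \<Rightarrow> ('a \<Rightarrow> complex) \<Rightarrow> ('a \<Rightarrow> complex) \<Rightarrow> complex"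
  where "mass T u v = integral T (\<lambda>x. u x * cnj (v x))"

lemma sesq_stiff: assumes T: "T \<in> mesh D" shows "sesq (stiff T)"
proof (rule sesqI_hermitian)
  fix u v w a b assume V: "u \<in> Vh D" "v \<in> Vh D" "w \<in> Vh D"
  have "stiff T (\<lambda>x. a * u x + b * v x) w = integral T (\<lambda>x. a * grad_dot u w x + b * grad_dot v w x)"
    unfolding stiff_def using grad_dot_combine[OF V(1,2) T] by (intro integral_mesh_cong(1)[OF T]) auto
  also have "\<dots> = a * stiff T u w + b * stiff T v w"
    unfolding stiff_def using grad_dot_integrable[OF V(1,3) T] grad_dot_integrable[OF V(2,3) T]
    by (simp add: integral_add integrable_on_mult_right)
  finally show "stiff T (\<lambda>x. a * u x + b * v x) w = a * stiff T u w + b * stiff T v w" .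
next
  fix u v :: "'a \<Rightarrow> complex"
  have "grad_dot v u = (\<lambda>x. cnj (grad_dot u v x))" using grad_dot_swap by blast
  then show "stiff T v u = cnj (stiff T u v)" unfolding stiff_def integral_cnj by simp
qed

lemma sesq_mass: assumes T: "T \<in> mesh D" shows "sesq (mass T)"
proof (rule sesqI_hermitian)
  fix u v w a b assume V: "u \<in> Vh D" "v \<in> Vh D" "w \<in> Vh D"
  have "mass T (\<lambda>x. a * u x + b * v x) w = integral T (\<lambda>x. a * (u x * cnj (w x)) + b * (v x * cnj (w x)))"
    unfolding mass_def by (simp add: algebra_simps)
  also have "\<dots> = a * mass T u w + b * mass T v w"
    unfolding mass_def using Vh_mult_integrable[OF V(1,3) T] Vh_mult_integrable[OF V(2,3) T]
    by (simp add: integral_add integrable_on_mult_right)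
  finally show "mass T (\<lambda>x. a * u x + b * v x) w = a * mass T u w + b * mass T v w" .
next
  fix u v :: "'a \<Rightarrow> complex"
  show "mass T v u = cnj (mass T u v)" unfolding mass_def integral_cnj by (simp add: mult.commute)
qed

lemma stiff_cnj:
  assumes "T \<in> mesh D" "u \<in> Vh D" "v \<in> Vh D"
  shows "stiff T (\<lambda>x. cnj (u x)) (\<lambda>x. cnj (v x)) = cnj (stiff T u v)"
  unfolding stiff_def integral_cnj using grad_dot_cnj[OF assms(2,3,1)]
  by (intro integral_mesh_cong(1)[OF assms(1)]) auto

lemma mass_cnj: "mass T (\<lambda>x. cnj (u x)) (\<lambda>x. cnj (v x)) = cnj (mass T u v)"
  unfolding mass_def integral_cnj by simp

abbreviation k2 :: complex where "k2 \<equiv> (complex_of_real (wavenumber D))\<^sup>2"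

lemma meshed_integrals:
  assumes S: "meshed S \<T>" and V: "u \<in> Vh D" "v \<in> Vh D"
  shows "integral S (grad_dot u v) = (\<Sum>T\<in>\<T>. stiff T u v)"
    "integral S (\<lambda>x. u x * cnj (v x)) = (\<Sum>T\<in>\<T>. mass T u v)"
    "grad_dot u v integrable_on S" "(\<lambda>x. u x * cnj (v x)) integrable_on S"
proof -
  have mesh: "T \<in> mesh D" if "T \<in> \<T>" for T using S that unfolding meshed_def by blast
  note g = has_integral_meshed[OF S grad_dot_integrable[OF V mesh]]
    and m = has_integral_meshed[OF S Vh_mult_integrable[OF V mesh]]
  show "integral S (grad_dot u v) = (\<Sum>T\<in>\<T>. stiff T u v)" "grad_dot u v integrable_on S"
    using integral_unique[OF g] has_integral_integrable[OF g] unfolding stiff_def by auto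
  show "integral S (\<lambda>x. u x * cnj (v x)) = (\<Sum>T\<in>\<T>. mass T u v)" "(\<lambda>x. u x * cnj (v x)) integrable_on S"
    using integral_unique[OF m] has_integral_integrable[OF m] unfolding mass_def by auto
qed

lemma H_ip_meshed:
  assumes "meshed S \<T>" "u \<in> Vh D" "v \<in> Vh D"
  shows "H_ip D S u v = (\<Sum>T\<in>\<T>. stiff T u v + k2 * mass T u v)"
  unfolding H_ip_def meshed_integrals[OF assms] by (simp add: sum.distrib sum_distrib_left)

lemma sesq_H_ip: assumes S: "meshed S \<T>" shows "sesq (H_ip D S)"
proof -
  have "T \<in> mesh D" if "T \<in> \<T>" for T using S that unfolding meshed_def by blast
  then have "sesq (\<lambda>u v. \<Sum>T\<in>\<T>. stiff T u v + k2 * mass T u v)"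
    by (intro sesq_sum sesq_add_scaled sesq_stiff sesq_mass)
  then show ?thesis using sesq_cong[OF H_ip_meshed[OF S]] by simp
qed

lemma H_ip_swap: "H_ip D S v u = cnj (H_ip D S u v)"
proof -
  have "grad_dot v u = (\<lambda>x. cnj (grad_dot u v x))" using grad_dot_swap by blast
  then show ?thesis unfolding H_ip_def by (simp add: integral_cnj mult.commute)
qed

lemma H_ip_cnj:
  assumes S: "meshed S \<T>" and V: "u \<in> Vh D" "v \<in> Vh D"
  shows "H_ip D S (\<lambda>x. cnj (u x)) (\<lambda>x. cnj (v x)) = cnj (H_ip D S u v)"
proof -
  have mesh: "T \<in> mesh D" if "T \<in> \<T>" for T using S that unfolding meshed_def by blast
  show ?thesis
    using mesh by (simp add: H_ip_meshed[OF S] V Vh_cnj stiff_cnj[OF _ V] mass_cnj)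
qed

section \<open>Definiteness of the energy norm\<close>

lemma H_ip_norm:
  assumes S: "meshed S \<T>" and u: "u \<in> Vh D"
  shows "H_ip D S u u = complex_of_real ((H_norm D S u)\<^sup>2)" "0 \<le> H_norm D S u"
proof -
  let ?g = "\<lambda>x. \<Sum>e\<in>Basis. (cmod (frechet_derivative u (at x) e))\<^sup>2" and ?m = "\<lambda>x. (cmod (u x))\<^sup>2"
  have g: "grad_dot u u = (\<lambda>x. complex_of_real (?g x))"
    unfolding grad_dot_def complex_norm_square[symmetric] by simp
  have m: "(\<lambda>x. u x * cnj (u x)) = (\<lambda>x. complex_of_real (?m x))"
    unfolding complex_norm_square[symmetric] by simp
  have re: "f integrable_on S" if "(\<lambda>x. complex_of_real (f x)) integrable_on S" for f
    using integrable_linear[OF that bounded_linear_Re] by (simp add: o_def)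
  note ints = meshed_integrals(3,4)[OF S u u, unfolded g m, THEN re]
  have ofr: "integral S (\<lambda>x. complex_of_real (f x)) = complex_of_real (integral S f)" if "f integrable_on S" for f
    using has_integral_of_real[OF integrable_integral[OF that]] integral_unique by blast
  have "0 \<le> integral S ?g" "0 \<le> integral S ?m"
    by (auto intro!: integral_nonneg ints sum_nonneg)
  then have sq: "0 \<le> integral S ?g + (wavenumber D)\<^sup>2 * integral S ?m" by simp
  then show "0 \<le> H_norm D S u" unfolding H_norm_def by simp
  show "H_ip D S u u = complex_of_real ((H_norm D S u)\<^sup>2)"
    unfolding H_ip_def H_norm_def g m ofr[OF ints(1)] ofr[OF ints(2)] using sq by simp
qed

text \<open>A continuous nonnegative function with vanishing integral is zero on every box inside
  the element, and by continuity also on the element boundary, since a convex set with interior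
  points is contained in the closure of its interior.\<close>

lemma mass_pos:
  assumes T: "T \<in> mesh D" and u: "u \<in> Vh D"
  shows "0 \<le> Re (mass T u u)" "Re (mass T u u) = 0 \<Longrightarrow> x \<in> T \<Longrightarrow> u x = 0"
proof -
  have uc: "continuous_on T u"
    using continuous_on_subset[OF Vh_continuous[OF u], of T] T Un_mesh by blast
  have re: "(Re \<circ> (\<lambda>x. u x * cnj (u x))) = (\<lambda>x. (cmod (u x))\<^sup>2)"
    unfolding complex_norm_square[symmetric] o_def by simp
  have int: "(\<lambda>x. (cmod (u x))\<^sup>2) integrable_on T"
    using integrable_linear[OF Vh_mult_integrable[OF u u T] bounded_linear_Re] unfolding re .
  have eq: "Re (mass T u u) = integral T (\<lambda>x. (cmod (u x))\<^sup>2)"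
    using integral_linear[OF Vh_mult_integrable[OF u u T] bounded_linear_Re] unfolding re mass_def by simp
  then show "0 \<le> Re (mass T u u)" using integral_nonneg[OF int] by simp
  assume 0: "Re (mass T u u) = 0" and x: "x \<in> T"
  have inner: "u y = 0" if y: "y \<in> interior T" for y
  proof -
    obtain a b where ab: "cbox a b \<subseteq> interior T" "y \<in> box a b" using open_contains_cbox[OF open_interior y] by metis
    then have sub: "cbox a b \<subseteq> T" using interior_subset by blast
    have cont: "continuous_on (cbox a b) (\<lambda>x. (cmod (u x))\<^sup>2)"
      using continuous_on_subset[OF uc sub] by (intro continuous_intros)
    then have "integral (cbox a b) (\<lambda>x. (cmod (u x))\<^sup>2) \<le> 0"
      using integral_subset_le[OF sub integrable_continuous[OF cont] int] 0 eq by simp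
    then have "integral (cbox a b) (\<lambda>x. (cmod (u x))\<^sup>2) = 0"
      using integral_nonneg[OF integrable_continuous[OF cont]] by (intro order_antisym) simp_all
    moreover have "box a b \<noteq> {}" "y \<in> cbox a b" using ab(2) box_subset_cbox[of a b] by auto
    ultimately show ?thesis using integral_cbox_eq_0_iff[OF cont] by simp
  qed
  have cl: "closure (interior T) = T"
    using convex_closure_interior[OF mesh_convex[OF T] mesh_interior_nonempty[OF T]] mesh_closed[OF T] by simp
  show "u x = 0"
    using continuous_constant_on_closure[of "interior T" u 0 x] inner uc x unfolding cl by simp
qed

lemma stiff_nonneg:
  assumes T: "T \<in> mesh D" and u: "u \<in> Vh D"
  shows "0 \<le> Re (stiff T u u)"
proof -
  have re: "0 \<le> (Re \<circ> grad_dot u u) x" for x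
    unfolding grad_dot_def o_def complex_norm_square[symmetric] by (simp add: sum_nonneg)
  have "(Re \<circ> grad_dot u u) integrable_on T" "Re (stiff T u u) = integral T (Re \<circ> grad_dot u u)"
    using integrable_linear[OF grad_dot_integrable[OF u u T] bounded_linear_Re]
      integral_linear[OF grad_dot_integrable[OF u u T] bounded_linear_Re] unfolding stiff_def by auto
  then show ?thesis using integral_nonneg[of "Re \<circ> grad_dot u u" T] re by simp
qed

text \<open>The squared norm is a sum of nonnegative contributions of the elements, so each of them
  vanishes. As the wavenumber is positive, the mass part alone then forces \<open>u\<close> to
  vanish.\<close>

lemma H_norm_eq_0:
  assumes S: "meshed S \<T>" and u: "u \<in> Vh D" and 0: "H_norm D S u = 0" and x: "x \<in> \<Union>\<T>"
  shows "u x = 0"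
proof -
  have mesh: "T \<in> mesh D" if "T \<in> \<T>" for T using S that unfolding meshed_def by blast
  have fin: "finite \<T>" using S finite_mesh finite_subset unfolding meshed_def by blast
  let ?f = "\<lambda>T. Re (stiff T u u) + (wavenumber D)\<^sup>2 * Re (mass T u u)"
  have k2: "Re (k2 * z) = (wavenumber D)\<^sup>2 * Re z" for z
    using Re_complex_of_real[of "(wavenumber D)\<^sup>2"] by (simp flip: of_real_power)
  have "(\<Sum>T\<in>\<T>. ?f T) = 0"
    using arg_cong[OF H_ip_norm(1)[OF S u], of Re] unfolding H_ip_meshed[OF S u u] 0 by (simp add: k2)
  moreover have "0 \<le> ?f T" if "T \<in> \<T>" for T using stiff_nonneg mass_pos mesh that u by simp
  ultimately have z: "?f T = 0" if "T \<in> \<T>" for T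
    using that sum_nonneg_eq_0_iff[OF fin, of ?f] by blast
  obtain T where T: "T \<in> \<T>" "x \<in> T" using x by blast
  have "Re (mass T u u) = 0"
    using z[OF T(1)] stiff_nonneg[OF mesh[OF T(1)] u] mass_pos(1)[OF mesh[OF T(1)] u] wavenumber_pos
    by (smt (verit) mult_pos_pos zero_less_power)
  then show ?thesis using mass_pos(2)[OF mesh[OF T(1)] u] T(2) by blast
qed

section \<open>Boundary integrals\<close>

lemma compact_closure_Omega: "compact (closure (Omega D))"
  using Omega_bounded by (simp add: compact_closure)

text \<open>By convexity the closed domain is the convex hull of the finitely many element vertices.
  This makes the facet theory of polyhedra available for the boundary.\<close>

lemma polyhedron_closure_Omega: "polyhedron (closure (Omega D))"
proof -
  let ?V = "\<Union>T\<in>mesh D. vert T"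
  have "closure (Omega D) = convex hull ?V"
  proof
    have "convex hull (vert T) \<subseteq> convex hull ?V" if "T \<in> mesh D" for T using that by (intro hull_mono) blast
    then show "closure (Omega D) \<subseteq> convex hull ?V" using mesh_hull unfolding Un_mesh[symmetric] by blast
    show "convex hull ?V \<subseteq> closure (Omega D)"
      using nodes_subset convex_closure[OF Omega_convex] unfolding nodes_def by (intro hull_minimal) auto
  qed
  moreover have "finite ?V" using finite_mesh mesh_vert(1) by blast
  ultimately show ?thesis using polytope_imp_polyhedron polytope_convex_hull by metis
qed

text \<open>The supporting hyperplane of a facet is also its affine hull, by comparing dimensions.
  The inequality is strict on \<open>Omega D\<close>, which is the interior of its closure.\<close>

lemma facet_hyperplane:
  assumes F: "F facet_of closure (Omega D)"
  obtains a b where "a \<noteq> 0" "closure (Omega D) \<subseteq> {x. a \<bullet> x \<le> b}"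
    "F \<subseteq> {x. a \<bullet> x = b}" "affine hull F = {x. a \<bullet> x = b}" "\<And>x. x \<in> Omega D \<Longrightarrow> a \<bullet> x < b"
proof -
  obtain a b where ab: "a \<noteq> 0" "closure (Omega D) \<subseteq> {x. a \<bullet> x \<le> b}" "F = closure (Omega D) \<inter> {x. a \<bullet> x = b}"
    using facet_of_polyhedron[OF polyhedron_closure_Omega F] by blast
  have "interior (closure (Omega D)) \<noteq> {}" using interior_closure_Omega Omega_nonempty by simp
  then have "aff_dim (closure (Omega D)) = int DIM('a)" by (rule aff_dim_nonempty_interior)
  then have dim: "aff_dim F = int DIM('a) - 1" "F \<noteq> {}" using F unfolding facet_of_def by auto
  have "affine hull F = {x. a \<bullet> x = b}"
  proof (rule affine_dim_equal)
    show "affine hull F \<subseteq> {x. a \<bullet> x = b}" using ab(3) by (intro hull_minimal) (auto simp: affine_hyperplane)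
    show "aff_dim (affine hull F) = aff_dim {x. a \<bullet> x = b}" using dim(1) ab(1) by simp
  qed (use dim(2) in \<open>auto simp: affine_hyperplane\<close>)
  moreover have "a \<bullet> x < b" if "x \<in> Omega D" for x
    using that interior_mono[OF ab(2)] ab(1) interior_closure_Omega by auto
  ultimately show ?thesis using that ab by blast
qed

lemma facet_frontier:
  assumes F: "F facet_of closure (Omega D)" shows "F \<subseteq> frontier (Omega D)"
proof -
  obtain a b where "F \<subseteq> {x. a \<bullet> x = b}" "\<And>x. x \<in> Omega D \<Longrightarrow> a \<bullet> x < b"
    using facet_hyperplane[OF F] by metis
  moreover have "F \<subseteq> closure (Omega D)" using F face_of_imp_subset unfolding facet_of_def by blast
  ultimately show ?thesis using interior_subset[of "Omega D"] unfolding frontier_def by fastforce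
qed

text \<open>
  Two elements lie on the same side of the hyperplane of a boundary facet, so if their common part
  on the facet had full dimension then they would overlap.
\<close>

lemma facet_overlap_dim:
  assumes F: "F facet_of closure (Omega D)" and T: "T \<in> mesh D" "T' \<in> mesh D" "T \<noteq> T'"
  shows "aff_dim (F \<inter> T \<inter> T') < int DIM('a) - 1 \<or> F \<inter> T \<inter> T' = {}"
proof (rule ccontr)
  let ?G = "F \<inter> T \<inter> T'"
  assume neg: "\<not> ?thesis"
  obtain a b where a: "a \<noteq> 0" and Fh: "F \<subseteq> {x. a \<bullet> x = b}" "affine hull F = {x. a \<bullet> x = b}"
    and less: "\<And>x. x \<in> Omega D \<Longrightarrow> a \<bullet> x < b"
    using facet_hyperplane[OF F] by metis
  have "affine hull ?G = {x. a \<bullet> x = b}"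
  proof (rule affine_dim_equal)
    show sub: "affine hull ?G \<subseteq> {x. a \<bullet> x = b}" using Fh(1) by (intro hull_minimal) (auto simp: affine_hyperplane)
    show "aff_dim (affine hull ?G) = aff_dim {x. a \<bullet> x = b}"
      using neg aff_dim_subset[OF sub] a by simp
  qed (use neg in \<open>auto simp: affine_hyperplane\<close>)
  moreover have "convex ?G"
    using F mesh_convex[OF T(1)] mesh_convex[OF T(2)] face_of_imp_convex unfolding facet_of_def
    by (intro convex_Int) auto
  then obtain x where "x \<in> rel_interior ?G" using neg rel_interior_eq_empty[of ?G] by auto
  ultimately obtain e where x: "x \<in> ?G" and e: "e > 0" "ball x e \<inter> {x. a \<bullet> x = b} \<subseteq> ?G"
    unfolding mem_rel_interior_ball by auto
  have ax: "a \<bullet> x = b" using x Fh by blast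
  have in_Omega: "interior S \<subseteq> Omega D" if "S \<in> mesh D" for S
    using that meshed_Omega unfolding meshed_def by blast
  obtain y y' where y: "y \<in> interior T" "y' \<in> interior T'" using mesh_interior_nonempty T by blast
  define s s' where "s = b - a \<bullet> y" and "s' = b - a \<bullet> y'"
  have s: "s > 0" "s' > 0" using less in_Omega T y unfolding s_def s'_def by force+
  \<comment> \<open>\<open>s\<close> and \<open>s'\<close> measure how far \<open>y\<close> and
    \<open>y'\<close> lie below the hyperplane, and the cross weights make \<open>w\<close> parallel
    to it. The size of \<open>t\<close> keeps the shrunken points inside their elements and
    \<open>q\<close> within \<open>e\<close> of \<open>x\<close>, so \<open>q\<close> belongs to
    \<open>T'\<close>. The midpoint of \<open>q\<close> and
    \<open>x - (t * s) *\<^sub>R (x - y')\<close> is \<open>?z\<close> below: it lies in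
    \<open>T'\<close> by convexity and in the interior of \<open>T\<close> because it is
    \<open>x\<close> moved towards \<open>y\<close>.\<close>
  define w where "w = s *\<^sub>R (x - y') - s' *\<^sub>R (x - y)"
  define t where "t = 1 / (s + s' + norm w / e + 1)"
  have M: "s + s' + norm w / e + 1 > 0" using s e by (simp add: add_pos_nonneg)
  have t: "t > 0" "t * s' \<le> 1" "t * s \<le> 1" "t * norm w < e"
    using s e M unfolding t_def by (auto simp: field_simps add_pos_nonneg add_nonneg_nonneg)
  define q where "q = x + t *\<^sub>R w"
  have aw: "a \<bullet> w = 0" unfolding w_def s_def s'_def by (simp add: inner_diff_right ax algebra_simps)
  have "q \<in> ball x e" using t unfolding q_def by (simp add: dist_norm)
  then have q: "q \<in> T'" using e(2) ax aw unfolding q_def by (auto simp: inner_add_right)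
  have p': "x - (t * s) *\<^sub>R (x - y') \<in> T'"
    using mem_interior_convex_shrink[OF mesh_convex[OF T(2)] y(2), of x "t * s"] x t s interior_subset[of T'] by auto
  let ?z = "x - (t * s' / 2) *\<^sub>R (x - y)"
  have zT: "?z \<in> interior T"
    using mem_interior_convex_shrink[OF mesh_convex[OF T(1)] y(1), of x "t * s' / 2"] x t s by auto
  have mid: "(1/2) *\<^sub>R q + (1/2) *\<^sub>R (x - (t * s) *\<^sub>R (x - y')) \<in> T'"
    by (rule convexD[OF mesh_convex[OF T(2)] q p']) auto
  have half: "(1/2) *\<^sub>R x + ((1/2) *\<^sub>R x + r) = x + r" for r
    unfolding add.assoc[symmetric] scaleR_add_left[symmetric] by simp
  have "?z \<in> T'"
    using mid unfolding q_def w_def by (simp add: algebra_simps half)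
  then show False using mesh_interior_unique[OF T(1,2) zT] T(3) by blast
qed

section \<open>Splitting the boundary integral among the subdomains\<close>

definition thick :: "'a set \<Rightarrow> 'a set \<Rightarrow> 'a set"
  where "thick F A = {y. closest_point (affine hull F) y \<in> F \<inter> A \<and> dist y (closest_point (affine hull F) y) \<le> 1/2}"

lemma surface_integral_thick:
  "surface_integral P A g = (\<Sum>F | F facet_of P. integral (thick F A) (\<lambda>y. g (closest_point (affine hull F) y)))"
  unfolding surface_integral_def thick_def Let_def by simp

lemma thick_integrable:
  fixes g :: "'a \<Rightarrow> complex"
  assumes F: "F facet_of closure (Omega D)" and A: "closed A"
    and g: "continuous_on (closure (Omega D)) g"
  shows "(\<lambda>y. g (closest_point (affine hull F) y)) integrable_on thick F A"
proof -
  let ?\<pi> = "closest_point (affine hull F)"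
  have F': "F face_of closure (Omega D)" "F \<noteq> {}" using F unfolding facet_of_def by auto
  have cont: "continuous_on S ?\<pi>" for S
    using F'(2) by (intro continuous_on_closest_point) (auto simp: closed_affine_hull affine_imp_convex)
  have cF: "compact F" using face_of_imp_compact[OF convex_closure[OF Omega_convex] compact_closure_Omega F'(1)] .
  then have cFA: "compact (F \<inter> A)" using A by (rule compact_Int_closed)
  have "thick F A = ?\<pi> -` (F \<inter> A) \<inter> {y. dist y (?\<pi> y) \<le> 1/2}" unfolding thick_def by blast
  moreover have "closed (?\<pi> -` (F \<inter> A))" using closed_vimage[OF compact_imp_closed[OF cFA] cont] .
  moreover have "closed {y. dist y (?\<pi> y) \<le> 1/2}" using cont by (intro closed_Collect_le continuous_intros)
  ultimately have cl: "closed (thick F A)" by auto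
  obtain c r where r: "F \<subseteq> cball c r" using compact_imp_bounded[OF cF] unfolding bounded_subset_cball by blast
  have "thick F A \<subseteq> cball c (r + 1/2)"
  proof
    fix y assume "y \<in> thick F A"
    then have "dist y (?\<pi> y) \<le> 1/2" "?\<pi> y \<in> cball c r" using r unfolding thick_def by auto
    then show "y \<in> cball c (r + 1/2)" using dist_triangle[of c y "?\<pi> y"] by (simp add: dist_commute)
  qed
  then have "compact (thick F A)"
    using cl bounded_subset[OF bounded_cball] compact_eq_bounded_closed by blast
  then show ?thesis
  proof (rule continuous_on_compact_integrable)
    have "?\<pi> ` thick F A \<subseteq> closure (Omega D)"
      using face_of_imp_subset[OF F'(1)] unfolding thick_def by blast
    then show "continuous_on (thick F A) (\<lambda>y. g (?\<pi> y))"
      using continuous_on_compose2[OF g cont] by blast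
  qed
qed

definition surf :: "'a set \<Rightarrow> ('a \<Rightarrow> complex) \<Rightarrow> ('a \<Rightarrow> complex) \<Rightarrow> complex"
  where "surf A u v = surface_integral (closure (Omega D)) A (\<lambda>x. u x * cnj (v x))"

lemma Vh_mult_continuous: "u \<in> Vh D \<Longrightarrow> v \<in> Vh D \<Longrightarrow> continuous_on (closure (Omega D)) (\<lambda>x. u x * cnj (v x))"
  by (intro continuous_intros Vh_continuous)

lemma sesq_surf: assumes A: "closed A" shows "sesq (surf A)"
proof (rule sesqI_hermitian)
  fix u v w a b assume V: "u \<in> Vh D" "v \<in> Vh D" "w \<in> Vh D"
  have "surf A (\<lambda>x. a * u x + b * v x) w = surface_integral (closure (Omega D)) A (\<lambda>x. a * (u x * cnj (w x)) + b * (v x * cnj (w x)))"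
    unfolding surf_def by (simp add: algebra_simps)
  also have "\<dots> = (\<Sum>F | F facet_of closure (Omega D).
      a * integral (thick F A) (\<lambda>y. u (closest_point (affine hull F) y) * cnj (w (closest_point (affine hull F) y)))
      + b * integral (thick F A) (\<lambda>y. v (closest_point (affine hull F) y) * cnj (w (closest_point (affine hull F) y))))"
    unfolding surface_integral_thick
  proof (intro sum.cong refl)
    fix F assume "F \<in> {F. F facet_of closure (Omega D)}"
    then have F: "F facet_of closure (Omega D)" by simp
    note i = thick_integrable[OF F A Vh_mult_continuous[OF V(1,3)]] thick_integrable[OF F A Vh_mult_continuous[OF V(2,3)]]
    show "integral (thick F A) (\<lambda>y. a * (u (closest_point (affine hull F) y) * cnj (w (closest_point (affine hull F) y)))
        + b * (v (closest_point (affine hull F) y) * cnj (w (closest_point (affine hull F) y)))) =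
      a * integral (thick F A) (\<lambda>y. u (closest_point (affine hull F) y) * cnj (w (closest_point (affine hull F) y)))
      + b * integral (thick F A) (\<lambda>y. v (closest_point (affine hull F) y) * cnj (w (closest_point (affine hull F) y)))"
      using i by (simp add: integral_add integrable_on_mult_right)
  qed
  also have "\<dots> = a * surf A u w + b * surf A v w"
    unfolding surf_def surface_integral_thick by (simp add: sum.distrib sum_distrib_left)
  finally show "surf A (\<lambda>x. a * u x + b * v x) w = a * surf A u w + b * surf A v w" .
next
  fix u v :: "'a \<Rightarrow> complex"
  show "surf A v u = cnj (surf A u v)"
    unfolding surf_def surface_integral_cnj[symmetric] by (simp add: mult.commute)
qed

definition outer :: "nat \<Rightarrow> 'a set" where "outer i = frontier (sub D i) \<inter> frontier (Omega D)"

lemma closed_outer: "closed (outer i)" unfolding outer_def by (intro closed_Int frontier_closed)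

lemma frontier_Omega_subset: assumes "x \<in> frontier (Omega D)" "x \<in> closure (sub D i)" "i < nsub D"
  shows "x \<in> outer i"
  using assms sub_Omega[OF assms(3)] interior_open[OF Omega_open] interior_open[OF sub_open[OF assms(3)]]
  unfolding outer_def frontier_def by auto

text \<open>The outer boundaries of two subdomains meet on a facet inside the finitely many sets
  \<open>F \<inter> T \<inter> T'\<close> with elements from different subdomains. These have
  codimension at least two by \<open>facet_overlap_dim\<close>, so their thickenings are null and
  the integrals add up.\<close>

lemma surf_outer:
  assumes V: "u \<in> Vh D" "v \<in> Vh D"
  shows "surf (frontier (Omega D)) u v = (\<Sum>i<nsub D. surf (outer i) u v)"
proof -
  let ?g = "\<lambda>x. u x * cnj (v x)"
  have "integral (thick F (frontier (Omega D))) (\<lambda>y. ?g (closest_point (affine hull F) y)) =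
      (\<Sum>i<nsub D. integral (thick F (outer i)) (\<lambda>y. ?g (closest_point (affine hull F) y)))"
    if F: "F facet_of closure (Omega D)" for F
  proof -
    let ?\<pi> = "closest_point (affine hull F)"
    have "((\<lambda>y. ?g (?\<pi> y)) has_integral (\<Sum>i<nsub D. integral (thick F (outer i)) (\<lambda>y. ?g (?\<pi> y))))
        (\<Union>i<nsub D. thick F (outer i))"
    proof (rule has_integral_UN)
      show "((\<lambda>y. ?g (?\<pi> y)) has_integral integral (thick F (outer i)) (\<lambda>y. ?g (?\<pi> y))) (thick F (outer i))" for i
        by (intro integrable_integral thick_integrable[OF F closed_outer Vh_mult_continuous[OF V]])
      show "pairwise (\<lambda>i j. negligible (thick F (outer i) \<inter> thick F (outer j))) {..<nsub D}"
        unfolding pairwise_def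
      proof (intro ballI impI)
        fix i j assume ij: "i \<in> {..<nsub D}" "j \<in> {..<nsub D}" "i \<noteq> j"
        obtain a b where a: "a \<noteq> 0" and Fh: "affine hull F = {x. a \<bullet> x = b}" using facet_hyperplane[OF F] by metis
        have "negligible {y. ?\<pi> y \<in> F \<inter> T \<inter> T'}" if "T \<in> cells i" "T' \<in> cells j" for T T'
        proof -
          have "T \<noteq> T'" using that cells_disjoint[of i j] ij by auto
          then show ?thesis
            using negligible_hyperplane_thickening[OF a, of "F \<inter> T \<inter> T'" b] facet_overlap_dim[OF F, of T T']
              that cells_mesh unfolding Fh by auto
        qed
        then have neg: "negligible (\<Union>T\<in>cells i. \<Union>T'\<in>cells j. {y. ?\<pi> y \<in> F \<inter> T \<inter> T'})"
          using finite_cells by (intro negligible_Union) auto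
        have "outer l \<subseteq> \<Union>(cells l)" if "l \<in> {..<nsub D}" for l
          using Un_cells[of l] that unfolding outer_def frontier_def by auto
        note sub = this[OF ij(1)] this[OF ij(2)]
        have "thick F (outer i) \<inter> thick F (outer j) \<subseteq> (\<Union>T\<in>cells i. \<Union>T'\<in>cells j. {y. ?\<pi> y \<in> F \<inter> T \<inter> T'})"
        proof
          fix y assume "y \<in> thick F (outer i) \<inter> thick F (outer j)"
          then have "?\<pi> y \<in> F" "?\<pi> y \<in> \<Union>(cells i)" "?\<pi> y \<in> \<Union>(cells j)" using sub unfolding thick_def by auto
          then show "y \<in> (\<Union>T\<in>cells i. \<Union>T'\<in>cells j. {y. ?\<pi> y \<in> F \<inter> T \<inter> T'})" by auto
        qed
        then show "negligible (thick F (outer i) \<inter> thick F (outer j))" using neg negligible_subset by blast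
      qed
    qed simp
    moreover have "(\<Union>i<nsub D. thick F (outer i)) = thick F (frontier (Omega D))"
    proof
      show "(\<Union>i<nsub D. thick F (outer i)) \<subseteq> thick F (frontier (Omega D))" unfolding thick_def outer_def by blast
      show "thick F (frontier (Omega D)) \<subseteq> (\<Union>i<nsub D. thick F (outer i))"
      proof
        fix y assume y: "y \<in> thick F (frontier (Omega D))"
        then have "?\<pi> y \<in> frontier (Omega D)" "?\<pi> y \<in> closure (Omega D)" unfolding thick_def frontier_def by auto
        then obtain i where "i < nsub D" "?\<pi> y \<in> outer i" using frontier_Omega_subset closure_Omega by blast
        then show "y \<in> (\<Union>i<nsub D. thick F (outer i))" using y unfolding thick_def by blast
      qed
    qed
    ultimately have "((\<lambda>y. ?g (?\<pi> y)) has_integral (\<Sum>i<nsub D. integral (thick F (outer i)) (\<lambda>y. ?g (?\<pi> y))))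
        (thick F (frontier (Omega D)))" by simp
    then show ?thesis by (rule integral_unique)
  qed
  then show ?thesis unfolding surf_def surface_integral_thick by (subst sum.swap) simp
qed

lemma surf_cong:
  assumes "\<And>F x. F facet_of closure (Omega D) \<Longrightarrow> x \<in> F \<Longrightarrow> x \<in> A \<Longrightarrow> u x * cnj (v x) = u' x * cnj (v' x)"
  shows "surf A u v = surf A u' v'"
  unfolding surf_def surface_integral_thick
  using assms by (intro sum.cong refl integral_cong) (auto simp: thick_def)

text \<open>The boundary facet cuts the element \<open>T\<close> in a face of \<open>T\<close>. A
  node on that face lies on the outer boundary of the subdomain, so \<open>p\<close> is not on it.
  This also covers nodes inside the subdomain and is what confines the imaginary part of
  \<open>Bloc\<close> to \<open>nodes_Pi\<close>.\<close>

lemma hat_outer_zero: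
  assumes i: "i < nsub D" and p: "p \<in> nodes D" "p \<notin> nodes_Pi D i"
    and F: "F facet_of closure (Omega D)" and x: "x \<in> F" "x \<in> outer i"
  shows "hat D p x = 0"
proof -
  have "x \<in> closure (sub D i)" using x unfolding outer_def frontier_def by blast
  then obtain T where T: "T \<in> cells i" "x \<in> T" using Un_cells[OF i] by blast
  note Tm = cells_mesh[OF T(1)]
  have "(F \<inter> T) face_of (closure (Omega D) \<inter> T)"
    using F mesh_convex[OF Tm] unfolding facet_of_def by (intro face_of_slice) auto
  moreover have "closure (Omega D) \<inter> T = T" using Tm Un_mesh by blast
  ultimately have face: "(F \<inter> T) face_of T" by simp
  have "p \<notin> F \<inter> T"
  proof
    assume "p \<in> F \<inter> T"
    then have "p \<in> outer i" using frontier_Omega_subset[of p i] facet_frontier[OF F] i Un_cells[OF i] T by blast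
    then show False using p unfolding nodes_Pi_def outer_def by blast
  qed
  then show ?thesis using hat_zero_on_face[OF Tm face, of p x] x T by blast
qed

section \<open>Local matrices\<close>

abbreviation nodes_cl :: "nat \<Rightarrow> 'a set" where "nodes_cl i \<equiv> nodes_Gam D i \<union> nodes_I D i"

lemma sub_frontier: assumes "i < nsub D" "j < nsub D" shows "sub D i \<inter> frontier (sub D j) = {}"
proof (cases "i = j")
  case True then show ?thesis using interior_open[OF sub_open[OF assms(2)]] unfolding frontier_def by blast
next
  case False
  then show ?thesis using open_Int_closure_eq_empty[OF sub_open[OF assms(1)], of "sub D j"] sub_disjoint[OF assms]
    unfolding frontier_def by blast
qed

lemma closure_sub: "i < nsub D \<Longrightarrow> closure (sub D i) = frontier (sub D i) \<union> sub D i"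
  using interior_open[OF sub_open] closure_subset[of "sub D i"] unfolding frontier_def by blast

lemma nodes_cl_eq: "i < nsub D \<Longrightarrow> nodes_cl i = nodes D \<inter> closure (sub D i)"
  unfolding nodes_Gam_def nodes_I_def closure_sub by blast

lemma finite_node_sets: "finite (nodes_Gam D i)" "finite (nodes_I D i)" "finite (nodes_Pi D i)"
    "finite (nodes_R D i)" "finite (nodes_skel D)"
  unfolding nodes_Gam_def nodes_I_def nodes_Pi_def nodes_R_def nodes_skel_def using finite_nodes by auto

lemma nodes_I_Gam: "i < nsub D \<Longrightarrow> j < nsub D \<Longrightarrow> nodes_I D i \<inter> nodes_Gam D j = {}"
  using sub_frontier unfolding nodes_Gam_def nodes_I_def by blast

lemma nodes_I_skel: "i < nsub D \<Longrightarrow> nodes_I D i \<inter> nodes_skel D = {}"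
  using sub_frontier unfolding nodes_skel_def skel_def nodes_I_def by blast

lemma nodes_I_disjoint: "i < nsub D \<Longrightarrow> j < nsub D \<Longrightarrow> i \<noteq> j \<Longrightarrow> nodes_I D i \<inter> nodes_I D j = {}"
  using sub_disjoint unfolding nodes_I_def by blast

lemma nodes_Gam_skel: "i < nsub D \<Longrightarrow> nodes_Gam D i \<subseteq> nodes_skel D"
  unfolding nodes_skel_def skel_def nodes_Gam_def by blast

lemma nodes_decomp: "nodes D = nodes_skel D \<union> (\<Union>i<nsub D. nodes_I D i)"
proof
  show "nodes D \<subseteq> nodes_skel D \<union> (\<Union>i<nsub D. nodes_I D i)"
  proof
    fix p assume p: "p \<in> nodes D"
    then obtain i where "i < nsub D" "p \<in> closure (sub D i)" using nodes_subset closure_Omega by blast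
    then show "p \<in> nodes_skel D \<union> (\<Union>i<nsub D. nodes_I D i)"
      using p closure_sub unfolding nodes_skel_def skel_def nodes_I_def by blast
  qed
qed (auto simp: nodes_skel_def nodes_I_def)

lemma nodes_Pi_R: assumes "i < nsub D"
  shows "nodes_Pi D i \<subseteq> nodes_Gam D i" "nodes_cl i = nodes_Pi D i \<union> nodes_R D i" "nodes_Pi D i \<inter> nodes_R D i = {}"
    "nodes_I D i \<inter> nodes_Pi D i = {}"
proof -
  have "sub D i \<inter> frontier (Omega D) = {}"
    using sub_Omega[OF assms] interior_open[OF Omega_open] unfolding frontier_def by blast
  then show "nodes_Pi D i \<subseteq> nodes_Gam D i" "nodes_cl i = nodes_Pi D i \<union> nodes_R D i" "nodes_Pi D i \<inter> nodes_R D i = {}"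
    "nodes_I D i \<inter> nodes_Pi D i = {}"
    unfolding nodes_Pi_def nodes_Gam_def nodes_I_def nodes_R_def by blast+
qed

lemma hat_zero_cells:
  assumes i: "i < nsub D" and p: "p \<in> nodes D" "p \<notin> nodes_cl i" and T: "T \<in> cells i" and x: "x \<in> T"
  shows "hat D p x = 0"
proof -
  have "p \<notin> T" using p T nodes_cl_eq[OF i] Un_cells[OF i] by blast
  then show ?thesis using hat_zero_on_face[OF cells_mesh[OF T] face_of_refl[OF mesh_convex[OF cells_mesh[OF T]]]] x by blast
qed

lemma stiff_mass_zero:
  assumes T: "T \<in> mesh D" and zero: "\<And>x. x \<in> T \<Longrightarrow> u x = 0"
  shows "stiff T u v = 0" "mass T u v = 0" "stiff T v u = 0" "mass T v u = 0"
proof -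
  have fr: "frechet_derivative u (at x) = (\<lambda>_. 0)" if x: "x \<in> interior T" for x
  proof (rule frechet_derivative_at[symmetric], rule has_derivative_transform_within_open[OF _ open_interior x])
    show "0 = u y" if "y \<in> interior T" for y using zero[of y] that interior_subset[of T] by auto
  qed simp
  show "mass T u v = 0" "mass T v u = 0"
    unfolding mass_def using zero by (auto intro!: integral_unique has_integral_is_0)
  have "stiff T u v = integral T (\<lambda>x. 0)" "stiff T v u = integral T (\<lambda>x. 0)"
    unfolding stiff_def by (rule integral_mesh_cong(1)[OF T]; simp add: grad_dot_def fr)+
  then show "stiff T u v = 0" "stiff T v u = 0" by simp_all
qed

lemma b_form_loc_meshed:
  assumes i: "i < nsub D" and V: "u \<in> Vh D" "v \<in> Vh D"
  shows "b_form_loc D i u v = (\<Sum>T\<in>cells i. stiff T u v + (- k2) * mass T u v)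
    + \<i> * complex_of_real (wavenumber D) * surf (outer i) u v"
proof -
  note m = meshed_integrals[OF meshed_sub[OF i] V]
  have "integral (sub D i) (\<lambda>x. grad_dot u v x - k2 * (u x * cnj (v x))) =
      (\<Sum>T\<in>cells i. stiff T u v) - k2 * (\<Sum>T\<in>cells i. mass T u v)"
    using m by (simp add: integral_diff integrable_on_mult_right)
  then show ?thesis
    unfolding b_form_loc_def surf_def outer_def by (simp add: sum_subtractf sum_distrib_left)
qed

lemma sum_mesh: "(\<Sum>T\<in>mesh D. f T) = (\<Sum>i<nsub D. \<Sum>T\<in>cells i. f T)" for f :: "'a set \<Rightarrow> complex"
  unfolding mesh_cells using finite_cells cells_disjoint by (intro sum.UNION_disjoint) auto

lemma b_form_sum:
  assumes V: "u \<in> Vh D" "v \<in> Vh D"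
  shows "b_form D u v = (\<Sum>i<nsub D. b_form_loc D i u v)"
proof -
  note m = meshed_integrals[OF meshed_Omega V]
  have "b_form D u v = (\<Sum>T\<in>mesh D. stiff T u v + (- k2) * mass T u v)
      + \<i> * complex_of_real (wavenumber D) * surf (frontier (Omega D)) u v"
    unfolding b_form_def surf_def m by (simp add: sum_subtractf sum_distrib_left)
  also have "\<dots> = (\<Sum>i<nsub D. b_form_loc D i u v)"
    unfolding sum_mesh surf_outer[OF V] sum_distrib_left sum.distrib[symmetric]
    using b_form_loc_meshed[OF _ V] by simp
  finally show ?thesis .
qed

lemma H_ip_sum:
  assumes V: "u \<in> Vh D" "v \<in> Vh D"
  shows "H_ip D (Omega D) u v = (\<Sum>i<nsub D. H_ip D (sub D i) u v)"
  unfolding H_ip_meshed[OF meshed_Omega V] sum_mesh using H_ip_meshed[OF meshed_sub V] by simp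

lemma sesq_b_form_loc: assumes i: "i < nsub D" shows "sesq (b_form_loc D i)"
proof -
  have "sesq (\<lambda>u v. (\<Sum>T\<in>cells i. stiff T u v + (- k2) * mass T u v)
    + (\<i> * complex_of_real (wavenumber D)) * surf (outer i) u v)"
    by (intro sesq_sum sesq_add_scaled sesq_stiff sesq_mass sesq_surf closed_outer) (auto dest: cells_mesh)
  then show ?thesis using sesq_cong[OF b_form_loc_meshed[OF i]] by simp
qed

lemma b_form_fe_fun: "i < nsub D \<Longrightarrow> b_form_loc D i (fe_fun D c) (fe_fun D d)
    = (\<Sum>p\<in>nodes D. \<Sum>q\<in>nodes D. cnj (d p) * Bloc D i p q * c q)"
  using sesq_fe_fun[OF sesq_b_form_loc] unfolding Bloc_def by blast

lemma H_ip_fe_fun: "i < nsub D \<Longrightarrow> H_ip D (sub D i) (fe_fun D c) (fe_fun D d)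
    = (\<Sum>p\<in>nodes D. \<Sum>q\<in>nodes D. cnj (d p) * Hloc D i p q * c q)"
  using sesq_fe_fun[OF sesq_H_ip[OF meshed_sub]] unfolding Hloc_def by blast

section \<open>Symmetry, reality and support of the local matrices\<close>

lemma Bmat_sum: "Bmat D p q = (\<Sum>i<nsub D. Bloc D i p q)"
  unfolding Bmat_def Bloc_def by (rule b_form_sum[OF hat_Vh hat_Vh])

lemma hat_cnj: "(\<lambda>x. cnj (hat D p x)) = hat D p"
  using hat_real by blast

lemma Hloc_cnj: "i < nsub D \<Longrightarrow> cnj (Hloc D i p q) = Hloc D i p q"
  using H_ip_cnj[OF meshed_sub hat_Vh hat_Vh] unfolding Hloc_def hat_cnj by metis

lemma Hloc_sym: "i < nsub D \<Longrightarrow> Hloc D i q p = Hloc D i p q"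
  using Hloc_cnj H_ip_swap unfolding Hloc_def by metis

lemma surf_hat_sym: "surf A (hat D p) (hat D q) = surf A (hat D q) (hat D p)"
  unfolding surf_def by (simp add: hat_real mult.commute)

lemma stiff_hat: assumes T: "T \<in> mesh D"
  shows "cnj (stiff T (hat D q) (hat D p)) = stiff T (hat D q) (hat D p)"
    "stiff T (hat D p) (hat D q) = stiff T (hat D q) (hat D p)"
proof -
  show *: "cnj (stiff T (hat D q) (hat D p)) = stiff T (hat D q) (hat D p)" for q p
    using stiff_cnj[OF T hat_Vh hat_Vh] unfolding hat_cnj by metis
  have "grad_dot (hat D p) (hat D q) = (\<lambda>x. cnj (grad_dot (hat D q) (hat D p) x))" using grad_dot_swap by blast
  then have "stiff T (hat D p) (hat D q) = cnj (stiff T (hat D q) (hat D p))" unfolding stiff_def integral_cnj by simp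
  then show "stiff T (hat D p) (hat D q) = stiff T (hat D q) (hat D p)" using * by simp
qed

lemma mass_hat: "cnj (mass T (hat D q) (hat D p)) = mass T (hat D q) (hat D p)"
  "mass T (hat D p) (hat D q) = mass T (hat D q) (hat D p)"
  unfolding mass_def integral_cnj by (simp_all add: hat_real mult.commute)

text \<open>The hats are real, so the matrix is complex symmetric, not Hermitian. Adjoints are
  therefore taken by plain transposition later on.\<close>

lemma Bloc_sym: assumes i: "i < nsub D" shows "Bloc D i q p = Bloc D i p q"
  unfolding Bloc_def b_form_loc_meshed[OF i hat_Vh hat_Vh]
  using stiff_hat(2)[OF cells_mesh, of _ i p q] mass_hat(2)[of _ p q] surf_hat_sym[of _ p q] by simp

text \<open>Stiffness and mass of real hats are real, so only the boundary term contributes.\<close>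

lemma Im_Bloc: assumes i: "i < nsub D"
  shows "Im (Bloc D i p q) = wavenumber D * Re (surf (outer i) (hat D q) (hat D p))"
proof -
  have "cnj (\<Sum>T\<in>cells i. stiff T (hat D q) (hat D p) + (- k2) * mass T (hat D q) (hat D p)) =
    (\<Sum>T\<in>cells i. stiff T (hat D q) (hat D p) + (- k2) * mass T (hat D q) (hat D p))"
    using stiff_hat(1)[OF cells_mesh, of _ i] mass_hat(1) by simp
  then have "Im (\<Sum>T\<in>cells i. stiff T (hat D q) (hat D p) + (- k2) * mass T (hat D q) (hat D p)) = 0"
    by (metis Reals_cnj_iff complex_is_Real_iff)
  then show ?thesis unfolding Bloc_def b_form_loc_meshed[OF i hat_Vh hat_Vh] by simp
qed

lemma Im_Bloc_zero:
  assumes i: "i < nsub D" and pq: "p \<in> nodes D" "q \<in> nodes D" and out: "p \<notin> nodes_Pi D i \<or> q \<notin> nodes_Pi D i"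
  shows "Im (Bloc D i p q) = 0"
proof -
  have "surf (outer i) (hat D q) (hat D p) = surf (outer i) (\<lambda>x. 0) (\<lambda>x. 0)"
    using hat_outer_zero[OF i] pq out by (intro surf_cong) auto
  then show ?thesis unfolding Im_Bloc[OF i] using sesq_zero[OF sesq_surf[OF closed_outer] Vh_0] by simp
qed

text \<open>A node off the closed subdomain belongs to none of its elements, so its hat vanishes on
  all of them, and on the outer boundary as well by \<open>hat_outer_zero\<close>.\<close>

lemma loc_zero:
  assumes i: "i < nsub D" and pq: "p \<in> nodes D" "q \<in> nodes D" and out: "p \<notin> nodes_cl i \<or> q \<notin> nodes_cl i"
  shows "Bloc D i p q = 0" "Hloc D i p q = 0"
proof -
  have out': "p \<notin> nodes_Pi D i \<or> q \<notin> nodes_Pi D i" using out nodes_Pi_R[OF i] by blast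
  have "surf (outer i) (hat D q) (hat D p) = surf (outer i) (\<lambda>x. 0) (\<lambda>x. 0)"
    using hat_outer_zero[OF i] pq out' by (intro surf_cong) auto
  then have s: "surf (outer i) (hat D q) (hat D p) = 0" using sesq_zero[OF sesq_surf[OF closed_outer] Vh_0] by simp
  have "stiff T (hat D q) (hat D p) = 0 \<and> mass T (hat D q) (hat D p) = 0" if T: "T \<in> cells i" for T
    using out stiff_mass_zero[OF cells_mesh[OF T], of "hat D p" "hat D q"] stiff_mass_zero[OF cells_mesh[OF T], of "hat D q" "hat D p"]
      hat_zero_cells[OF i pq(1) _ T] hat_zero_cells[OF i pq(2) _ T] by blast
  then show "Bloc D i p q = 0" "Hloc D i p q = 0"
    unfolding Bloc_def Hloc_def b_form_loc_meshed[OF i hat_Vh hat_Vh] H_ip_meshed[OF meshed_sub[OF i] hat_Vh hat_Vh] s by simp_all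
qed

lemma H_norm_sub_eq_0:
  assumes "i < nsub D" "H_norm D (sub D i) (fe_fun D c) = 0" "p \<in> nodes_cl i" shows "c p = 0"
proof -
  have "p \<in> nodes D" "p \<in> \<Union>(cells i)" using assms nodes_cl_eq Un_cells by auto
  then show ?thesis using H_norm_eq_0[OF meshed_sub[OF assms(1)] fe_fun_Vh assms(2), of p] fe_fun_node by metis
qed

lemma H_norm_Omega_eq_0:
  assumes "u \<in> Vh D" "H_norm D (Omega D) u = 0" shows "u = 0"
proof
  fix x show "u x = 0 x"
    using H_norm_eq_0[OF meshed_Omega assms] Vh_zero[OF assms(1)] Un_mesh by (cases "x \<in> closure (Omega D)") auto
qed

lemma mesh_size_nonneg: "0 \<le> mesh_size D"
proof -
  have ne: "mesh D \<noteq> {}" using Un_mesh Omega_nonempty closure_subset[of "Omega D"] by auto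
  then obtain T where T: "T \<in> mesh D" by blast
  have "0 \<le> diameter T" using mesh_compact[OF T] compact_imp_bounded diameter_ge_0 by blast
  also have "\<dots> \<le> mesh_size D" unfolding mesh_size_def using finite_mesh T by (intro Max_ge) auto
  finally show ?thesis .
qed

section \<open>The energy norm\<close>

abbreviation ip :: "('a \<Rightarrow> complex) \<Rightarrow> ('a \<Rightarrow> complex) \<Rightarrow> complex" where "ip \<equiv> H_ip D (Omega D)"
abbreviation nrm :: "('a \<Rightarrow> complex) \<Rightarrow> real" where "nrm \<equiv> H_norm D (Omega D)"

lemmas ip_sesq = sesqD[OF sesq_H_ip[OF meshed_Omega]]
lemmas ip_norm = H_ip_norm(1)[OF meshed_Omega]
lemmas nrm_nonneg = H_ip_norm(2)[OF meshed_Omega]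

lemma ip_cauchy_schwarz:
  assumes u: "u \<in> Vh D" and v: "v \<in> Vh D"
  shows "cmod (ip u v) \<le> nrm u * nrm v"
proof (cases "v = 0")
  case True
  then have "ip u v = 0" using sesq_zero(2)[OF sesq_H_ip[OF meshed_Omega] u] by (simp add: zero_fun_def)
  then show ?thesis using nrm_nonneg[OF u] nrm_nonneg[OF v] by simp
next
  case False
  then have c: "0 < nrm v" using H_norm_Omega_eq_0[OF v] nrm_nonneg[OF v] by force
  \<comment> \<open>Minus the coefficient of the orthogonal projection of \<open>u\<close> onto
    \<open>v\<close>. The remainder \<open>?w\<close> is orthogonal to \<open>v\<close>, and the
    claim is the nonnegativity of its squared norm.\<close>
  define a where "a = - ip u v / complex_of_real ((nrm v)\<^sup>2)"
  let ?w = "\<lambda>x. 1 * u x + a * v x"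
  have w: "?w \<in> Vh D" using u v by (rule Vh_combine)
  have av: "a * complex_of_real ((nrm v)\<^sup>2) = - ip u v" unfolding a_def using c by simp
  have "complex_of_real ((nrm ?w)\<^sup>2) = ip u ?w + a * ip v ?w"
    unfolding ip_norm[OF w, symmetric] by (subst ip_sesq(1)[OF u v w]) simp
  also have "ip v ?w = cnj (ip u v) + cnj a * ip v v"
    using ip_sesq(2)[OF u v v, of 1 a] H_ip_swap[of "Omega D" v u] by simp
  also have "ip u ?w = ip u u + cnj a * ip u v" using ip_sesq(2)[OF u v u, of 1 a] by simp
  also have "a * (cnj (ip u v) + cnj a * ip v v) = 0"
    using arg_cong[OF av, of cnj] unfolding ip_norm[OF v] by (simp add: mult.commute)
  also have "cnj a * ip u v = - complex_of_real ((cmod (ip u v))\<^sup>2 / (nrm v)\<^sup>2)"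
    unfolding a_def of_real_divide complex_norm_square[of "ip u v"] by (simp add: mult.commute)
  finally have "complex_of_real ((nrm ?w)\<^sup>2) = complex_of_real ((nrm u)\<^sup>2 - (cmod (ip u v))\<^sup>2 / (nrm v)\<^sup>2)"
    unfolding ip_norm[OF u] by simp
  then have "0 \<le> (nrm u)\<^sup>2 - (cmod (ip u v))\<^sup>2 / (nrm v)\<^sup>2" unfolding of_real_eq_iff by (metis zero_le_power2)
  then have "(cmod (ip u v))\<^sup>2 \<le> (nrm u * nrm v)\<^sup>2" using c by (simp add: field_simps power_mult_distrib)
  then show ?thesis by (rule power2_le_imp_le) (simp add: nrm_nonneg u v)
qed

lemma nrm_triangle:
  assumes u: "u \<in> Vh D" and v: "v \<in> Vh D"
  shows "nrm (\<lambda>x. u x + v x) \<le> nrm u + nrm v"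
proof -
  let ?w = "\<lambda>x. 1 * u x + 1 * v x"
  have w: "?w \<in> Vh D" using u v by (rule Vh_combine)
  have "complex_of_real ((nrm ?w)\<^sup>2) = ip u ?w + ip v ?w"
    unfolding ip_norm[OF w, symmetric] by (subst ip_sesq(1)[OF u v w]) simp
  also have "\<dots> = complex_of_real ((nrm u)\<^sup>2) + complex_of_real ((nrm v)\<^sup>2) + (ip u v + cnj (ip u v))"
    using ip_sesq(2)[OF u v u, of 1 1] ip_sesq(2)[OF u v v, of 1 1] H_ip_swap[of "Omega D" v u] ip_norm[OF u] ip_norm[OF v] by simp
  finally have "(nrm ?w)\<^sup>2 = (nrm u)\<^sup>2 + (nrm v)\<^sup>2 + 2 * Re (ip u v)"
    unfolding complex_add_cnj of_real_add[symmetric] of_real_eq_iff by simp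
  also have "\<dots> \<le> (nrm u + nrm v)\<^sup>2"
    using complex_Re_le_cmod[of "ip u v"] ip_cauchy_schwarz[OF u v] by (simp add: power2_sum)
  finally have "nrm ?w \<le> nrm u + nrm v" by (rule power2_le_imp_le) (simp add: nrm_nonneg u v)
  then show ?thesis by simp
qed

lemma fe_fun_add: "fe_fun D (\<lambda>p. u p + v p) = (\<lambda>x. fe_fun D u x + fe_fun D v x)"
  unfolding fe_fun_def by (simp add: distrib_right sum.distrib)

lemma fe_fun_scale: "fe_fun D (\<lambda>p. a * u p) = (\<lambda>x. a * fe_fun D u x)"
  unfolding fe_fun_def by (simp add: sum_distrib_left mult.assoc)

lemma fe_fun_cong: "(\<And>p. p \<in> nodes D \<Longrightarrow> u p = v p) \<Longrightarrow> fe_fun D u = fe_fun D v"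
  unfolding fe_fun_def by simp

lemma ip_scale: assumes u: "u \<in> Vh D" and v: "v \<in> Vh D"
  shows "ip (\<lambda>x. a * u x) (\<lambda>x. a * v x) = complex_of_real ((cmod a)\<^sup>2) * ip u v"
proof -
  have v': "(\<lambda>x. a * v x) \<in> Vh D" using Vh_combine[OF v v, of a 0] by simp
  show ?thesis
    using ip_sesq(1)[OF u u v', of a 0] ip_sesq(2)[OF v v u, of a 0] unfolding complex_norm_square by simp
qed

lemma nrm_scale: assumes u: "u \<in> Vh D" shows "nrm (\<lambda>x. a * u x) = cmod a * nrm u"
proof -
  have au: "(\<lambda>x. a * u x) \<in> Vh D" using Vh_combine[OF u u, of a 0] by simp
  have "complex_of_real ((nrm (\<lambda>x. a * u x))\<^sup>2) = complex_of_real ((cmod a * nrm u)\<^sup>2)"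
    unfolding ip_norm[OF au, symmetric] ip_scale[OF u u] ip_norm[OF u] by (simp add: power_mult_distrib)
  then have "(nrm (\<lambda>x. a * u x))\<^sup>2 = (cmod a * nrm u)\<^sup>2" unfolding of_real_eq_iff .
  then show ?thesis using nrm_nonneg[OF u] nrm_nonneg[OF au] by (simp add: power2_eq_iff_nonneg)
qed

section \<open>Attainment of extrema of scaling-invariant functionals\<close>

lemma nodes_nonempty: "nodes D \<noteq> {}"
proof -
  obtain T where T: "T \<in> mesh D" using Un_mesh Omega_nonempty closure_subset[of "Omega D"] by auto
  then have "T \<noteq> {}" using mesh_interior_nonempty interior_subset by blast
  then have "vert T \<noteq> {}" using mesh_hull[OF T] by auto
  then show ?thesis using T unfolding nodes_def by blast
qed

text \<open>Nodal vectors are total functions; fixing them to zero off the nodes makes the unit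
  sphere compact in the product topology.\<close>

definition sphere_nodal :: "('a \<Rightarrow> complex) set"
  where "sphere_nodal = {c. (\<forall>p. p \<notin> nodes D \<longrightarrow> c p = 0) \<and> (\<Sum>p\<in>nodes D. (cmod (c p))\<^sup>2) = 1}"

text \<open>A closed subset of a product of unit disks at the nodes and of singletons elsewhere,
  which is compact by Tychonoff.\<close>

lemma compact_sphere_nodal: "compact sphere_nodal"
proof -
  let ?S = "\<lambda>p. if p \<in> nodes D then cball (0::complex) 1 else {0}"
  have "compactin (product_topology (\<lambda>_. euclidean) UNIV) (PiE UNIV ?S)"
    unfolding compactin_PiE by auto
  then have "compact (PiE UNIV ?S)" unfolding euclidean_product_topology compactin_euclidean_iff .
  moreover have "closed {c::'a \<Rightarrow> complex. (\<Sum>p\<in>nodes D. (cmod (c p))\<^sup>2) = 1}"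
    by (intro closed_Collect_eq continuous_intros continuous_on_product_coordinates)
  ultimately have "compact (PiE UNIV ?S \<inter> {c. (\<Sum>p\<in>nodes D. (cmod (c p))\<^sup>2) = 1})" by (rule compact_Int_closed)
  moreover have "PiE UNIV ?S \<inter> {c. (\<Sum>p\<in>nodes D. (cmod (c p))\<^sup>2) = 1} = sphere_nodal"
  proof -
    have "cmod (c p) \<le> 1" if "(\<Sum>p\<in>nodes D. (cmod (c p))\<^sup>2) = 1" "p \<in> nodes D" for c :: "'a \<Rightarrow> complex" and p
    proof -
      have "(cmod (c p))\<^sup>2 \<le> (\<Sum>p\<in>nodes D. (cmod (c p))\<^sup>2)" using finite_nodes that(2) by (intro member_le_sum) auto
      then show ?thesis using that(1) by (simp add: abs_square_le_1)
    qed
    then show ?thesis unfolding sphere_nodal_def PiE_UNIV_domain by (auto simp: Pi_iff split: if_splits)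
  qed
  ultimately show ?thesis by simp
qed

lemma sphere_nodal_nonempty: "sphere_nodal \<noteq> {}"
proof -
  obtain p where p: "p \<in> nodes D" using nodes_nonempty by blast
  have "(\<Sum>q\<in>nodes D. (cmod (of_bool (q = p)))\<^sup>2) = (\<Sum>q\<in>nodes D. if q = p then 1 else (0::real))" by (intro sum.cong) auto
  then have "(\<lambda>q. of_bool (q = p)) \<in> sphere_nodal" unfolding sphere_nodal_def using p finite_nodes by auto
  then show ?thesis by blast
qed

lemma sphere_nodal_Vh: "c \<in> sphere_nodal \<Longrightarrow> fe_fun D c \<in> Vh D - {0}"
proof
  assume c: "c \<in> sphere_nodal"
  show "fe_fun D c \<notin> {0}"
  proof
    assume "fe_fun D c \<in> {0}"
    then have "c p = 0" if "p \<in> nodes D" for p using fe_fun_node[OF that, of c] by simp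
    then show False using c unfolding sphere_nodal_def by simp
  qed
qed (rule fe_fun_Vh)

lemma sphere_nodal_scale:
  assumes "w \<in> Vh D - {0}"
  obtains c s where "c \<in> sphere_nodal" "0 < s" "\<And>p. p \<in> nodes D \<Longrightarrow> c p = complex_of_real s * w p"
proof -
  let ?r = "\<Sum>p\<in>nodes D. (cmod (w p))\<^sup>2"
  have "\<exists>p\<in>nodes D. w p \<noteq> 0"
    using Vh_eqI[of w "\<lambda>_. 0"] assms Vh_0 by (auto simp: zero_fun_def)
  then have "?r > 0" using finite_nodes by (auto intro!: sum_pos2)
  then have r: "1 / sqrt ?r > 0" "(1 / sqrt ?r)\<^sup>2 * ?r = 1" by (auto simp: power_divide)
  define c where "c p = (if p \<in> nodes D then complex_of_real (1 / sqrt ?r) * w p else 0)" for p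
  have "(\<Sum>p\<in>nodes D. (cmod (c p))\<^sup>2) = (1 / sqrt ?r)\<^sup>2 * ?r"
    unfolding sum_distrib_left c_def using r(1) by (intro sum.cong) (auto simp: norm_mult power_mult_distrib norm_divide power_divide)
  then have "c \<in> sphere_nodal" unfolding sphere_nodal_def using r(2) by (simp add: c_def)
  then show ?thesis using that[of c "1 / sqrt ?r"] r(1) by (simp add: c_def)
qed

lemma ip_continuous:
  assumes "\<And>p. continuous_on K (\<lambda>c. f c p)" "\<And>p. continuous_on K (\<lambda>c. g c p)"
  shows "continuous_on K (\<lambda>c. ip (fe_fun D (f c)) (fe_fun D (g c)))"
  unfolding sesq_fe_fun[OF sesq_H_ip[OF meshed_Omega]] using assms by (intro continuous_intros)

lemma nrm_continuous:
  assumes "\<And>p. continuous_on K (\<lambda>c. f c p)"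
  shows "continuous_on K (\<lambda>c. nrm (fe_fun D (f c)))"
proof -
  have "nrm (fe_fun D c) = sqrt (Re (ip (fe_fun D c) (fe_fun D c)))" for c
    using nrm_nonneg[OF fe_fun_Vh] unfolding ip_norm[OF fe_fun_Vh] by simp
  then show ?thesis using ip_continuous[OF assms assms] by (auto intro!: continuous_intros)
qed

text \<open>Scaling invariance means that every value of \<open>F\<close> on nonzero functions is
  already taken on the nodal unit sphere, where a continuous function attains its bounds.\<close>

lemma attains_on_Vh:
  fixes F :: "('a \<Rightarrow> complex) \<Rightarrow> real"
  assumes cont: "continuous_on sphere_nodal (\<lambda>c. F (fe_fun D c))"
    and hom: "\<And>c s w. w \<in> Vh D \<Longrightarrow> 0 < s \<Longrightarrow> F (\<lambda>x. complex_of_real s * w x) = F w"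
  shows "\<exists>v\<in>Vh D - {0}. is_arg_max F (\<lambda>w. w \<in> Vh D - {0}) v" "\<exists>v\<in>Vh D - {0}. is_arg_min F (\<lambda>w. w \<in> Vh D - {0}) v"
proof -
  have red: "\<exists>c\<in>sphere_nodal. F (fe_fun D c) = F w" if w: "w \<in> Vh D - {0}" for w
  proof -
    obtain c s where c: "c \<in> sphere_nodal" "0 < s" "\<And>p. p \<in> nodes D \<Longrightarrow> c p = complex_of_real s * w p"
      using sphere_nodal_scale[OF w] by metis
    have "fe_fun D c = (\<lambda>x. complex_of_real s * fe_fun D w x)"
      unfolding fe_fun_scale[symmetric] by (rule fe_fun_cong) (rule c(3))
    then have "F (fe_fun D c) = F w" using hom[of w s] c(2) w fe_fun_id[of w] by simp
    then show ?thesis using c(1) by blast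
  qed
  obtain c where c: "c \<in> sphere_nodal" "\<And>y. y \<in> sphere_nodal \<Longrightarrow> F (fe_fun D y) \<le> F (fe_fun D c)"
    using continuous_attains_sup[OF compact_sphere_nodal sphere_nodal_nonempty cont] by blast
  have "\<not> F (fe_fun D c) < F w" if "w \<in> Vh D - {0}" for w using red[OF that] c(2) by force
  then show "\<exists>v\<in>Vh D - {0}. is_arg_max F (\<lambda>w. w \<in> Vh D - {0}) v"
    using sphere_nodal_Vh[OF c(1)] unfolding is_arg_max_def by blast
  obtain c where c: "c \<in> sphere_nodal" "\<And>y. y \<in> sphere_nodal \<Longrightarrow> F (fe_fun D c) \<le> F (fe_fun D y)"
    using continuous_attains_inf[OF compact_sphere_nodal sphere_nodal_nonempty cont] by blast
  have "\<not> F w < F (fe_fun D c)" if "w \<in> Vh D - {0}" for w using red[OF that] c(2) by force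
  then show "\<exists>v\<in>Vh D - {0}. is_arg_min F (\<lambda>w. w \<in> Vh D - {0}) v"
    using sphere_nodal_Vh[OF c(1)] unfolding is_arg_min_def by blast
qed

end

section \<open>Linear algebra over finite index sets\<close>

text \<open>Bilinear, without conjugation, to match transposes and complex symmetric matrices. Where
  an energy is meant, the conjugate is written out.\<close>

definition dot :: "'r set \<Rightarrow> ('r \<Rightarrow> complex) \<Rightarrow> ('r \<Rightarrow> complex) \<Rightarrow> complex"
  where "dot J w x = (\<Sum>p\<in>J. w p * x p)"

lemma mapply_mprod: "mapply (A \<odot>\<^bsub>J\<^esub> B) K u = mapply A J (mapply B K u)"
  unfolding mapply_def mprod_def
  by (auto simp: sum_distrib_left sum_distrib_right mult.assoc intro: sum.swap)

lemma dot_mapply: "dot J w (mapply A K x) = dot K (mapply (tr A) J w) x"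
  unfolding dot_def mapply_def tr_def
  by (simp add: sum_distrib_left sum_distrib_right mult_ac) (rule sum.swap)

lemma tr_tr [simp]: "tr (tr A) = A"
  unfolding tr_def by simp

lemma dot_mapply_tr: "dot J w (mapply (tr A) K x) = dot K (mapply A J w) x"
  by (simp add: dot_mapply)

lemma tr_mprod: "tr (A \<odot>\<^bsub>J\<^esub> B) = tr B \<odot>\<^bsub>J\<^esub> tr A"
  unfolding tr_def mprod_def by (simp add: mult.commute)

lemma mprod_assoc: "A \<odot>\<^bsub>J\<^esub> B \<odot>\<^bsub>K\<^esub> C = A \<odot>\<^bsub>J\<^esub> (B \<odot>\<^bsub>K\<^esub> C)"
  unfolding mprod_def fun_eq_iff
  by (auto simp: sum_distrib_left sum_distrib_right mult.assoc intro: sum.swap)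

lemma mapply_cong: "(\<And>p. p \<in> J \<Longrightarrow> u p = v p) \<Longrightarrow> mapply A J u = mapply A J v"
  unfolding mapply_def by simp

lemma mapply_cong2: "(\<And>p. p \<in> J \<Longrightarrow> A x p * u p = B x p * v p) \<Longrightarrow> mapply A J u x = mapply B J v x"
  unfolding mapply_def by simp

lemma dot_cong: "(\<And>p. p \<in> J \<Longrightarrow> u p = u' p) \<Longrightarrow> (\<And>p. p \<in> J \<Longrightarrow> v p = v' p) \<Longrightarrow> dot J u v = dot J u' v'"
  unfolding dot_def by simp

lemma dot_commute: "dot J u v = dot J v u"
  unfolding dot_def by (simp add: mult.commute)

lemma mapply_add: "mapply A J (\<lambda>p. u p + v p) = (\<lambda>x. mapply A J u x + mapply A J v x)"
  unfolding mapply_def by (simp add: distrib_left sum.distrib)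

lemma mapply_diff: "mapply A J (\<lambda>p. u p - v p) = (\<lambda>x. mapply A J u x - mapply A J v x)"
  unfolding mapply_def by (simp add: right_diff_distrib sum_subtractf)

lemma mapply_scale: "mapply A J (\<lambda>p. c * u p) = (\<lambda>x. c * mapply A J u x)"
  unfolding mapply_def by (simp add: sum_distrib_left mult_ac)

lemma mapply_plus: "mapply (A + B) J u = (\<lambda>x. mapply A J u x + mapply B J u x)"
  unfolding mapply_def by (simp add: distrib_right sum.distrib)

lemma mapply_minus: "mapply (A - B) J u = (\<lambda>x. mapply A J u x - mapply B J u x)"
  unfolding mapply_def by (simp add: left_diff_distrib sum_subtractf)

lemma mapply_scl: "mapply (scl c A) J u = (\<lambda>x. c * mapply A J u x)"
  unfolding mapply_def scl_def by (simp add: sum_distrib_left mult_ac)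

lemma sum_fun_apply: "(\<Sum>i\<in>I. f i) x = (\<Sum>i\<in>I. f i x)"
  by (induction I rule: infinite_finite_induct) auto

lemma mapply_sum: "mapply (\<Sum>i\<in>I. A i) J u = (\<lambda>x. \<Sum>i\<in>I. mapply (A i) J u x)"
  unfolding mapply_def sum_fun_apply by (subst sum.swap) (simp add: sum_distrib_right)

lemma mapply_idM: "finite J \<Longrightarrow> x \<in> J \<Longrightarrow> mapply idM J u x = u x"
  unfolding mapply_def idM_def by simp

lemma dot_add_left: "dot J (\<lambda>p. u p + v p) w = dot J u w + dot J v w"
  and dot_add_right: "dot J w (\<lambda>p. u p + v p) = dot J w u + dot J w v"
  and dot_diff_right: "dot J w (\<lambda>p. u p - v p) = dot J w u - dot J w v"
  and dot_scale_right: "dot J w (\<lambda>p. c * u p) = c * dot J w u"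
  unfolding dot_def by (simp_all add: distrib_left distrib_right right_diff_distrib
      sum.distrib sum_subtractf sum_distrib_left mult_ac)

section \<open>Kernels, solvability and inverses\<close>

lemma nontrivial_kernel:
  fixes A :: "'k \<Rightarrow> 'j \<Rightarrow> complex"
  assumes "finite K" "finite J" "card K < card J"
  shows "\<exists>u. (\<exists>p\<in>J. u p \<noteq> 0) \<and> (\<forall>k\<in>K. mapply A J u k = 0)"
  using assms
proof (induction K arbitrary: J A rule: finite_induct)
  case empty
  then have "J \<noteq> {}" by auto
  then show ?case by (intro exI[of _ "\<lambda>_. 1"]) auto
next
  case (insert k K)
  show ?case
  proof (cases "\<forall>p\<in>J. A k p = 0")
    case True
    have "card K < card J" using insert by simp
    then obtain u where "\<exists>p\<in>J. u p \<noteq> 0" "\<forall>k\<in>K. mapply A J u k = 0" using insert.IH[of J A] insert.prems(1) by auto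
    then show ?thesis using True by (intro exI[of _ u]) (auto simp: mapply_def)
  next
    case False
    then obtain p0 where p0: "p0 \<in> J" "A k p0 \<noteq> 0" by blast
    let ?J = "J - {p0}"
    \<comment> \<open>One step of Gaussian elimination with pivot \<open>A k p0\<close>. It removes
      one row and one column, so there are still more unknowns than equations.\<close>
    let ?A = "\<lambda>l p. A l p - A l p0 * A k p / A k p0"
    have "card K < card ?J" "finite ?J" using insert p0 by auto
    then obtain u where u: "\<exists>p\<in>?J. u p \<noteq> 0" "\<forall>l\<in>K. mapply ?A ?J u l = 0" using insert.IH[of ?J ?A] by auto
    define s where "s = (\<Sum>p\<in>?J. A k p * u p)"
    \<comment> \<open>The eliminated component is chosen so that row \<open>k\<close> is
      satisfied.\<close>
    define v where "v p = (if p = p0 then - s / A k p0 else u p)" for p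
    have split: "mapply A J v l = A l p0 * (- s / A k p0) + (\<Sum>p\<in>?J. A l p * u p)" for l
      unfolding mapply_def sum.remove[OF insert.prems(1) p0(1)] by (simp add: v_def)
    have "mapply A J v l = mapply ?A ?J u l" for l
      unfolding split unfolding mapply_def s_def
      by (simp add: right_diff_distrib sum_subtractf sum_distrib_left sum_divide_distrib mult_ac)
    then have "\<forall>l\<in>K. mapply A J v l = 0" using u(2) by simp
    moreover have "mapply A J v k = 0" unfolding split using p0 by (simp add: s_def)
    moreover have "\<exists>p\<in>J. v p \<noteq> 0" using u(1) by (auto simp: v_def)
    ultimately show ?thesis by blast
  qed
qed

text \<open>Appending \<open>- y\<close> as a further column, indexed by \<open>None\<close>, leaves
  more columns than rows, hence a nonzero kernel vector. Injectivity rules out that its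
  \<open>None\<close> component is zero, and dividing by that component gives the solution.\<close>

lemma injective_imp_surjective:
  fixes A :: "'k \<Rightarrow> 'j \<Rightarrow> complex"
  assumes fin: "finite K" "finite J" and card: "card K \<le> card J"
    and inj: "\<And>u. (\<And>k. k \<in> K \<Longrightarrow> mapply A J u k = 0) \<Longrightarrow> \<forall>p\<in>J. u p = 0"
  shows "\<exists>u. \<forall>k\<in>K. mapply A J u k = y k"
proof -
  let ?J = "insert None (Some ` J)"
  let ?A = "\<lambda>k. case_option (- y k) (A k)"
  have c: "card ?J = Suc (card J)" using fin by (subst card_insert_disjoint) (auto simp: card_image)
  have sum: "mapply ?A ?J u k = mapply A J (\<lambda>p. u (Some p)) k - y k * u None" for u k
    unfolding mapply_def using fin by (simp add: sum.reindex)
  from c card have "card K < card ?J" by simp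
  with nontrivial_kernel[OF fin(1), of ?J ?A] fin(2)
  obtain u where u: "\<exists>p\<in>?J. u p \<noteq> 0" "\<forall>k\<in>K. mapply ?A ?J u k = 0" by auto
  have nz: "u None \<noteq> 0"
  proof
    assume 0: "u None = 0"
    then have "\<forall>p\<in>J. u (Some p) = 0" using inj[of "\<lambda>p. u (Some p)"] u(2) unfolding sum by simp
    then show False using u(1) 0 by auto
  qed
  have "\<forall>k\<in>K. mapply A J (\<lambda>p. inverse (u None) * u (Some p)) k = y k"
    using u(2) nz unfolding sum mapply_scale by (simp add: field_simps)
  then show ?thesis by blast
qed

text \<open>\<open>minv\<close> is a choice, so an inverse has to be exhibited. Surjectivity yields
  a right inverse \<open>Y\<close>; it is a left inverse too, because A maps the columns of
  \<open>Y A - I\<close> to zero and is injective.\<close>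

lemma minv_inverse:
  assumes fin: "finite J" and inj: "\<And>u. (\<And>k. k \<in> J \<Longrightarrow> mapply A J u k = 0) \<Longrightarrow> \<forall>p\<in>J. u p = 0"
  shows "x \<in> J \<Longrightarrow> y \<in> J \<Longrightarrow> (A \<odot>\<^bsub>J\<^esub> minv J A) x y = idM x y"
proof -
  have "\<forall>y. \<exists>u. \<forall>k\<in>J. mapply A J u k = idM k y"
    by (intro allI injective_imp_surjective[OF fin fin order_refl inj])
  from choice[OF this] obtain X where X: "\<And>y k. k \<in> J \<Longrightarrow> mapply A J (X y) k = idM k y" by blast
  define Y where "Y p y = X y p" for p y
  have AY: "(A \<odot>\<^bsub>J\<^esub> Y) x y = idM x y" if "x \<in> J" for x y
    using X[OF that] unfolding mprod_def mapply_def Y_def by simp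
  have YA: "(Y \<odot>\<^bsub>J\<^esub> A) x y = idM x y" if xy: "x \<in> J" "y \<in> J" for x y
  proof -
    have "mapply A J (\<lambda>p. (Y \<odot>\<^bsub>J\<^esub> A) p y - idM p y) k = 0" if k: "k \<in> J" for k
    proof -
      have "mapply A J (\<lambda>p. (Y \<odot>\<^bsub>J\<^esub> A) p y) k = (A \<odot>\<^bsub>J\<^esub> (Y \<odot>\<^bsub>J\<^esub> A)) k y"
        unfolding mapply_def mprod_def ..
      also have "\<dots> = (\<Sum>j\<in>J. idM k j * A j y)"
        unfolding mprod_assoc[symmetric] by (simp add: mprod_def[of "A \<odot>\<^bsub>J\<^esub> Y"] AY[OF k])
      also have "\<dots> = A k y" using fin k unfolding idM_def by simp
      also have "\<dots> = mapply A J (\<lambda>p. idM p y) k" using fin xy unfolding mapply_def idM_def by simp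
      finally show ?thesis unfolding mapply_diff by simp
    qed
    from inj[OF this] xy(1) show ?thesis by simp
  qed
  have "\<exists>X. \<forall>x\<in>J. \<forall>y\<in>J. (A \<odot>\<^bsub>J\<^esub> X) x y = idM x y \<and> (X \<odot>\<^bsub>J\<^esub> A) x y = idM x y"
    using AY YA by blast
  from someI_ex[OF this] show "x \<in> J \<Longrightarrow> y \<in> J \<Longrightarrow> (A \<odot>\<^bsub>J\<^esub> minv J A) x y = idM x y"
    unfolding minv_def by blast
qed

lemma mapply_minv:
  assumes fin: "finite J" and inj: "\<And>u. (\<And>k. k \<in> J \<Longrightarrow> mapply A J u k = 0) \<Longrightarrow> \<forall>p\<in>J. u p = 0" and x: "x \<in> J"
  shows "mapply A J (mapply (minv J A) J u) x = u x"
proof -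
  have "mapply A J (mapply (minv J A) J u) x = mapply (A \<odot>\<^bsub>J\<^esub> minv J A) J u x" by (simp add: mapply_mprod)
  also have "\<dots> = mapply idM J u x" using minv_inverse[OF fin inj x] by (intro mapply_cong2) simp
  finally show ?thesis using fin x by (simp add: mapply_idM)
qed

lemma minv_diagonal:
  assumes fin: "finite J" and diag: "\<And>j l. j \<in> J \<Longrightarrow> l \<in> J \<Longrightarrow> A j l = (if j = l then d j else 0)"
    and nz: "\<And>j. j \<in> J \<Longrightarrow> d j \<noteq> 0" and jl: "j \<in> J" "l \<in> J"
  shows "minv J A j l = (if j = l then 1 / d j else 0)"
proof -
  have app: "(\<Sum>l\<in>J. A k l * u l) = d k * u k" if "k \<in> J" for k u
  proof -
    have "(\<Sum>l\<in>J. A k l * u l) = (\<Sum>l\<in>J. if k = l then d k * u l else 0)"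
      by (intro sum.cong refl) (simp add: diag that)
    then show ?thesis using fin that by simp
  qed
  have "(A \<odot>\<^bsub>J\<^esub> minv J A) j l = idM j l"
  proof (rule minv_inverse[OF fin _ jl])
    fix u assume "\<And>k. k \<in> J \<Longrightarrow> mapply A J u k = 0"
    then show "\<forall>p\<in>J. u p = 0" using nz app[of _ u] unfolding mapply_def by auto
  qed
  then have "d j * minv J A j l = idM j l" unfolding mprod_def using app[OF jl(1), of "\<lambda>j. minv J A j l"] by simp
  then show ?thesis using nz[OF jl(1)] unfolding idM_def by (auto simp: field_simps split: if_splits)
qed

lemma norm_sum_mult_le:
  fixes w x :: "'i \<Rightarrow> complex"
  assumes r: "\<And>j. j \<in> S \<Longrightarrow> \<bar>r j\<bar> \<le> \<eta>" and "0 \<le> \<eta>"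
  shows "cmod (\<Sum>j\<in>S. complex_of_real (r j) * (w j * x j))
    \<le> \<eta> * (sqrt (\<Sum>j\<in>S. (cmod (w j))\<^sup>2) * sqrt (\<Sum>j\<in>S. (cmod (x j))\<^sup>2))"
proof -
  have "cmod (\<Sum>j\<in>S. complex_of_real (r j) * (w j * x j)) \<le> (\<Sum>j\<in>S. \<bar>r j\<bar> * (cmod (w j) * cmod (x j)))"
    by (rule order_trans[OF norm_sum]) (simp add: norm_mult)
  also have "\<dots> \<le> (\<Sum>j\<in>S. \<eta> * (cmod (w j) * cmod (x j)))"
    using r by (intro sum_mono mult_right_mono) auto
  also have "\<dots> = \<eta> * (\<Sum>j\<in>S. \<bar>cmod (w j)\<bar> * \<bar>cmod (x j)\<bar>)" by (simp add: sum_distrib_left)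
  also have "\<dots> \<le> \<eta> * (L2_set (\<lambda>j. cmod (w j)) S * L2_set (\<lambda>j. cmod (x j)) S)"
    by (intro mult_left_mono L2_set_mult_ineq assms(2))
  finally show ?thesis unfolding L2_set_def .
qed

section \<open>Coordinates with respect to an eigensystem\<close>

definition energy :: "'r set \<Rightarrow> ('r, 'r) mtx \<Rightarrow> ('r \<Rightarrow> complex) \<Rightarrow> real"
  where "energy J W u = Re (dot J (\<lambda>p. cnj (u p)) (mapply W J u))"

lemma colsM_cnj: "cnj (mapply (colsM x) S c p) = mapply (colsM x) S (\<lambda>j. cnj (c j)) p"
  unfolding mapply_def colsM_def by simp

text \<open>For columns that are orthonormal with respect to \<open>W\<close>, the matrix inverse to
  the basis is its transpose times \<open>W\<close>, so this is the coordinate vector of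
  \<open>u\<close>.\<close>

definition eigcoord :: "'r set \<Rightarrow> ('r, 'r) mtx \<Rightarrow> (nat \<Rightarrow> 'r \<Rightarrow> real) \<Rightarrow> ('r \<Rightarrow> complex) \<Rightarrow> nat \<Rightarrow> complex"
  where "eigcoord J W x u = mapply (tr (colsM x)) J (mapply W J u)"

lemma eigcoord_cong: "(\<And>p. p \<in> J \<Longrightarrow> u p = v p) \<Longrightarrow> eigcoord J W x u = eigcoord J W x v"
  unfolding eigcoord_def by (simp cong: mapply_cong)

context
  fixes J :: "'r set" and A M W :: "('r, 'r) mtx" and lam :: "nat \<Rightarrow> real" and x :: "nat \<Rightarrow> 'r \<Rightarrow> real"
  assumes fin: "finite J" and eig: "eigensystem J A M W lam x"
begin

private abbreviation (input) X where "X \<equiv> colsM x"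
private abbreviation (input) n where "n \<equiv> card J"

lemma eigcoord_combination: assumes "j < n" shows "eigcoord J W x (mapply X {..<n} c) j = c j"
proof -
  have "eigcoord J W x (mapply X {..<n} c) j = mapply (tr X \<odot>\<^bsub>J\<^esub> W \<odot>\<^bsub>J\<^esub> X) {..<n} c j"
    unfolding eigcoord_def mapply_mprod ..
  also have "\<dots> = mapply idM {..<n} c j"
    using eig assms unfolding eigensystem_def by (intro mapply_cong2) simp
  finally show ?thesis using assms by (simp add: mapply_idM)
qed

text \<open>By \<open>eigcoord_combination\<close> the square matrix of eigenvectors has a left
  inverse. It is therefore injective and hence surjective: the eigenvectors span. Everything below,
  including the nonnegativity of the energy, is read off in these coordinates.\<close>

lemma eig_expansion: assumes p: "p \<in> J" shows "u p = mapply X {..<n} (eigcoord J W x u) p"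
proof -
  have "\<exists>c. \<forall>p\<in>J. mapply X {..<n} c p = u p"
  proof (rule injective_imp_surjective[OF fin])
    fix c assume "\<And>k. k \<in> J \<Longrightarrow> mapply X {..<n} c k = 0"
    then have "eigcoord J W x (mapply X {..<n} c) = eigcoord J W x (\<lambda>_. 0)" by (intro eigcoord_cong) simp
    then show "\<forall>j\<in>{..<n}. c j = 0"
      using eigcoord_combination[of _ c] by (auto simp: eigcoord_def mapply_def)
  qed simp_all
  then obtain c where c: "\<And>p. p \<in> J \<Longrightarrow> mapply X {..<n} c p = u p" by blast
  have "eigcoord J W x u j = c j" if "j < n" for j
    using eigcoord_combination[OF that, of c] eigcoord_cong[of J, OF c] by simp
  then have "mapply X {..<n} (eigcoord J W x u) = mapply X {..<n} c" by (intro mapply_cong) simp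
  then show ?thesis using c[OF p] by simp
qed

lemma eig_dot: "dot J w (mapply W J u) = (\<Sum>j<n. eigcoord J W x w j * eigcoord J W x u j)"
proof -
  have "dot J w (mapply W J u) = dot J (mapply X {..<n} (eigcoord J W x w)) (mapply W J u)"
    using eig_expansion by (intro dot_cong) auto
  also have "\<dots> = dot {..<n} (eigcoord J W x w) (eigcoord J W x u)"
    unfolding eigcoord_def dot_mapply_tr[symmetric] ..
  finally show ?thesis unfolding dot_def .
qed

lemma eigcoord_cnj: assumes "j < n" shows "eigcoord J W x (\<lambda>p. cnj (u p)) j = cnj (eigcoord J W x u j)"
proof -
  have "cnj (u p) = mapply X {..<n} (\<lambda>j. cnj (eigcoord J W x u j)) p" if "p \<in> J" for p
    using eig_expansion[OF that, of u] colsM_cnj[of x "{..<n}" "eigcoord J W x u" p] by metis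
  then have "eigcoord J W x (\<lambda>p. cnj (u p)) = eigcoord J W x (mapply X {..<n} (\<lambda>j. cnj (eigcoord J W x u j)))"
    by (rule eigcoord_cong)
  then show ?thesis using eigcoord_combination[OF assms] by simp
qed

lemma eig_energy: "energy J W u = (\<Sum>j<n. (cmod (eigcoord J W x u j))\<^sup>2)"
proof -
  have "dot J (\<lambda>p. cnj (u p)) (mapply W J u) = (\<Sum>j<n. complex_of_real ((cmod (eigcoord J W x u j))\<^sup>2))"
    unfolding eig_dot using eigcoord_cnj by (simp add: complex_norm_square mult.commute del: of_real_power)
  then show ?thesis unfolding energy_def by simp
qed

text \<open>In eigenvector coordinates \<open>A\<close> becomes \<open>t\<close> times the diagonal
  of eigenvalues. The factor \<open>t\<close> separates the right-hand matrix of the eigenproblem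
  from the matrix \<open>W\<close> of orthonormality: it is 1 for the subdomain interiors and the
  real part, and h k for the imaginary part.\<close>

lemma eig_form:
  assumes sub: "\<And>p q. p \<in> J \<Longrightarrow> q \<in> J \<Longrightarrow> M p q = complex_of_real t * W p q"
  shows "dot J w (mapply A J u) = complex_of_real t * (\<Sum>j<n. complex_of_real (lam j) * (eigcoord J W x w j * eigcoord J W x u j))"
proof -
  have A: "mapply A J u p = complex_of_real t * mapply W J (mapply X {..<n} (\<lambda>j. complex_of_real (lam j) * eigcoord J W x u j)) p"
    if p: "p \<in> J" for p
  proof -
    have "mapply A J u p = mapply A J (mapply X {..<n} (eigcoord J W x u)) p"
      using eig_expansion by (metis (no_types, lifting) mapply_cong)
    also have "\<dots> = mapply (A \<odot>\<^bsub>J\<^esub> X) {..<n} (eigcoord J W x u) p" by (simp add: mapply_mprod)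
    also have "\<dots> = mapply (M \<odot>\<^bsub>J\<^esub> X) {..<n} (\<lambda>j. complex_of_real (lam j) * eigcoord J W x u j) p"
      using eig p unfolding eigensystem_def by (intro mapply_cong2) simp
    also have "\<dots> = mapply M J (mapply X {..<n} (\<lambda>j. complex_of_real (lam j) * eigcoord J W x u j)) p"
      by (simp add: mapply_mprod)
    also have "\<dots> = complex_of_real t * mapply W J (mapply X {..<n} (\<lambda>j. complex_of_real (lam j) * eigcoord J W x u j)) p"
      using sub[OF p] unfolding mapply_def by (simp add: sum_distrib_left mult_ac)
    finally show ?thesis .
  qed
  have "dot J w (mapply A J u) = dot J w (\<lambda>p. complex_of_real t * mapply W J (mapply X {..<n} (\<lambda>j. complex_of_real (lam j) * eigcoord J W x u j)) p)"
    using A by (intro dot_cong) auto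
  also have "\<dots> = complex_of_real t * (\<Sum>j<n. eigcoord J W x w j * (complex_of_real (lam j) * eigcoord J W x u j))"
    unfolding dot_scale_right eig_dot using eigcoord_combination by simp
  finally show ?thesis by (simp add: mult_ac)
qed

end

lemma dot_restrict:
  assumes fin: "finite N" and sub: "Y \<subseteq> N"
    and K: "\<And>p q. p \<in> N \<Longrightarrow> q \<in> N \<Longrightarrow> p \<notin> Y \<or> q \<notin> Y \<Longrightarrow> A p q = 0"
  shows "dot N u (mapply A N v) = dot Y u (mapply A Y v)"
proof -
  have m: "mapply A N v p = mapply A Y v p" if "p \<in> N" for p
    unfolding mapply_def using that K fin sub by (intro sum.mono_neutral_right) auto
  have "dot N u (mapply A N v) = dot N u (mapply A Y v)" using m by (intro dot_cong) auto
  also have "\<dots> = dot Y u (mapply A Y v)"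
    unfolding dot_def mapply_def using K fin sub by (intro sum.mono_neutral_right) (auto intro!: sum.neutral)
  finally show ?thesis .
qed

lemma mapply_restr: "finite J \<Longrightarrow> Y \<subseteq> J \<Longrightarrow> mapply (restr Y) J u x = (if x \<in> Y then u x else 0)"
  unfolding mapply_def restr_def by (auto simp: of_bool_conj if_distrib cong: if_cong)

lemma mapply_tr_restr: "finite Y \<Longrightarrow> mapply (tr (restr Y)) Y u x = (if x \<in> Y then u x else 0)"
  unfolding mapply_def restr_def tr_def by (auto intro: sum.neutral simp: if_distrib cong: if_cong)

lemma continuous_on_coordinate: "continuous_on K (\<lambda>c::'b \<Rightarrow> complex. c p)"
  by (rule continuous_on_subset[OF continuous_on_product_coordinates]) simp

lemma continuous_mapply:
  assumes "\<And>p. continuous_on K (\<lambda>c. f c p)"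
  shows "continuous_on K (\<lambda>c. mapply A J (f c) p)"
  unfolding mapply_def using assms by (intro continuous_intros)

section \<open>The error of a two-step spectral selection\<close>

lemma mprod_scl_mid: "tr Q \<odot>\<^bsub>J\<^esub> scl c W \<odot>\<^bsub>J\<^esub> Q = scl c (tr Q \<odot>\<^bsub>J\<^esub> W \<odot>\<^bsub>J\<^esub> Q)"
  unfolding mprod_def scl_def by (simp add: sum_distrib_left mult_ac)

lemma energy_nonneg_eig: "finite J \<Longrightarrow> eigensystem J A M W lam x \<Longrightarrow> 0 \<le> energy J W u"
  using eig_energy[of J A M W lam x u] by (simp add: sum_nonneg)

text \<open>The common form of \<open>PiRe\<close> and \<open>PiIm\<close>, so that one estimate
  serves both selections. \<open>J1c\<close> indexes the eigenvectors left by step one, from which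
  step two forms its own combinations through \<open>Phi\<close>.\<close>

definition proj :: "'r set \<Rightarrow> ('r, 'r) mtx \<Rightarrow> nat set \<Rightarrow> nat set \<Rightarrow> nat set \<Rightarrow> ('r, nat) mtx \<Rightarrow> (nat, nat) mtx \<Rightarrow> ('r, 'r) mtx"
  where "proj J W J1 J1c J2 Q Phi =
    (hcat Q (Q \<odot>\<^bsub>J1c\<^esub> Phi) \<odot>\<^bsub>J1 <+> J2\<^esub> tr (hcat Q (Q \<odot>\<^bsub>J1c\<^esub> Phi)) \<odot>\<^bsub>J\<^esub> W)"

lemma proj_apply:
  assumes fin: "finite J1" "finite J2"
  shows "mapply (proj J W J1 J1c J2 Q Phi) J u p =
    (\<Sum>j\<in>J1. Q p j * mapply (tr Q) J (mapply W J u) j) +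
    (\<Sum>j\<in>J2. (Q \<odot>\<^bsub>J1c\<^esub> Phi) p j * mapply (tr Phi) J1c (mapply (tr Q) J (mapply W J u)) j)"
proof -
  let ?H = "hcat Q (Q \<odot>\<^bsub>J1c\<^esub> Phi)"
  have l: "mapply (tr ?H) J v (Inl j) = mapply (tr Q) J v j" for v j
    unfolding mapply_def tr_def hcat_def by simp
  have r: "mapply (tr ?H) J v (Inr j) = mapply (tr Phi) J1c (mapply (tr Q) J v) j" for v j
    unfolding mapply_mprod[symmetric] tr_mprod[symmetric] unfolding mapply_def tr_def hcat_def by simp
  have "mapply (proj J W J1 J1c J2 Q Phi) J u p = mapply ?H (J1 <+> J2) (mapply (tr ?H) J (mapply W J u)) p"
    unfolding proj_def mapply_mprod ..
  also have "\<dots> = (\<Sum>j\<in>J1. ?H p (Inl j) * mapply (tr ?H) J (mapply W J u) (Inl j)) +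
      (\<Sum>j\<in>J2. ?H p (Inr j) * mapply (tr ?H) J (mapply W J u) (Inr j))"
    unfolding mapply_def[of ?H] using fin by (simp add: sum.Plus o_def)
  finally show ?thesis unfolding l r by (simp add: hcat_def)
qed

text \<open>
  The selected eigenvectors are removed by the projection. On what remains, each of the two forms
  differs from \<open>t\<close> times the energy form by at most \<open>\<eta> * t\<close>, because its eigenvalues lie in
  \<open>[1 - \<eta>, 1 + \<eta>]\<close>.
\<close>

lemma selection_estimate:
  fixes t \<eta> :: real
  assumes fin: "finite J" and t: "0 \<le> t" and \<eta>: "0 \<le> \<eta>"
    and e1: "eigensystem J A (scl (complex_of_real t) W) W lam1 xi"
    and J1: "J1 = {j. j < card J \<and> selected \<eta> (lam1 j)}" and J1c: "J1c = {j. j < card J \<and> \<not> selected \<eta> (lam1 j)}"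
    and Q: "Q = colsM xi"
    and e2: "eigensystem J1c (tr Q \<odot>\<^bsub>J\<^esub> C \<odot>\<^bsub>J\<^esub> Q) (tr Q \<odot>\<^bsub>J\<^esub> scl (complex_of_real t) W \<odot>\<^bsub>J\<^esub> Q)
        (tr Q \<odot>\<^bsub>J\<^esub> W \<odot>\<^bsub>J\<^esub> Q) lam2 phi"
    and J2: "J2 = {j. j < card J1c \<and> selected \<eta> (lam2 j)}"
    and P: "\<And>u p. p \<in> J \<Longrightarrow> P u p = u p - mapply (proj J W J1 J1c J2 Q (colsM phi)) J u p"
  shows "cmod (dot J (P w) (mapply A J (P x)) - dot J (P w) (mapply C J (P x)))
    \<le> 2 * \<eta> * t * (sqrt (energy J W w) * sqrt (energy J W x))"
proof -
  let ?n = "card J" and ?m = "card J1c"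
  let ?W2 = "tr Q \<odot>\<^bsub>J\<^esub> W \<odot>\<^bsub>J\<^esub> Q"
  have fin1: "finite J1c" "finite J1" "finite J2" "J1c \<subseteq> {..<?n}" unfolding J1 J1c J2 by auto
  \<comment> \<open>The vectors of step one are orthonormal, so the matrix of orthonormality of step
    two is the identity on \<open>J1c\<close>, and the coordinates of step two are Euclidean
    ones.\<close>
  have W2: "?W2 j l = idM j l" if "j \<in> J1c" "l \<in> J1c" for j l
    using e1 that unfolding eigensystem_def Q J1c by auto
  have W2app: "mapply ?W2 J1c b l = b l" if "l \<in> J1c" for b l
  proof -
    have "mapply ?W2 J1c b l = mapply idM J1c b l" using W2[OF that] by (intro mapply_cong2) simp
    then show ?thesis using mapply_idM[OF fin1(1) that] by simp
  qed
  \<comment> \<open>Here \<open>a\<close> holds the coordinates of step one, \<open>c\<close> those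
    of step two for the part of \<open>a\<close> on \<open>J1c\<close>, and \<open>cr\<close> is
    \<open>c\<close> with the selected entries removed. Transforming \<open>cr\<close> back and
    padding by zero gives \<open>dl\<close>, the coordinates of \<open>P u\<close> in the basis of
    step one.\<close>
  define a where "a u = eigcoord J W xi u" for u
  define c where "c u = eigcoord J1c ?W2 phi (a u)" for u
  have c: "c u = mapply (tr (colsM phi)) J1c (a u)" for u
    unfolding c_def eigcoord_def by (rule mapply_cong) (rule W2app)
  define cr where "cr u j = (if j \<in> J2 then 0 else c u j)" for u j
  define d where "d u = mapply (colsM phi) {..<?m} (cr u)" for u
  define dl where "dl u l = (if l \<in> J1c then d u l else 0)" for u l
  have ad: "a u l = d u l + (\<Sum>j\<in>J2. colsM phi l j * c u j)" if l: "l \<in> J1c" for u l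
  proof -
    have "a u l = (\<Sum>j<?m. colsM phi l j * c u j)"
      using eig_expansion[OF fin1(1) e2 l, of "a u"] unfolding c_def mapply_def .
    also have "\<dots> = (\<Sum>j<?m. colsM phi l j * cr u j + (if j \<in> J2 then colsM phi l j * c u j else 0))"
      by (intro sum.cong) (auto simp: cr_def)
    also have "\<dots> = d u l + (\<Sum>j<?m. if j \<in> J2 then colsM phi l j * c u j else 0)"
      unfolding d_def mapply_def sum.distrib ..
    also have "(\<Sum>j<?m. if j \<in> J2 then colsM phi l j * c u j else 0) = (\<Sum>j\<in>J2. colsM phi l j * c u j)"
      by (rule sum.mono_neutral_cong_right) (auto simp: J2)
    finally show ?thesis .
  qed
  have Qdl: "mapply Q {..<?n} (dl u) p = mapply Q J1c (d u) p" for u p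
    unfolding mapply_def using fin1 by (intro sum.mono_neutral_cong_right) (auto simp: dl_def)
  have Pu: "P u p = mapply Q {..<?n} (dl u) p" if p: "p \<in> J" for u p
  proof -
    have "u p = (\<Sum>j<?n. Q p j * a u j)"
      using eig_expansion[OF fin e1 p, of u] unfolding Q a_def mapply_def .
    also have "{..<?n} = J1 \<union> J1c" unfolding J1 J1c by auto
    also have "(\<Sum>j\<in>J1 \<union> J1c. Q p j * a u j) = (\<Sum>j\<in>J1. Q p j * a u j) + (\<Sum>j\<in>J1c. Q p j * a u j)"
      using fin1 by (intro sum.union_disjoint) (auto simp: J1 J1c)
    also have "(\<Sum>j\<in>J1c. Q p j * a u j) = mapply Q J1c (d u) p + (\<Sum>l\<in>J1c. \<Sum>j\<in>J2. Q p l * (colsM phi l j * c u j))"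
      unfolding mapply_def by (simp add: ad distrib_left sum.distrib sum_distrib_left)
    also have "(\<Sum>l\<in>J1c. \<Sum>j\<in>J2. Q p l * (colsM phi l j * c u j)) = (\<Sum>j\<in>J2. (Q \<odot>\<^bsub>J1c\<^esub> colsM phi) p j * c u j)"
      by (subst sum.swap) (simp add: mprod_def sum_distrib_right mult.assoc)
    finally have "u p = mapply Q J1c (d u) p + mapply (proj J W J1 J1c J2 Q (colsM phi)) J u p"
      unfolding proj_apply[OF fin1(2,3)] using c[of u] a_def[of u] Q eigcoord_def[of J W xi u] by simp
    then show ?thesis unfolding P[OF p] Qdl by simp
  qed
  have aP: "eigcoord J W xi (P u) j = dl u j" if "j < ?n" for u j
    using eigcoord_combination[OF fin e1 that, of "dl u"] eigcoord_cong[of J "P u" "mapply Q {..<?n} (dl u)"] Pu Q by simp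
  have cd: "eigcoord J1c ?W2 phi (d u) j = cr u j" if "j < ?m" for u j
    using eigcoord_combination[OF fin1(1) e2 that, of "cr u"] unfolding d_def .
  have A: "dot J (P w) (mapply A J (P x)) = complex_of_real t * (\<Sum>j<?n. complex_of_real (lam1 j) * (dl w j * dl x j))"
    using eig_form[OF fin e1, of t "P w" "P x"] aP by (simp add: scl_def)
  have sc: "(tr Q \<odot>\<^bsub>J\<^esub> scl (complex_of_real t) W \<odot>\<^bsub>J\<^esub> Q) p q = complex_of_real t * ?W2 p q" for p q
    unfolding mprod_scl_mid by (simp add: scl_def)
  have "dot J (P w) (mapply C J (P x)) = dot J (mapply Q J1c (d w)) (mapply C J (mapply Q J1c (d x)))"
    using Pu Qdl by (intro dot_cong) (auto intro!: fun_cong[OF mapply_cong])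
  also have "\<dots> = dot J1c (d w) (mapply (tr Q \<odot>\<^bsub>J\<^esub> C \<odot>\<^bsub>J\<^esub> Q) J1c (d x))"
    unfolding mapply_mprod dot_mapply_tr ..
  also have "\<dots> = complex_of_real t * (\<Sum>j<?m. complex_of_real (lam2 j) * (cr w j * cr x j))"
    using eig_form[OF fin1(1) e2 sc, of "d w" "d x"] cd by simp
  finally have C: "dot J (P w) (mapply C J (P x)) = complex_of_real t * (\<Sum>j<?m. complex_of_real (lam2 j) * (cr w j * cr x j))" .
  have dsum: "(\<Sum>j<?n. dl w j * dl x j) = (\<Sum>l\<in>J1c. d w l * d x l)"
    using fin1 by (intro sum.mono_neutral_cong_right) (auto simp: dl_def)
  also have "\<dots> = dot J1c (d w) (mapply ?W2 J1c (d x))" unfolding dot_def using W2app by simp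
  also have "\<dots> = (\<Sum>j<?m. cr w j * cr x j)" unfolding eig_dot[OF fin1(1) e2] using cd by simp
  finally have dc: "(\<Sum>j<?n. dl w j * dl x j) = (\<Sum>j<?m. cr w j * cr x j)" .
  \<comment> \<open>Deviations from the reference eigenvalue 1. They are set to zero where the
    coordinates of \<open>P w\<close> and \<open>P x\<close> vanish anyway, so that the bound by the
    threshold holds for all indices.\<close>
  define r1 where "r1 j = (if j \<in> J1c then lam1 j - 1 else 0)" for j
  define r2 where "r2 j = (if j \<in> J2 then 0 else lam2 j - 1)" for j
  let ?S1 = "\<Sum>j<?n. complex_of_real (r1 j) * (dl w j * dl x j)"
  let ?S2 = "\<Sum>j<?m. complex_of_real (r2 j) * (cr w j * cr x j)"
  have S1: "?S1 = (\<Sum>j<?n. complex_of_real (lam1 j) * (dl w j * dl x j)) - (\<Sum>j<?n. dl w j * dl x j)"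
    unfolding sum_subtractf[symmetric] by (intro sum.cong) (auto simp: r1_def dl_def algebra_simps)
  have S2: "?S2 = (\<Sum>j<?m. complex_of_real (lam2 j) * (cr w j * cr x j)) - (\<Sum>j<?m. cr w j * cr x j)"
    unfolding sum_subtractf[symmetric] by (intro sum.cong) (auto simp: r2_def cr_def algebra_simps)
  \<comment> \<open>By \<open>dc\<close> the reference term is the same number in both bases and
    cancels. Each of the two remaining deviations costs one \<open>\<eta>\<close>, which is where
    the 2 comes from.\<close>
  have diff: "dot J (P w) (mapply A J (P x)) - dot J (P w) (mapply C J (P x)) = complex_of_real t * (?S1 - ?S2)"
    unfolding A C S1 S2 dc by (simp add: algebra_simps)
  have en1: "(\<Sum>j<?n. (cmod (dl u j))\<^sup>2) = (\<Sum>j<?m. (cmod (cr u j))\<^sup>2)" for u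
  proof -
    have "(\<Sum>j<?n. (cmod (dl u j))\<^sup>2) = (\<Sum>l\<in>J1c. (cmod (d u l))\<^sup>2)"
      using fin1 by (intro sum.mono_neutral_cong_right) (auto simp: dl_def)
    also have "\<dots> = energy J1c ?W2 (d u)"
      unfolding energy_def dot_def using W2app by (simp add: cmod_power2 flip: power2_eq_square)
    also have "\<dots> = (\<Sum>j<?m. (cmod (cr u j))\<^sup>2)" unfolding eig_energy[OF fin1(1) e2] using cd by simp
    finally show ?thesis .
  qed
  \<comment> \<open>Dropping orthonormal coordinates, once in each step, can only lower the
    energy.\<close>
  have en2: "(\<Sum>j<?m. (cmod (cr u j))\<^sup>2) \<le> energy J W u" for u
  proof -
    have "(\<Sum>j<?m. (cmod (cr u j))\<^sup>2) \<le> (\<Sum>j<?m. (cmod (c u j))\<^sup>2)"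
      by (intro sum_mono) (auto simp: cr_def)
    also have "\<dots> = energy J1c ?W2 (a u)" unfolding eig_energy[OF fin1(1) e2] c_def ..
    also have "\<dots> = (\<Sum>l\<in>J1c. (cmod (a u l))\<^sup>2)"
      unfolding energy_def dot_def using W2app by (simp add: cmod_power2 flip: power2_eq_square)
    also have "\<dots> \<le> (\<Sum>l<?n. (cmod (a u l))\<^sup>2)" using fin1 by (intro sum_mono2) auto
    also have "\<dots> = energy J W u" unfolding eig_energy[OF fin e1] a_def ..
    finally show ?thesis .
  qed
  have prod: "sqrt (\<Sum>j<?m. (cmod (cr w j))\<^sup>2) * sqrt (\<Sum>j<?m. (cmod (cr x j))\<^sup>2) \<le> sqrt (energy J W w) * sqrt (energy J W x)"
    using en2 by (intro mult_mono) (auto intro: sum_nonneg energy_nonneg_eig[OF fin e1])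
  have "cmod ?S1 \<le> \<eta> * (sqrt (\<Sum>j<?n. (cmod (dl w j))\<^sup>2) * sqrt (\<Sum>j<?n. (cmod (dl x j))\<^sup>2))"
    using \<eta> by (intro norm_sum_mult_le) (auto simp: r1_def J1c selected_def)
  also have "\<dots> \<le> \<eta> * (sqrt (energy J W w) * sqrt (energy J W x))" unfolding en1 using prod \<eta> by (intro mult_left_mono)
  finally have n1: "cmod ?S1 \<le> \<eta> * (sqrt (energy J W w) * sqrt (energy J W x))" .
  have "cmod ?S2 \<le> \<eta> * (sqrt (\<Sum>j<?m. (cmod (cr w j))\<^sup>2) * sqrt (\<Sum>j<?m. (cmod (cr x j))\<^sup>2))"
    using \<eta> by (intro norm_sum_mult_le) (auto simp: r2_def J2 selected_def)
  also have "\<dots> \<le> \<eta> * (sqrt (energy J W w) * sqrt (energy J W x))" using prod \<eta> by (intro mult_left_mono)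
  finally have n2: "cmod ?S2 \<le> \<eta> * (sqrt (energy J W w) * sqrt (energy J W x))" .
  have "cmod (complex_of_real t * (?S1 - ?S2)) \<le> t * (2 * (\<eta> * (sqrt (energy J W w) * sqrt (energy J W x))))"
    unfolding norm_mult using n1 n2 norm_triangle_ineq4[of ?S1 ?S2] t by (simp add: mult_left_mono)
  then show ?thesis unfolding diff by (simp add: mult_ac)
qed

section \<open>Schur complements as minimal energies\<close>

lemma mapply_union:
  assumes "finite P" "finite R" "P \<inter> R = {}"
  shows "mapply A (P \<union> R) u = (\<lambda>x. mapply A P u x + mapply A R u x)"
  unfolding mapply_def using assms by (simp add: sum.union_disjoint)

lemma dot_union:
  assumes "finite P" "finite R" "P \<inter> R = {}"
  shows "dot (P \<union> R) w u = dot P w u + dot R w u"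
  unfolding dot_def using assms by (simp add: sum.union_disjoint)

lemma mapply_cnj:
  assumes "\<And>p q. cnj (A p q) = A p q"
  shows "mapply A J (\<lambda>p. cnj (u p)) = (\<lambda>p. cnj (mapply A J u p))"
  unfolding mapply_def using assms by simp

lemma dot_mapply_sym:
  assumes "\<And>p q. A q p = A p q"
  shows "dot P w (mapply A R u) = dot R u (mapply A P w)"
proof -
  have "tr A = A" using assms unfolding tr_def by blast
  then show ?thesis using dot_mapply[of P w A R u] dot_commute by metis
qed

text \<open>Completing the square: the values \<open>- y\<close> on \<open>R\<close> form the
  extension of least energy of \<open>z\<close> from \<open>P\<close>, and the surplus energy is
  exactly that of the deviation \<open>z + y\<close> on \<open>R\<close>.\<close>

lemma schur_energy_le:
  assumes fin: "finite P" "finite R" "P \<inter> R = {}"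
    and sym: "\<And>p q. H q p = H p q" and real: "\<And>p q. cnj (H p q) = H p q"
    and pos: "\<And>u. 0 \<le> energy R H u" and def0: "\<And>u. energy R H u = 0 \<Longrightarrow> \<forall>p\<in>R. u p = 0"
  shows "energy P (H - H \<odot>\<^bsub>R\<^esub> minv R H \<odot>\<^bsub>R\<^esub> H) z \<le> energy (P \<union> R) H z"
proof -
  define y where "y = mapply (minv R H) R (mapply H P z)"
  let ?b = "\<lambda>A B w x. dot A w (mapply H B x)"
  let ?cz = "\<lambda>p. cnj (z p)" and ?cy = "\<lambda>p. cnj (y p)"
  have inj: "\<forall>p\<in>R. u p = 0" if "\<And>k. k \<in> R \<Longrightarrow> mapply H R u k = 0" for u
    using that by (intro def0) (simp add: energy_def dot_def)
  have Hy: "mapply H R y k = mapply H P z k" if "k \<in> R" for k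
    unfolding y_def using mapply_minv[OF fin(2) inj that] by blast
  have by1: "?b R R w y = ?b R P w z" for w using Hy by (intro dot_cong) auto
  have by2: "?b R R w ?cy = ?b R P w ?cz" for w
    unfolding mapply_cnj[OF real] using Hy by (intro dot_cong) auto
  have S: "mapply (H - H \<odot>\<^bsub>R\<^esub> minv R H \<odot>\<^bsub>R\<^esub> H) P z = (\<lambda>p. mapply H P z p - mapply H R y p)"
    unfolding mapply_minus mapply_mprod y_def ..
  have s: "?b A B w x = ?b B A x w" for A B w x using dot_mapply_sym[OF sym] .
  have 1: "dot (P \<union> R) ?cz (mapply H (P \<union> R) z) = ?b P P ?cz z + ?b P R ?cz z + ?b R P ?cz z + ?b R R ?cz z"
    unfolding dot_union[OF fin] mapply_union[OF fin] dot_add_right by simp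
  have 2: "dot P ?cz (mapply (H - H \<odot>\<^bsub>R\<^esub> minv R H \<odot>\<^bsub>R\<^esub> H) P z) = ?b P P ?cz z - ?b P R ?cz y"
    unfolding S dot_diff_right ..
  have 3: "dot R (\<lambda>p. cnj (z p + y p)) (mapply H R (\<lambda>p. z p + y p)) =
      ?b R R ?cz z + ?b R P ?cz z + ?b P R ?cz z + ?b P R ?cz y"
  proof -
    have "dot R (\<lambda>p. cnj (z p + y p)) (mapply H R (\<lambda>p. z p + y p)) = ?b R R ?cz z + ?b R R ?cz y + (?b R R ?cy z + ?b R R ?cy y)"
      unfolding mapply_add complex_cnj_add dot_add_left dot_add_right by simp
    also have "?b R R ?cy z = ?b P R ?cz z" using s by2 by metis
    also have "?b R R ?cy y = ?b P R ?cz y" using s by2 by metis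
    finally show ?thesis unfolding by1 by simp
  qed
  have "energy (P \<union> R) H z - energy P (H - H \<odot>\<^bsub>R\<^esub> minv R H \<odot>\<^bsub>R\<^esub> H) z = energy R H (\<lambda>p. z p + y p)"
    unfolding energy_def 1 2 3 by simp
  then show ?thesis using pos[of "\<lambda>p. z p + y p"] by simp
qed

section \<open>The coarse space\<close>

locale helmholtz_selection = helmholtz_mesh D \<sigma> for D :: "'a::euclidean_space helmholtz" and \<sigma> +
  fixes E :: "'a selection"
  assumes sel: "is_selection D E" and beta_pos: "0 < beta E"
    and eta: "0 \<le> etaRe E" "0 \<le> etaIm E"
begin

text \<open>The coarse component of a nodal vector in the splitting of \<open>V\<^sub>h\<close> into the coarse space and the spans of \<open>Q\<^sub>L\<close>.\<close>

definition crs :: "('a \<Rightarrow> complex) \<Rightarrow> 'a cidx \<Rightarrow> complex"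
  where "crs z = case_sum z (\<lambda>(i, j). eigcoord (nodes_I D i) (Hloc D i) (phiI E i) z j)"

lemma finite_JS: "finite (JS D E i)" and finite_JL: "finite (JL D E i)"
  and JS_JL: "{..<card (nodes_I D i)} = JS D E i \<union> JL D E i" and JS_Int_JL: "JS D E i \<inter> JL D E i = {}"
  unfolding JS_def JL_def by auto

lemma finite_X0loc: "finite (X0loc D E i)"
proof -
  have "{Inr (i, j) | j. j \<in> JS D E i} = (\<lambda>j. Inr (i, j)) ` JS D E i" by auto
  then show ?thesis unfolding X0loc_def using finite_node_sets finite_JS by simp
qed

lemma sum_X0loc: "(\<Sum>x\<in>X0loc D E i. f x) = (\<Sum>p\<in>nodes_Gam D i. f (Inl p)) + (\<Sum>j\<in>JS D E i. f (Inr (i, j)))"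
proof -
  have eq: "X0loc D E i = Inl ` nodes_Gam D i \<union> (\<lambda>j. Inr (i, j)) ` JS D E i" unfolding X0loc_def by auto
  have "(\<Sum>x\<in>X0loc D E i. f x) = (\<Sum>x\<in>Inl ` nodes_Gam D i. f x) + (\<Sum>x\<in>(\<lambda>j. Inr (i, j)) ` JS D E i. f x)"
    unfolding eq using finite_node_sets(1) finite_JS by (intro sum.union_disjoint) auto
  then show ?thesis by (simp add: sum.reindex inj_on_def)
qed

lemma dot_block2:
  "dot (X0loc D E i) u (mapply (block2 A B C M) (X0loc D E i) v) =
    dot (nodes_Gam D i) (\<lambda>p. u (Inl p)) (mapply A (nodes_Gam D i) (\<lambda>p. v (Inl p)))
    + dot (nodes_Gam D i) (\<lambda>p. u (Inl p)) (mapply B (JS D E i) (\<lambda>j. v (Inr (i, j))))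
    + dot (JS D E i) (\<lambda>j. u (Inr (i, j))) (mapply C (nodes_Gam D i) (\<lambda>p. v (Inl p)))
    + dot (JS D E i) (\<lambda>j. u (Inr (i, j))) (mapply M (JS D E i) (\<lambda>j. v (Inr (i, j))))"
  unfolding dot_def mapply_def sum_X0loc by (simp add: block2_def distrib_left sum.distrib)

text \<open>The coupling of interface values \<open>w\<close> to the interior through
  \<open>K\<close>, tested with the eigenvectors.\<close>

definition gc :: "nat \<Rightarrow> ('a, 'a) mtx \<Rightarrow> ('a \<Rightarrow> complex) \<Rightarrow> nat \<Rightarrow> complex"
  where "gc i K w = mapply (tr (QI E i)) (nodes_I D i) (mapply K (nodes_Gam D i) w)"

text \<open>The part of the coarse extension that subdomain \<open>i\<close> sees; on its closed
  node set it agrees with the global one by \<open>R0_ext\<close>.\<close>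

definition ext :: "nat \<Rightarrow> ('a cidx \<Rightarrow> complex) \<Rightarrow> 'a \<Rightarrow> complex"
  where "ext i w p = (if p \<in> nodes_I D i then mapply (Eloc D E i) (X0loc D E i) w p else w (Inl p))"

abbreviation h :: real where "h \<equiv> mesh_size D"
abbreviation k :: real where "k \<equiv> wavenumber D"

definition en :: "nat \<Rightarrow> ('a \<Rightarrow> complex) \<Rightarrow> real"
  where "en i z = energy (nodes_cl i) (Hloc D i) z"

context
  fixes i assumes i: "i < nsub D"
begin

private abbreviation (input) "G \<equiv> nodes_Gam D i"
private abbreviation (input) "I \<equiv> nodes_I D i"
private abbreviation (input) "X \<equiv> X0loc D E i"
private abbreviation (input) "Q \<equiv> QI E i"
private abbreviation (input) "al \<equiv> eigcoord (nodes_I D i) (Hloc D i) (phiI E i)"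
private abbreviation (input) "S \<equiv> JS D E i"
private abbreviation (input) "L \<equiv> JL D E i"
private abbreviation (input) "Bd \<equiv> nodes_Pi D i"

lemma eig_I: "eigensystem I (Bloc D i) (Hloc D i) (Hloc D i) (muI E i) (phiI E i)"
  and eig_Re1: "eigensystem X (reM (B0loc D E i)) (H0loc D E i) (H0loc D E i) (lamRe1 E i) (xiRe1 E i)"
  and eig_Re2: "eigensystem (JRe1c D E i) (tr (QRe1 E i) \<odot>\<^bsub>X\<^esub> C0loc D E i \<odot>\<^bsub>X\<^esub> QRe1 E i)
      (tr (QRe1 E i) \<odot>\<^bsub>X\<^esub> H0loc D E i \<odot>\<^bsub>X\<^esub> QRe1 E i) (tr (QRe1 E i) \<odot>\<^bsub>X\<^esub> H0loc D E i \<odot>\<^bsub>X\<^esub> QRe1 E i)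
      (lamRe2 E i) (phiRe2 E i)"
  and eig_Im1: "eigensystem (nodes_Pi D i) (imM (Bloc D i)) (hkS D i) (Schur D i) (lamIm1 E i) (xiIm1 E i)"
  and eig_Im2: "eigensystem (JIm1c D E i) (tr (QIm1 E i) \<odot>\<^bsub>nodes_Pi D i\<^esub> CDiag D E i \<odot>\<^bsub>nodes_Pi D i\<^esub> QIm1 E i)
      (tr (QIm1 E i) \<odot>\<^bsub>nodes_Pi D i\<^esub> hkS D i \<odot>\<^bsub>nodes_Pi D i\<^esub> QIm1 E i)
      (tr (QIm1 E i) \<odot>\<^bsub>nodes_Pi D i\<^esub> Schur D i \<odot>\<^bsub>nodes_Pi D i\<^esub> QIm1 E i) (lamIm2 E i) (phiIm2 E i)"
  using sel i unfolding is_selection_def Let_def by simp_all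

lemma mu_L: "j \<in> L \<Longrightarrow> complex_of_real (muI E i j) \<noteq> 0"
  using beta_pos unfolding JL_def by auto

lemma Q_expansion: "p \<in> I \<Longrightarrow> u p = mapply Q {..<card I} (al u) p"
  using eig_expansion[OF finite_node_sets(2) eig_I] unfolding QI_def .

lemma Q_diag:
  assumes "j < card I" "l < card I"
  shows "(tr Q \<odot>\<^bsub>I\<^esub> Hloc D i \<odot>\<^bsub>I\<^esub> Q) j l = (if j = l then 1 else 0)"
    "(tr Q \<odot>\<^bsub>I\<^esub> Bloc D i \<odot>\<^bsub>I\<^esub> Q) j l = (if j = l then complex_of_real (muI E i j) else 0)"
proof -
  show H: "(tr Q \<odot>\<^bsub>I\<^esub> Hloc D i \<odot>\<^bsub>I\<^esub> Q) j l = (if j = l then 1 else 0)"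
    using eig_I assms unfolding eigensystem_def QI_def idM_def by simp
  have "(tr Q \<odot>\<^bsub>I\<^esub> Bloc D i \<odot>\<^bsub>I\<^esub> Q) j l = (\<Sum>p\<in>I. tr Q j p * (Bloc D i \<odot>\<^bsub>I\<^esub> Q) p l)"
    unfolding mprod_assoc unfolding mprod_def ..
  also have "\<dots> = (\<Sum>p\<in>I. tr Q j p * (complex_of_real (muI E i l) * (Hloc D i \<odot>\<^bsub>I\<^esub> Q) p l))"
    using eig_I assms unfolding eigensystem_def QI_def by simp
  also have "\<dots> = complex_of_real (muI E i l) * (tr Q \<odot>\<^bsub>I\<^esub> (Hloc D i \<odot>\<^bsub>I\<^esub> Q)) j l"
    by (simp add: mprod_def[of "tr Q"] sum_distrib_left mult_ac)
  finally show "(tr Q \<odot>\<^bsub>I\<^esub> Bloc D i \<odot>\<^bsub>I\<^esub> Q) j l = (if j = l then complex_of_real (muI E i j) else 0)"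
    using H unfolding mprod_assoc by simp
qed

lemma minv_Bi: "j \<in> L \<Longrightarrow> l \<in> L \<Longrightarrow> minv L (Bi D E i) j l = (if j = l then 1 / complex_of_real (muI E i j) else 0)"
proof (rule minv_diagonal[OF finite_JL])
  fix j l assume "j \<in> L" "l \<in> L"
  then show "Bi D E i j l = (if j = l then complex_of_real (muI E i j) else 0)"
    unfolding Bi_def by (intro Q_diag(2)) (auto simp: JL_def)
qed (use mu_L in auto)

lemma minv_Hi: "j \<in> L \<Longrightarrow> l \<in> L \<Longrightarrow> minv L (tr Q \<odot>\<^bsub>I\<^esub> Hloc D i \<odot>\<^bsub>I\<^esub> Q) j l = (if j = l then 1 / 1 else 0)"
proof (rule minv_diagonal[OF finite_JL])
  fix j l assume "j \<in> L" "l \<in> L"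
  then show "(tr Q \<odot>\<^bsub>I\<^esub> Hloc D i \<odot>\<^bsub>I\<^esub> Q) j l = (if j = l then 1 else 0)"
    by (intro Q_diag(1)) (auto simp: JL_def)
qed auto

lemma mapply_QMQ:
  assumes "\<And>j l. j \<in> L \<Longrightarrow> l \<in> L \<Longrightarrow> M j l = (if j = l then r j else 0)"
  shows "mapply (Q \<odot>\<^bsub>L\<^esub> M \<odot>\<^bsub>L\<^esub> tr Q) I v p = mapply Q L (\<lambda>j. r j * mapply (tr Q) I v j) p"
proof -
  have "mapply M L b j = r j * b j" if j: "j \<in> L" for b j
  proof -
    have "mapply M L b j = (\<Sum>l\<in>L. if j = l then r j * b l else 0)"
      unfolding mapply_def using assms[OF j] by (intro sum.cong) auto
    then show ?thesis using j finite_JL by simp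
  qed
  then show ?thesis unfolding mapply_mprod by (intro fun_cong[OF mapply_cong])
qed

lemma mapply_BL: "mapply (BL D E i) I v p = mapply Q L (\<lambda>j. 1 / complex_of_real (muI E i j) * mapply (tr Q) I v j) p"
  unfolding BL_def by (rule mapply_QMQ) (rule minv_Bi)

lemma mapply_HL: "mapply (HL D E i) I v p = mapply Q L (\<lambda>j. 1 / 1 * mapply (tr Q) I v j) p"
  unfolding HL_def by (rule mapply_QMQ) (rule minv_Hi)

section \<open>Local forms in eigenvector coordinates\<close>

lemma gc_pair:
  assumes "\<And>p q. K q p = K p q"
  shows "dot G w (mapply K I (mapply Q A c)) = dot A (gc i K w) c"
proof -
  have "dot G w (mapply K I (mapply Q A c)) = dot I (mapply K G w) (mapply Q A c)"
    using dot_mapply_sym[of K, OF assms] dot_commute by metis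
  then show ?thesis unfolding gc_def using dot_mapply[of I "mapply K G w" Q A c] by simp
qed

lemma gc_pair2: "dot I (mapply Q A c) (mapply K G w) = dot A c (gc i K w)"
  unfolding gc_def by (rule dot_mapply_tr[symmetric])

text \<open>Covers both coarse matrices: \<open>B0loc\<close> with \<open>r j\<close> the reciprocal
  eigenvalue and \<open>kap j\<close> the eigenvalue, and \<open>H0loc\<close> with both equal to
  1.\<close>

lemma block_form:
  assumes sym: "\<And>p q. K q p = K p q"
    and L: "\<And>v p. mapply Lm I v p = mapply Q L (\<lambda>j. r j * mapply (tr Q) I v j) p"
    and M: "\<And>j l. j < card I \<Longrightarrow> l < card I \<Longrightarrow> (tr Q \<odot>\<^bsub>I\<^esub> K \<odot>\<^bsub>I\<^esub> Q) j l = (if j = l then kap j else 0)"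
  shows "dot X u (mapply (block2 (K - K \<odot>\<^bsub>I\<^esub> Lm \<odot>\<^bsub>I\<^esub> K) (K \<odot>\<^bsub>I\<^esub> Q) (tr Q \<odot>\<^bsub>I\<^esub> K) (tr Q \<odot>\<^bsub>I\<^esub> K \<odot>\<^bsub>I\<^esub> Q)) X v) =
    dot G (\<lambda>p. u (Inl p)) (mapply K G (\<lambda>p. v (Inl p)))
    - (\<Sum>j\<in>L. r j * (gc i K (\<lambda>p. u (Inl p)) j * gc i K (\<lambda>p. v (Inl p)) j))
    + (\<Sum>j\<in>S. gc i K (\<lambda>p. u (Inl p)) j * v (Inr (i, j)) + u (Inr (i, j)) * gc i K (\<lambda>p. v (Inl p)) j
        + kap j * (u (Inr (i, j)) * v (Inr (i, j))))"
proof -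
  let ?u = "\<lambda>p. u (Inl p)" and ?v = "\<lambda>p. v (Inl p)" and ?a = "\<lambda>j. u (Inr (i, j))" and ?b = "\<lambda>j. v (Inr (i, j))"
  have Lm: "mapply Lm I (mapply K G ?v) = mapply Q L (\<lambda>j. r j * gc i K ?v j)"
    unfolding gc_def using L by blast
  have 1: "dot G ?u (mapply (K - K \<odot>\<^bsub>I\<^esub> Lm \<odot>\<^bsub>I\<^esub> K) G ?v) = dot G ?u (mapply K G ?v) - dot L (gc i K ?u) (\<lambda>j. r j * gc i K ?v j)"
    unfolding mapply_minus dot_diff_right mapply_mprod Lm gc_pair[of K, OF sym] ..
  have 2: "dot G ?u (mapply (K \<odot>\<^bsub>I\<^esub> Q) S ?b) = dot S (gc i K ?u) ?b"
    unfolding mapply_mprod gc_pair[of K, OF sym] ..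
  have 3: "dot S ?a (mapply (tr Q \<odot>\<^bsub>I\<^esub> K) G ?v) = dot S ?a (gc i K ?v)"
    unfolding mapply_mprod gc_def ..
  have "mapply (tr Q \<odot>\<^bsub>I\<^esub> K \<odot>\<^bsub>I\<^esub> Q) S ?b j = kap j * ?b j" if j: "j \<in> S" for j
  proof -
    have "mapply (tr Q \<odot>\<^bsub>I\<^esub> K \<odot>\<^bsub>I\<^esub> Q) S ?b j = (\<Sum>l\<in>S. if j = l then kap j * ?b l else 0)"
      unfolding mapply_def using M j by (intro sum.cong) (auto simp: JS_def)
    then show ?thesis using j finite_JS by simp
  qed
  then have 4: "dot S ?a (mapply (tr Q \<odot>\<^bsub>I\<^esub> K \<odot>\<^bsub>I\<^esub> Q) S ?b) = (\<Sum>j\<in>S. kap j * (?a j * ?b j))"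
    unfolding dot_def by (simp add: mult_ac)
  show ?thesis unfolding dot_block2 1 2 3 4 by (simp add: dot_def sum.distrib mult_ac)
qed

lemma B0loc_form: "dot X u (mapply (B0loc D E i) X v) = dot G (\<lambda>p. u (Inl p)) (mapply (Bloc D i) G (\<lambda>p. v (Inl p)))
    - (\<Sum>j\<in>L. 1 / complex_of_real (muI E i j) * (gc i (Bloc D i) (\<lambda>p. u (Inl p)) j * gc i (Bloc D i) (\<lambda>p. v (Inl p)) j))
    + (\<Sum>j\<in>S. gc i (Bloc D i) (\<lambda>p. u (Inl p)) j * v (Inr (i, j)) + u (Inr (i, j)) * gc i (Bloc D i) (\<lambda>p. v (Inl p)) j
        + complex_of_real (muI E i j) * (u (Inr (i, j)) * v (Inr (i, j))))"
  unfolding B0loc_def by (rule block_form[of "Bloc D i" "BL D E i", OF Bloc_sym[OF i] mapply_BL Q_diag(2)])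

lemma H0loc_form: "dot X u (mapply (H0loc D E i) X v) = dot G (\<lambda>p. u (Inl p)) (mapply (Hloc D i) G (\<lambda>p. v (Inl p)))
    - (\<Sum>j\<in>L. 1 / 1 * (gc i (Hloc D i) (\<lambda>p. u (Inl p)) j * gc i (Hloc D i) (\<lambda>p. v (Inl p)) j))
    + (\<Sum>j\<in>S. gc i (Hloc D i) (\<lambda>p. u (Inl p)) j * v (Inr (i, j)) + u (Inr (i, j)) * gc i (Hloc D i) (\<lambda>p. v (Inl p)) j
        + 1 * (u (Inr (i, j)) * v (Inr (i, j))))"
  unfolding H0loc_def Hhat_def by (rule block_form[of "Hloc D i" "HL D E i", OF Hloc_sym[OF i] mapply_HL Q_diag(1)])

text \<open>The counterpart of \<open>block_form\<close> before elimination. Comparing the two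
  leaves only terms indexed by \<open>JL\<close>.\<close>

lemma full_form:
  assumes sym: "\<And>p q. K q p = K p q"
    and diag: "dot I z (mapply K I y) = (\<Sum>j<card I. kap j * (al z j * al y j))"
  shows "dot (G \<union> I) z (mapply K (G \<union> I) y) = dot G z (mapply K G y)
    + (\<Sum>j<card I. gc i K z j * al y j + al z j * gc i K y j + kap j * (al z j * al y j))"
proof -
  have "G \<inter> I = {}" using nodes_I_Gam[OF i i] by blast
  note un = finite_node_sets(1) finite_node_sets(2) this
  have 1: "dot G z (mapply K I y) = dot {..<card I} (gc i K z) (al y)"
  proof -
    have "mapply K I y = mapply K I (mapply Q {..<card I} (al y))" by (rule mapply_cong) (rule Q_expansion)
    then show ?thesis using gc_pair[of K, OF sym] by simp
  qed
  have 2: "dot I z (mapply K G y) = dot {..<card I} (al z) (gc i K y)"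
  proof -
    have "dot I z (mapply K G y) = dot I (mapply Q {..<card I} (al z)) (mapply K G y)" by (rule dot_cong, erule Q_expansion, rule refl)
    then show ?thesis unfolding gc_pair2 .
  qed
  show ?thesis unfolding dot_union[OF un] mapply_union[OF un] dot_add_right 1 2 diag by (simp add: dot_def sum.distrib)
qed

text \<open>On \<open>JL\<close> the coordinate is the solution a of g + \<mu> a = 0, with g the
  coupling and \<mu> the eigenvalue. So the residual of the extension vanishes when tested with the
  columns of Q_L; on \<open>JS\<close> the coordinate is prescribed.\<close>

lemma ext_coord: assumes "j < card I"
  shows "al (ext i w) j = (if j \<in> S then w (Inr (i, j)) else - gc i (Bloc D i) (\<lambda>p. w (Inl p)) j / complex_of_real (muI E i j))"
proof -
  let ?g = "gc i (Bloc D i) (\<lambda>p. w (Inl p))"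
  let ?cf = "\<lambda>j. if j \<in> S then w (Inr (i, j)) else - ?g j / complex_of_real (muI E i j)"
  have "ext i w p = mapply Q {..<card I} ?cf p" if p: "p \<in> I" for p
  proof -
    have "ext i w p = (\<Sum>q\<in>G. - ((BL D E i \<odot>\<^bsub>I\<^esub> Bloc D i) p q * w (Inl q))) + (\<Sum>j\<in>S. Q p j * w (Inr (i, j)))"
      unfolding ext_def using p by (simp add: mapply_def sum_X0loc Eloc_def)
    also have "(\<Sum>q\<in>G. - ((BL D E i \<odot>\<^bsub>I\<^esub> Bloc D i) p q * w (Inl q))) = - mapply (BL D E i \<odot>\<^bsub>I\<^esub> Bloc D i) G (\<lambda>p. w (Inl p)) p"
      unfolding mapply_def by (simp add: sum_negf)
    also have "\<dots> = - mapply Q L (\<lambda>j. 1 / complex_of_real (muI E i j) * ?g j) p"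
      unfolding mapply_mprod mapply_BL gc_def ..
    also have "\<dots> = (\<Sum>j\<in>L. Q p j * ?cf j)"
      unfolding mapply_def sum_negf[symmetric] using JS_Int_JL by (intro sum.cong) auto
    also have "(\<Sum>j\<in>S. Q p j * w (Inr (i, j))) = (\<Sum>j\<in>S. Q p j * ?cf j)" by (intro sum.cong) auto
    finally show ?thesis
      unfolding mapply_def JS_JL sum.union_disjoint[OF finite_JS finite_JL JS_Int_JL] by (simp only: add.commute)
  qed
  then have "al (ext i w) = al (mapply (colsM (phiI E i)) {..<card I} ?cf)" unfolding QI_def by (rule eigcoord_cong)
  then show ?thesis using eigcoord_combination[OF finite_node_sets(2) eig_I assms, of ?cf] by simp
qed

text \<open>By \<open>ext_coord\<close>, the \<open>JL\<close> coordinates of \<open>z\<close> are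
  multiplied by a vanishing residual. Thus \<open>z\<close> enters only through its coarse
  components, for arbitrary \<open>z\<close>; the remaining \<open>JL\<close> terms are the
  correction by \<open>BL\<close> contained in \<open>B0loc\<close>.\<close>

lemma local_form: "dot (G \<union> I) z (mapply (Bloc D i) (G \<union> I) (ext i w)) = dot X (crs z) (mapply (B0loc D E i) X w)"
proof -
  let ?w = "\<lambda>p. w (Inl p)" and ?g = "gc i (Bloc D i)" and ?mu = "\<lambda>j. complex_of_real (muI E i j)"
  have ew: "ext i w p = w (Inl p)" if "p \<in> G" for p
    using that nodes_I_Gam[OF i i] unfolding ext_def by auto
  have g: "?g (ext i w) = ?g ?w" and gG: "mapply (Bloc D i) G (ext i w) = mapply (Bloc D i) G ?w"
    unfolding gc_def using mapply_cong[of G "ext i w" ?w "Bloc D i"] ew by auto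
  have diag: "dot I z (mapply (Bloc D i) I (ext i w)) = (\<Sum>j<card I. ?mu j * (al z j * al (ext i w) j))"
    using eig_form[OF finite_node_sets(2) eig_I, of 1] by simp
  have "dot (G \<union> I) z (mapply (Bloc D i) (G \<union> I) (ext i w)) = dot G z (mapply (Bloc D i) G ?w)
    + (\<Sum>j\<in>S \<union> L. ?g z j * al (ext i w) j + al z j * ?g ?w j + ?mu j * (al z j * al (ext i w) j))"
    unfolding full_form[OF Bloc_sym[OF i] diag] g gG JS_JL ..
  also have "\<dots> = dot G z (mapply (Bloc D i) G ?w)
    + (\<Sum>j\<in>S. ?g z j * al (ext i w) j + al z j * ?g ?w j + ?mu j * (al z j * al (ext i w) j))
    + (\<Sum>j\<in>L. ?g z j * al (ext i w) j + al z j * ?g ?w j + ?mu j * (al z j * al (ext i w) j))"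
    unfolding sum.union_disjoint[OF finite_JS finite_JL JS_Int_JL] by simp
  also have "(\<Sum>j\<in>S. ?g z j * al (ext i w) j + al z j * ?g ?w j + ?mu j * (al z j * al (ext i w) j)) =
      (\<Sum>j\<in>S. ?g z j * w (Inr (i, j)) + al z j * ?g ?w j + ?mu j * (al z j * w (Inr (i, j))))"
    by (intro sum.cong refl) (simp add: ext_coord JS_def)
  also have "(\<Sum>j\<in>L. ?g z j * al (ext i w) j + al z j * ?g ?w j + ?mu j * (al z j * al (ext i w) j)) =
      - (\<Sum>j\<in>L. 1 / ?mu j * (?g z j * ?g ?w j))"
    unfolding sum_negf[symmetric]
  proof (intro sum.cong refl)
    fix j assume j: "j \<in> L"
    then have "j < card I" "j \<notin> S" using JS_Int_JL unfolding JL_def by auto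
    then show "?g z j * al (ext i w) j + al z j * ?g ?w j + ?mu j * (al z j * al (ext i w) j) = - (1 / ?mu j * (?g z j * ?g ?w j))"
      using mu_L[OF j] by (simp add: ext_coord)
  qed
  also have "dot G z (mapply (Bloc D i) G ?w)
      + (\<Sum>j\<in>S. ?g z j * w (Inr (i, j)) + al z j * ?g ?w j + ?mu j * (al z j * w (Inr (i, j)))) + - (\<Sum>j\<in>L. 1 / ?mu j * (?g z j * ?g ?w j))
    = dot X (crs z) (mapply (B0loc D E i) X w)"
    unfolding B0loc_form by (simp add: crs_def)
  finally show ?thesis .
qed

lemma crs_cnj: "x \<in> X \<Longrightarrow> crs (\<lambda>p. cnj (z p)) x = cnj (crs z x)"
  using eigcoord_cnj[OF finite_node_sets(2) eig_I] by (auto simp: X0loc_def crs_def JS_def)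

text \<open>Completing the square in the \<open>JL\<close> coordinates: the surplus of the full
  energy is the sum of the squares of |a + g|, with a the coordinate of \<open>z\<close> and g its
  coupling through \<open>Hloc\<close>.\<close>

lemma coarse_energy_le: "energy X (H0loc D E i) (crs z) \<le> energy (G \<union> I) (Hloc D i) z"
proof -
  let ?g = "gc i (Hloc D i)" and ?zc = "\<lambda>p. cnj (z p)"
  have gc: "?g ?zc = (\<lambda>j. cnj (?g z j))"
  proof
    fix j
    have "cnj (tr Q p q) = tr Q p q" for p q unfolding tr_def QI_def colsM_def by simp
    then show "?g ?zc j = cnj (?g z j)"
      unfolding gc_def mapply_cnj[of "Hloc D i", OF Hloc_cnj[OF i]] by (simp add: mapply_cnj)
  qed
  have alc: "al ?zc j = cnj (al z j)" if "j < card I" for j using eigcoord_cnj[OF finite_node_sets(2) eig_I that] .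
  have diag: "dot I ?zc (mapply (Hloc D i) I z) = (\<Sum>j<card I. 1 * (al ?zc j * al z j))"
    using eig_dot[OF finite_node_sets(2) eig_I] by simp
  have full: "dot (G \<union> I) ?zc (mapply (Hloc D i) (G \<union> I) z) = dot G ?zc (mapply (Hloc D i) G z)
    + (\<Sum>j\<in>S. ?g ?zc j * al z j + al ?zc j * ?g z j + 1 * (al ?zc j * al z j))
    + (\<Sum>j\<in>L. ?g ?zc j * al z j + al ?zc j * ?g z j + 1 * (al ?zc j * al z j))"
    unfolding full_form[OF Hloc_sym[OF i] diag] JS_JL sum.union_disjoint[OF finite_JS finite_JL JS_Int_JL] by simp
  have "dot X (\<lambda>x. cnj (crs z x)) (mapply (H0loc D E i) X (crs z)) = dot X (crs ?zc) (mapply (H0loc D E i) X (crs z))"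
    using crs_cnj by (intro dot_cong) auto
  also have "\<dots> = dot G ?zc (mapply (Hloc D i) G z) - (\<Sum>j\<in>L. 1 / 1 * (?g ?zc j * ?g z j))
    + (\<Sum>j\<in>S. ?g ?zc j * al z j + al ?zc j * ?g z j + 1 * (al ?zc j * al z j))"
    unfolding H0loc_form by (simp add: crs_def)
  finally have coarse: "dot X (\<lambda>x. cnj (crs z x)) (mapply (H0loc D E i) X (crs z)) = \<dots>" .
  have sq: "?g ?zc j * al z j + al ?zc j * ?g z j + 1 * (al ?zc j * al z j) + ?g ?zc j * ?g z j = complex_of_real ((cmod (al z j + ?g z j))\<^sup>2)"
    if "j \<in> L" for j
    unfolding complex_norm_square gc using alc[of j] that by (simp add: JL_def algebra_simps)
  have "(\<Sum>j\<in>L. ?g ?zc j * al z j + al ?zc j * ?g z j + 1 * (al ?zc j * al z j)) + (\<Sum>j\<in>L. ?g ?zc j * ?g z j)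
    = complex_of_real (\<Sum>j\<in>L. (cmod (al z j + ?g z j))\<^sup>2)"
    unfolding sum.distrib[symmetric] of_real_sum using sq by (intro sum.cong) auto
  then have "Re (\<Sum>j\<in>L. ?g ?zc j * al z j + al ?zc j * ?g z j + 1 * (al ?zc j * al z j)) + Re (\<Sum>j\<in>L. ?g ?zc j * ?g z j) \<ge> 0"
    by (simp only: plus_complex.sel(1)[symmetric] Re_complex_of_real) (simp add: sum_nonneg)
  then show ?thesis unfolding energy_def full coarse by simp
qed

section \<open>Local energies and imaginary parts\<close>

lemma nodes_cl_subset: "nodes_cl i \<subseteq> nodes D"
  unfolding nodes_Gam_def nodes_I_def by blast

lemma dot_Bloc_restrict: "dot (nodes D) u (mapply (Bloc D i) (nodes D) v) = dot (nodes_cl i) u (mapply (Bloc D i) (nodes_cl i) v)"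
  using loc_zero(1)[OF i] by (intro dot_restrict finite_nodes nodes_cl_subset)

lemma en_norm: "en i z = (H_norm D (sub D i) (fe_fun D z))\<^sup>2"
proof -
  have "complex_of_real ((H_norm D (sub D i) (fe_fun D z))\<^sup>2) = dot (nodes D) (\<lambda>p. cnj (z p)) (mapply (Hloc D i) (nodes D) z)"
    unfolding H_ip_norm(1)[OF meshed_sub[OF i] fe_fun_Vh, symmetric] H_ip_fe_fun[OF i] dot_def mapply_def
    by (simp add: sum_distrib_left mult.assoc)
  also have "\<dots> = dot (nodes_cl i) (\<lambda>p. cnj (z p)) (mapply (Hloc D i) (nodes_cl i) z)"
    using loc_zero(2)[OF i] by (intro dot_restrict finite_nodes nodes_cl_subset)
  finally show ?thesis unfolding en_def energy_def by (metis Re_complex_of_real)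
qed

lemma en_nonneg: "0 \<le> en i z" unfolding en_norm by simp

lemma en_cnj: "en i (\<lambda>p. cnj (z p)) = en i z"
proof -
  have "dot (nodes_cl i) z (mapply (Hloc D i) (nodes_cl i) (\<lambda>p. cnj (z p))) = dot (nodes_cl i) (\<lambda>p. cnj (z p)) (mapply (Hloc D i) (nodes_cl i) z)"
    by (rule dot_mapply_sym[OF Hloc_sym[OF i]])
  then show ?thesis unfolding en_def energy_def by simp
qed

lemma Bloc_Reals: "p \<in> nodes_cl i \<Longrightarrow> q \<in> nodes_cl i \<Longrightarrow> p \<in> I \<or> q \<in> I \<Longrightarrow> Bloc D i p q \<in> \<real>"
  unfolding complex_is_Real_iff using nodes_Pi_R(4)[OF i] nodes_cl_subset by (intro Im_Bloc_zero[OF i]) auto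

lemma QI_Reals: "QI E i p j \<in> \<real>"
  unfolding QI_def colsM_def by simp

lemma BL_Reals: "BL D E i p q \<in> \<real>"
  unfolding BL_def mprod_def tr_def
  by (intro sum_in_Reals Reals_mult QI_Reals) (simp add: minv_Bi)

text \<open>Interior nodes are off the outer boundary, so all blocks of \<open>Bloc\<close> that
  involve them are real, and so are the eigenvectors and \<open>BL\<close>. What is left of the
  imaginary part is the interface block, supported on \<open>nodes_Pi\<close>.\<close>

lemma imM_B0loc: "x \<in> X \<Longrightarrow> y \<in> X \<Longrightarrow> imM (B0loc D E i) x y = padPi D i (imM (Bloc D i)) x y"
proof -
  have im: "Im z = 0" if "z \<in> \<real>" for z using that complex_is_Real_iff by blast
  have Gs: "p \<in> G \<Longrightarrow> p \<in> nodes_cl i" and Is: "p \<in> I \<Longrightarrow> p \<in> nodes_cl i" for p by auto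
  have 1: "(Bloc D i \<odot>\<^bsub>I\<^esub> BL D E i \<odot>\<^bsub>I\<^esub> Bloc D i) p q \<in> \<real>" if "p \<in> G" "q \<in> G" for p q
    unfolding mprod_def using that Gs Is by (intro sum_in_Reals Reals_mult BL_Reals Bloc_Reals) auto
  have 2: "(Bloc D i \<odot>\<^bsub>I\<^esub> QI E i) p j \<in> \<real>" if "p \<in> G" for p j
    unfolding mprod_def using that Gs Is by (intro sum_in_Reals Reals_mult QI_Reals Bloc_Reals) auto
  have 3: "(tr (QI E i) \<odot>\<^bsub>I\<^esub> Bloc D i) j q \<in> \<real>" if "q \<in> G" for q j
    unfolding mprod_def tr_def using that Gs Is by (intro sum_in_Reals Reals_mult QI_Reals Bloc_Reals) auto
  have 4: "(tr (QI E i) \<odot>\<^bsub>I\<^esub> Bloc D i \<odot>\<^bsub>I\<^esub> QI E i) j l \<in> \<real>" for j l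
    unfolding mprod_def tr_def using Is by (intro sum_in_Reals Reals_mult QI_Reals Bloc_Reals) auto
  have 5: "Im (Bloc D i p q) = 0" if "p \<in> G" "q \<in> G" "p \<notin> Bd \<or> q \<notin> Bd" for p q
    using that nodes_cl_subset by (intro Im_Bloc_zero[OF i]) auto
  assume "x \<in> X" "y \<in> X"
  then show ?thesis
    using 1 2 3 4 5 im unfolding X0loc_def
    by (auto simp: imM_def B0loc_def block2_def padPi_def)
qed

lemma dot_padPi: "dot X u (mapply (padPi D i A) X v) = dot Bd (\<lambda>p. u (Inl p)) (mapply A Bd (\<lambda>p. v (Inl p)))"
proof -
  let ?A = "\<lambda>p q. if p \<in> Bd \<and> q \<in> Bd then A p q else 0"
  have "dot X u (mapply (padPi D i A) X v) = dot G (\<lambda>p. u (Inl p)) (mapply ?A G (\<lambda>p. v (Inl p)))"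
    unfolding padPi_def dot_block2 by (simp add: dot_def mapply_def)
  also have "\<dots> = dot Bd (\<lambda>p. u (Inl p)) (mapply ?A Bd (\<lambda>p. v (Inl p)))"
    using nodes_Pi_R(1)[OF i] by (intro dot_restrict finite_node_sets) auto
  also have "\<dots> = dot Bd (\<lambda>p. u (Inl p)) (mapply A Bd (\<lambda>p. v (Inl p)))"
    by (simp add: dot_def mapply_def)
  finally show ?thesis .
qed

lemma mapply_padPi: "p \<in> Bd \<Longrightarrow> mapply (padPi D i A) X v (Inl p) = mapply A Bd (\<lambda>p. v (Inl p)) p"
  unfolding padPi_def mapply_def sum_X0loc block2_def
  using nodes_Pi_R(1)[OF i] finite_node_sets(1) by (auto intro!: sum.mono_neutral_cong_right)

section \<open>The perturbation of the local coarse matrices\<close>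

definition PRe :: "('a cidx \<Rightarrow> complex) \<Rightarrow> 'a cidx \<Rightarrow> complex"
  where "PRe u = mapply (idM - PiRe D E i) X u"

definition PIm :: "('a cidx \<Rightarrow> complex) \<Rightarrow> 'a cidx \<Rightarrow> complex"
  where "PIm u = mapply (idM - padPi D i (PiIm D E i)) X u"

text \<open>The unprojected parts of \<open>B0loc\<close> cancel. What remains are the replaced
  forms, evaluated on the vectors that the projections leave over.\<close>

lemma BP3loc_diff:
  "dot X u (mapply (B0loc D E i) X v) - dot X u (mapply (BP3loc D E i) X v) =
    (dot X (PRe u) (mapply (reM (B0loc D E i)) X (PRe v)) - dot X (PRe u) (mapply (C0loc D E i) X (PRe v)))
    + \<i> * (dot X (PIm u) (mapply (imM (B0loc D E i)) X (PIm v)) - dot X (PIm u) (mapply (padPi D i (CDiag D E i)) X (PIm v)))"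
proof -
  have B0: "B0loc D E i = reM (B0loc D E i) + scl \<i> (imM (B0loc D E i))"
    unfolding reM_def imM_def scl_def by (intro ext) (simp add: complex_eq[symmetric])
  show ?thesis
    apply (subst (1) B0)
    unfolding BP3loc_def Let_def mapply_plus mapply_minus mapply_scl dot_add_right dot_diff_right dot_scale_right
      mapply_mprod dot_mapply_tr PRe_def PIm_def
    by (simp add: algebra_simps)
qed

lemma Re_estimate:
  "cmod (dot X (PRe u) (mapply (reM (B0loc D E i)) X (PRe v)) - dot X (PRe u) (mapply (C0loc D E i) X (PRe v)))
    \<le> 2 * etaRe E * 1 * (sqrt (energy X (H0loc D E i) u) * sqrt (energy X (H0loc D E i) v))"
proof (rule selection_estimate[OF finite_X0loc _ eta(1)])
  have s: "scl (complex_of_real 1) W = W" for W :: "('b, 'b) mtx" unfolding scl_def by simp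
  show "eigensystem X (reM (B0loc D E i)) (scl (complex_of_real 1) (H0loc D E i)) (H0loc D E i) (lamRe1 E i) (xiRe1 E i)"
    unfolding s by (rule eig_Re1)
  show "eigensystem (JRe1c D E i) (tr (QRe1 E i) \<odot>\<^bsub>X\<^esub> C0loc D E i \<odot>\<^bsub>X\<^esub> QRe1 E i)
      (tr (QRe1 E i) \<odot>\<^bsub>X\<^esub> scl (complex_of_real 1) (H0loc D E i) \<odot>\<^bsub>X\<^esub> QRe1 E i)
      (tr (QRe1 E i) \<odot>\<^bsub>X\<^esub> H0loc D E i \<odot>\<^bsub>X\<^esub> QRe1 E i) (lamRe2 E i) (phiRe2 E i)"
    unfolding s by (rule eig_Re2)
  show "PRe u p = u p - mapply (proj X (H0loc D E i) (JRe1 D E i) (JRe1c D E i) (JRe2 D E i) (QRe1 E i) (colsM (phiRe2 E i))) X u p"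
    if "p \<in> X" for u p
    using that finite_X0loc unfolding PRe_def mapply_minus PiRe_def proj_def Let_def QRe2_def by (simp add: mapply_idM)
qed (simp_all add: JRe1_def JRe1c_def JRe2_def QRe1_def)

text \<open>All matrices here live on \<open>nodes_Pi\<close>, so the selection estimate is applied
  on that index set, with \<open>t\<close> equal to h k; this produces the factor h k in
  \<open>\<delta>\<close>.\<close>

lemma Im_estimate:
  "cmod (dot X (PIm u) (mapply (imM (B0loc D E i)) X (PIm v)) - dot X (PIm u) (mapply (padPi D i (CDiag D E i)) X (PIm v)))
    \<le> 2 * etaIm E * (h * k) * (sqrt (energy Bd (Schur D i) (\<lambda>p. u (Inl p))) * sqrt (energy Bd (Schur D i) (\<lambda>p. v (Inl p))))"
proof -
  define P where "P w p = w p - mapply (PiIm D E i) Bd w p" for w p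
  have Pe: "PIm u (Inl p) = P (\<lambda>p. u (Inl p)) p" if p: "p \<in> Bd" for u p
  proof -
    have "Inl p \<in> X" using p nodes_Pi_R(1)[OF i] unfolding X0loc_def by auto
    then show ?thesis unfolding PIm_def mapply_minus P_def mapply_padPi[OF p] using finite_X0loc by (simp add: mapply_idM)
  qed
  have form: "dot Bd (\<lambda>p. PIm u (Inl p)) (mapply A Bd (\<lambda>p. PIm v (Inl p))) = dot Bd (P (\<lambda>p. u (Inl p))) (mapply A Bd (P (\<lambda>p. v (Inl p))))" for A
    using Pe by (intro dot_cong) (auto intro!: fun_cong[OF mapply_cong])
  have im: "dot X w (mapply (imM (B0loc D E i)) X x) = dot Bd (\<lambda>p. w (Inl p)) (mapply (imM (Bloc D i)) Bd (\<lambda>p. x (Inl p)))" for w x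
    unfolding dot_padPi[symmetric] using imM_B0loc by (intro dot_cong refl mapply_cong2) auto
  have "cmod (dot Bd (P (\<lambda>p. u (Inl p))) (mapply (imM (Bloc D i)) Bd (P (\<lambda>p. v (Inl p)))) -
      dot Bd (P (\<lambda>p. u (Inl p))) (mapply (CDiag D E i) Bd (P (\<lambda>p. v (Inl p)))))
    \<le> 2 * etaIm E * (h * k) * (sqrt (energy Bd (Schur D i) (\<lambda>p. u (Inl p))) * sqrt (energy Bd (Schur D i) (\<lambda>p. v (Inl p))))"
  proof (rule selection_estimate[OF finite_node_sets(3) _ eta(2)])
    show "0 \<le> h * k" using mesh_size_nonneg wavenumber_pos by simp
    show "eigensystem Bd (imM (Bloc D i)) (scl (complex_of_real (h * k)) (Schur D i)) (Schur D i) (lamIm1 E i) (xiIm1 E i)"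
      using eig_Im1 unfolding hkS_def .
    show "eigensystem (JIm1c D E i) (tr (QIm1 E i) \<odot>\<^bsub>Bd\<^esub> CDiag D E i \<odot>\<^bsub>Bd\<^esub> QIm1 E i)
      (tr (QIm1 E i) \<odot>\<^bsub>Bd\<^esub> scl (complex_of_real (h * k)) (Schur D i) \<odot>\<^bsub>Bd\<^esub> QIm1 E i)
      (tr (QIm1 E i) \<odot>\<^bsub>Bd\<^esub> Schur D i \<odot>\<^bsub>Bd\<^esub> QIm1 E i) (lamIm2 E i) (phiIm2 E i)"
      using eig_Im2 unfolding hkS_def .
    show "P w p = w p - mapply (proj Bd (Schur D i) (JIm1 D E i) (JIm1c D E i) (JIm2 D E i) (QIm1 E i) (colsM (phiIm2 E i))) Bd w p"
      for w p
      unfolding P_def PiIm_def proj_def Let_def QIm2_def ..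
  qed (simp_all add: JIm1_def JIm1c_def JIm2_def QIm1_def)
  then show ?thesis unfolding im dot_padPi form .
qed

text \<open>An instance of \<open>schur_energy_le\<close>. Definiteness on \<open>nodes_R\<close>
  comes from the energy norm of the subdomain, after extending a vector on \<open>nodes_R\<close> by
  zero.\<close>

lemma Schur_energy: "energy Bd (Schur D i) z \<le> en i z"
proof -
  note R = nodes_Pi_R[OF i]
  have sub: "energy (nodes_R D i) (Hloc D i) u = en i (\<lambda>p. if p \<in> nodes_R D i then u p else 0)" for u
  proof -
    let ?u = "\<lambda>p. if p \<in> nodes_R D i then u p else 0"
    have fin: "finite (nodes_cl i)" using finite_node_sets by simp
    have m: "mapply (Hloc D i) (nodes_cl i) ?u = mapply (Hloc D i) (nodes_R D i) u"
      unfolding mapply_def using R(2) fin by (intro ext sum.mono_neutral_cong_right) auto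
    have "dot (nodes_cl i) (\<lambda>p. cnj (?u p)) w = dot (nodes_R D i) (\<lambda>p. cnj (u p)) w" for w
      unfolding dot_def using R(2) fin by (intro sum.mono_neutral_cong_right) auto
    then show ?thesis unfolding en_def energy_def m by simp
  qed
  have "energy Bd (Schur D i) z \<le> energy (Bd \<union> nodes_R D i) (Hloc D i) z"
    unfolding Schur_def
  proof (rule schur_energy_le[OF finite_node_sets(3,4) R(3) Hloc_sym[OF i] Hloc_cnj[OF i]])
    show "0 \<le> energy (nodes_R D i) (Hloc D i) u" for u unfolding sub by (rule en_nonneg)
    fix u assume "energy (nodes_R D i) (Hloc D i) u = 0"
    then have "H_norm D (sub D i) (fe_fun D (\<lambda>p. if p \<in> nodes_R D i then u p else 0)) = 0"
      unfolding sub en_norm by simp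
    note zero = H_norm_sub_eq_0[OF i this, unfolded R(2)]
    show "\<forall>p\<in>nodes_R D i. u p = 0"
    proof
      fix p assume "p \<in> nodes_R D i"
      then show "u p = 0" using zero[of p] by simp
    qed
  qed
  then show ?thesis unfolding en_def R(2) .
qed

text \<open>The real part is measured in the coarse energy, the imaginary part in the Schur energy.
  Both are bounded by the full local energy, so the two constants add up to one.\<close>

lemma local_estimate:
  "cmod (dot X (crs z) (mapply (B0loc D E i) X (crs y)) - dot X (crs z) (mapply (BP3loc D E i) X (crs y)))
    \<le> (2 * etaRe E + 2 * h * k * etaIm E) * (sqrt (en i z) * sqrt (en i y))"
proof -
  have c: "(\<lambda>p. crs u (Inl p)) = u" for u unfolding crs_def by simp
  have hk: "0 \<le> 2 * etaIm E * (h * k)" using eta mesh_size_nonneg wavenumber_pos by simp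
  have Re: "sqrt (energy X (H0loc D E i) (crs z)) * sqrt (energy X (H0loc D E i) (crs y)) \<le> sqrt (en i z) * sqrt (en i y)"
    using coarse_energy_le energy_nonneg_eig[OF finite_X0loc eig_Re1] unfolding en_def
    by (intro mult_mono real_sqrt_le_mono) (auto intro: order_trans)
  have Im: "sqrt (energy Bd (Schur D i) z) * sqrt (energy Bd (Schur D i) y) \<le> sqrt (en i z) * sqrt (en i y)"
    using Schur_energy energy_nonneg_eig[OF finite_node_sets(3) eig_Im1] en_nonneg
    by (intro mult_mono real_sqrt_le_mono) auto
  show ?thesis
    unfolding BP3loc_diff
    apply (rule order_trans[OF norm_triangle_ineq])
    unfolding norm_mult norm_ii mult_1
    apply (rule order_trans[OF add_mono[OF Re_estimate Im_estimate]])
    unfolding c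
    using mult_left_mono[OF Re, of "2 * etaRe E"] mult_left_mono[OF Im hk] eta by (simp add: algebra_simps)
qed

end

section \<open>The coarse problem\<close>

lemma X0loc_X0: "i < nsub D \<Longrightarrow> X0loc D E i \<subseteq> X0 D E"
  using nodes_Gam_skel unfolding X0loc_def X0_def by blast

lemma finite_X0: "finite (X0 D E)"
proof -
  have "{Inr (i, j) :: 'a cidx | i j. i < nsub D \<and> j \<in> JS D E i} = (\<Union>i<nsub D. (\<lambda>j. Inr (i, j)) ` JS D E i)" by auto
  then show ?thesis unfolding X0_def using finite_node_sets finite_JS by simp
qed

definition assembled :: "(nat \<Rightarrow> ('a cidx, 'a cidx) mtx) \<Rightarrow> ('a cidx, 'a cidx) mtx"
  where "assembled M = (\<Sum>i<nsub D. tr (restr (X0loc D E i)) \<odot>\<^bsub>X0loc D E i\<^esub> M i \<odot>\<^bsub>X0loc D E i\<^esub> restr (X0loc D E i))"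

lemma dot_assembled:
  "dot (X0 D E) u (mapply (assembled M) (X0 D E) v) = (\<Sum>i<nsub D. dot (X0loc D E i) u (mapply (M i) (X0loc D E i) v))"
proof -
  have "dot (X0 D E) u (mapply (assembled M) (X0 D E) v) =
    (\<Sum>i<nsub D. dot (X0 D E) u (mapply (tr (restr (X0loc D E i))) (X0loc D E i) (mapply (M i) (X0loc D E i) (mapply (restr (X0loc D E i)) (X0 D E) v))))"
    unfolding assembled_def mapply_sum mapply_mprod dot_def by (subst sum.swap) (simp add: sum_distrib_left)
  also have "\<dots> = (\<Sum>i<nsub D. dot (X0loc D E i) u (mapply (M i) (X0loc D E i) v))"
  proof (intro sum.cong refl)
    fix i assume "i \<in> {..<nsub D}"
    then have r: "x \<in> X0loc D E i \<Longrightarrow> mapply (restr (X0loc D E i)) (X0 D E) v x = v x" for x v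
      using mapply_restr[OF finite_X0 X0loc_X0] by simp
    show "dot (X0 D E) u (mapply (tr (restr (X0loc D E i))) (X0loc D E i) (mapply (M i) (X0loc D E i) (mapply (restr (X0loc D E i)) (X0 D E) v)))
      = dot (X0loc D E i) u (mapply (M i) (X0loc D E i) v)"
      unfolding dot_mapply_tr using r by (intro dot_cong) (auto intro!: fun_cong[OF mapply_cong])
  qed
  finally show ?thesis .
qed

abbreviation "B0 \<equiv> assembled (B0loc D E)"
abbreviation "R0 w \<equiv> mapply (R0T D E) (X0 D E) w"
abbreviation "nn z \<equiv> H_norm D (Omega D) (fe_fun D z)"
abbreviation "\<delta> \<equiv> 2 * etaRe E + 2 * h * k * etaIm E"

lemma BP3_assembled: "BP3 D E = assembled (BP3loc D E)"
  unfolding BP3_def assembled_def ..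

lemma mapply_eqI_dot:
  assumes "finite J" "\<And>u. dot J u v = dot J u w" "x \<in> J" shows "v x = w x"
  using assms(2)[of "\<lambda>y. of_bool (y = x)"] assms(1,3) unfolding dot_def by simp

lemma nn_nonneg: "0 \<le> nn z"
  using H_ip_norm(2)[OF meshed_Omega fe_fun_Vh] .

lemma nn_en: "(nn z)\<^sup>2 = (\<Sum>i<nsub D. en i z)"
proof -
  have "complex_of_real ((nn z)\<^sup>2) = complex_of_real (\<Sum>i<nsub D. (H_norm D (sub D i) (fe_fun D z))\<^sup>2)"
    unfolding H_ip_norm(1)[OF meshed_Omega fe_fun_Vh, symmetric] H_ip_sum[OF fe_fun_Vh fe_fun_Vh]
    using H_ip_norm(1)[OF meshed_sub fe_fun_Vh] by simp
  then show ?thesis unfolding of_real_eq_iff by (simp add: en_norm)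
qed

lemma nn_cnj: "nn (\<lambda>p. cnj (z p)) = nn z"
proof -
  have "(nn (\<lambda>p. cnj (z p)))\<^sup>2 = (nn z)\<^sup>2" unfolding nn_en by (simp add: en_cnj)
  then show ?thesis using nn_nonneg by (simp add: power2_eq_iff_nonneg)
qed

lemma nn_eq_0: "nn z = 0 \<Longrightarrow> p \<in> nodes D \<Longrightarrow> z p = 0"
  using H_norm_Omega_eq_0[OF fe_fun_Vh, of z] fe_fun_node[of p z] by simp

lemma b_form_nodal: "b_form D (fe_fun D y) (fe_fun D z) = (\<Sum>i<nsub D. dot (nodes_cl i) (\<lambda>p. cnj (z p)) (mapply (Bloc D i) (nodes_cl i) y))"
  unfolding b_form_sum[OF fe_fun_Vh fe_fun_Vh]
proof (intro sum.cong refl)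
  fix i assume "i \<in> {..<nsub D}"
  then have i: "i < nsub D" by simp
  show "b_form_loc D i (fe_fun D y) (fe_fun D z) = dot (nodes_cl i) (\<lambda>p. cnj (z p)) (mapply (Bloc D i) (nodes_cl i) y)"
    unfolding b_form_fe_fun[OF i] dot_Bloc_restrict[OF i, symmetric] unfolding dot_def mapply_def
    by (simp add: sum_distrib_left mult.assoc)
qed

lemma dot_Bmat: "dot (nodes D) z (mapply (Bmat D) (nodes D) y) = (\<Sum>i<nsub D. dot (nodes_cl i) z (mapply (Bloc D i) (nodes_cl i) y))"
proof -
  have "Bmat D = (\<Sum>i<nsub D. Bloc D i)" using Bmat_sum by (intro ext) (simp add: sum_fun_apply)
  then have "dot (nodes D) z (mapply (Bmat D) (nodes D) y) = (\<Sum>i<nsub D. dot (nodes D) z (mapply (Bloc D i) (nodes D) y))"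
    unfolding dot_def by (simp add: mapply_sum sum_distrib_left) (rule sum.swap)
  then show ?thesis using dot_Bloc_restrict by simp
qed

section \<open>The coarse extension and its Galerkin property\<close>

lemma R0_skel: assumes "p \<in> nodes_skel D" shows "R0 w p = w (Inl p)"
proof -
  have "R0 w p = (\<Sum>x\<in>X0 D E. if x = Inl p then w x else 0)"
    unfolding mapply_def R0T_def using assms by (intro sum.cong) auto
  moreover have "Inl p \<in> X0 D E" using assms unfolding X0_def by blast
  ultimately show ?thesis using finite_X0 by simp
qed

lemma R0_I: assumes i: "i < nsub D" and p: "p \<in> nodes_I D i"
  shows "R0 w p = mapply (Eloc D E i) (X0loc D E i) w p"
proof -
  let ?A = "\<lambda>j. tr (restr (nodes_I D j)) \<odot>\<^bsub>nodes_I D j\<^esub> Eloc D E j \<odot>\<^bsub>X0loc D E j\<^esub> restr (X0loc D E j)"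
  have "p \<notin> nodes_skel D" using nodes_I_skel[OF i] p by blast
  then have "R0 w p = mapply (\<Sum>j<nsub D. ?A j) (X0 D E) w p"
    by (intro mapply_cong2) (simp add: R0T_def)
  also have "\<dots> = (\<Sum>j<nsub D. mapply (?A j) (X0 D E) w p)" unfolding mapply_sum ..
  also have "\<dots> = (\<Sum>j<nsub D. if j = i then mapply (Eloc D E i) (X0loc D E i) w p else 0)"
  proof (intro sum.cong refl)
    fix j assume "j \<in> {..<nsub D}"
    then have j: "j < nsub D" by simp
    have "mapply (restr (X0loc D E j)) (X0 D E) w x = w x" if "x \<in> X0loc D E j" for x
      using that mapply_restr[OF finite_X0 X0loc_X0[OF j]] by simp
    then have "mapply (Eloc D E j) (X0loc D E j) (mapply (restr (X0loc D E j)) (X0 D E) w) = mapply (Eloc D E j) (X0loc D E j) w"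
      by (rule mapply_cong)
    then show "mapply (?A j) (X0 D E) w p = (if j = i then mapply (Eloc D E i) (X0loc D E i) w p else 0)"
      unfolding mapply_mprod using mapply_tr_restr[OF finite_node_sets(2)[of j]] nodes_I_disjoint[OF i j] p by auto
  qed
  finally show ?thesis using i by simp
qed

lemma R0_ext: assumes i: "i < nsub D" and p: "p \<in> nodes_cl i" shows "R0 w p = ext i w p"
  using R0_I[OF i] R0_skel[of p w] p nodes_Gam_skel[OF i] unfolding ext_def by auto

text \<open>The sum of \<open>local_form\<close> over the subdomains. It holds for every nodal
  vector \<open>z\<close>, so it contains the orthogonality of the extension to the spans of Q_L,
  whose coarse components vanish.\<close>

lemma galerkin: "dot (nodes D) z (mapply (Bmat D) (nodes D) (R0 w)) = dot (X0 D E) (crs z) (mapply B0 (X0 D E) w)"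
  unfolding dot_Bmat dot_assembled
proof (intro sum.cong refl)
  fix i assume "i \<in> {..<nsub D}"
  then have i: "i < nsub D" by simp
  have "mapply (Bloc D i) (nodes_cl i) (R0 w) = mapply (Bloc D i) (nodes_cl i) (ext i w)"
    using R0_ext[OF i] by (rule mapply_cong)
  then show "dot (nodes_cl i) z (mapply (Bloc D i) (nodes_cl i) (R0 w)) = dot (X0loc D E i) (crs z) (mapply (B0loc D E i) (X0loc D E i) w)"
    using local_form[OF i] by simp
qed

lemma crs_R0: assumes "x \<in> X0 D E" shows "crs (R0 w) x = w x"
proof -
  from assms consider p where "x = Inl p" "p \<in> nodes_skel D" | i j where "x = Inr (i, j)" "i < nsub D" "j \<in> JS D E i"
    unfolding X0_def by blast
  then show ?thesis
  proof cases
    case 1 then show ?thesis using R0_skel unfolding crs_def by simp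
  next
    case (2 i j)
    have "eigcoord (nodes_I D i) (Hloc D i) (phiI E i) (R0 w) = eigcoord (nodes_I D i) (Hloc D i) (phiI E i) (ext i w)"
      using R0_ext[OF 2(2)] by (intro eigcoord_cong) auto
    then show ?thesis using ext_coord[OF 2(2), of j w] 2(1,3) unfolding crs_def by (simp add: JS_def)
  qed
qed

text \<open>Cauchy-Schwarz over the subdomains, whose local energies sum to the squared global norm
  by \<open>nn_en\<close>, so the constant stays that of the local estimates.\<close>

lemma coarse_estimate:
  "cmod (dot (X0 D E) (crs z) (mapply B0 (X0 D E) (crs y)) - dot (X0 D E) (crs z) (mapply (BP3 D E) (X0 D E) (crs y)))
    \<le> \<delta> * (nn z * nn y)"
proof -
  have d: "0 \<le> \<delta>" using eta mesh_size_nonneg wavenumber_pos by simp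
  have sq: "sqrt (\<Sum>i<nsub D. (sqrt (en i u))\<^sup>2) = nn u" for u
    using nn_en[of u, symmetric] nn_nonneg[of u] by (simp add: en_nonneg)
  have "cmod (dot (X0 D E) (crs z) (mapply B0 (X0 D E) (crs y)) - dot (X0 D E) (crs z) (mapply (BP3 D E) (X0 D E) (crs y)))
    \<le> (\<Sum>i<nsub D. \<delta> * (sqrt (en i z) * sqrt (en i y)))"
    unfolding BP3_assembled dot_assembled sum_subtractf[symmetric]
    using local_estimate by (intro sum_norm_le) auto
  also have "\<dots> = \<delta> * (\<Sum>i<nsub D. \<bar>sqrt (en i z)\<bar> * \<bar>sqrt (en i y)\<bar>)"
    by (simp add: sum_distrib_left en_nonneg)
  also have "\<dots> \<le> \<delta> * (L2_set (\<lambda>i. sqrt (en i z)) {..<nsub D} * L2_set (\<lambda>i. sqrt (en i y)) {..<nsub D})"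
    by (intro mult_left_mono L2_set_mult_ineq d)
  finally show ?thesis unfolding L2_set_def sq .
qed

lemma B0_sym: "dot (X0 D E) u (mapply B0 (X0 D E) w) = dot (X0 D E) w (mapply B0 (X0 D E) u)"
  unfolding dot_assembled
proof (intro sum.cong refl)
  fix i assume "i \<in> {..<nsub D}"
  then have i: "i < nsub D" by simp
  show "dot (X0loc D E i) u (mapply (B0loc D E i) (X0loc D E i) w) = dot (X0loc D E i) w (mapply (B0loc D E i) (X0loc D E i) u)"
    unfolding B0loc_form[OF i] dot_mapply_sym[of "Bloc D i", OF Bloc_sym[OF i], of _ "\<lambda>p. u (Inl p)" _ "\<lambda>p. w (Inl p)"]
    by (simp add: algebra_simps)
qed

lemma Bmat_sym: "Bmat D q p = Bmat D p q"
  unfolding Bmat_sum using Bloc_sym by simp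

text \<open>The transpose of \<open>galerkin\<close>, by symmetry of both matrices. It identifies
  the right-hand side of the coarse solve as the exact coarse matrix applied to the coarse
  component.\<close>

lemma R0_adjoint: assumes "x \<in> X0 D E"
  shows "mapply (tr (R0T D E)) (nodes D) (mapply (Bmat D) (nodes D) v) x = mapply B0 (X0 D E) (crs v) x"
proof (rule mapply_eqI_dot[OF finite_X0 _ assms])
  fix u
  have "dot (X0 D E) u (mapply (tr (R0T D E)) (nodes D) (mapply (Bmat D) (nodes D) v)) = dot (nodes D) (R0 u) (mapply (Bmat D) (nodes D) v)"
    by (rule dot_mapply_tr)
  also have "\<dots> = dot (nodes D) v (mapply (Bmat D) (nodes D) (R0 u))" by (rule dot_mapply_sym[OF Bmat_sym])
  also have "\<dots> = dot (X0 D E) u (mapply B0 (X0 D E) (crs v))" unfolding galerkin by (rule B0_sym)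
  finally show "dot (X0 D E) u (mapply (tr (R0T D E)) (nodes D) (mapply (Bmat D) (nodes D) v)) = dot (X0 D E) u (mapply B0 (X0 D E) (crs v))" .
qed

text \<open>On \<open>JS\<close> the extension of the coarse component already has the coordinates
  of \<open>v\<close>. On \<open>JL\<close> it has -g/\<mu>, and the local solve adds (g + \<mu>
  a)/\<mu>, which leaves exactly the coordinate a of \<open>v\<close>.\<close>

lemma BL_residual:
  assumes i: "i < nsub D" and p: "p \<in> nodes_I D i"
  shows "R0 (crs v) p + mapply (BL D E i) (nodes_I D i) (mapply (Bmat D) (nodes D) v) p = v p"
proof -
  let ?I = "nodes_I D i" and ?G = "nodes_Gam D i" and ?n = "card (nodes_I D i)"
  let ?al = "eigcoord ?I (Hloc D i) (phiI E i)" and ?g = "gc i (Bloc D i) v" and ?mu = "\<lambda>j. complex_of_real (muI E i j)"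
  have disj: "?G \<inter> ?I = {}" using nodes_I_Gam[OF i i] by blast
  \<comment> \<open>A row of an interior node receives contributions from its own subdomain
    only.\<close>
  have B: "mapply (Bmat D) (nodes D) v q = mapply (Bloc D i) ?G v q + mapply (Bloc D i) ?I v q" if q: "q \<in> ?I" for q
  proof -
    have qn: "q \<in> nodes D" using q unfolding nodes_I_def by blast
    have "Bloc D j q r = 0" if "j < nsub D" "j \<noteq> i" "r \<in> nodes D" for j r
      using loc_zero(1)[OF that(1) qn that(3)] nodes_I_disjoint[OF i that(1)] nodes_I_Gam[OF i that(1)] that(2) q by blast
    then have "Bmat D q r = Bloc D i q r" if "r \<in> nodes D" for r
      unfolding Bmat_sum using i that by (subst sum.mono_neutral_right[of "{..<nsub D}" "{i}"]) auto
    then have "mapply (Bmat D) (nodes D) v q = mapply (Bloc D i) (nodes D) v q" by (intro mapply_cong2) simp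
    also have "\<dots> = mapply (Bloc D i) (nodes_cl i) v q"
      unfolding mapply_def using loc_zero(1)[OF i qn] finite_nodes nodes_cl_subset[OF i] by (intro sum.mono_neutral_right) auto
    finally show ?thesis unfolding mapply_union[OF finite_node_sets(1,2) disj] .
  qed
  have t: "mapply (tr (QI E i)) ?I (mapply (Bmat D) (nodes D) v) j = ?g j + ?mu j * ?al v j" if j: "j < ?n" for j
  proof -
    have "mapply (tr (QI E i)) ?I (mapply (Bmat D) (nodes D) v) j
      = mapply (tr (QI E i)) ?I (\<lambda>q. mapply (Bloc D i) ?G v q + mapply (Bloc D i) ?I v q) j"
      using B by (intro mapply_cong2) simp
    also have "\<dots> = ?g j + mapply (tr (QI E i)) ?I (mapply (Bloc D i) ?I v) j" unfolding mapply_add gc_def ..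
    also have "mapply (Bloc D i) ?I v = mapply (Bloc D i) ?I (mapply (QI E i) {..<?n} (?al v))"
      by (rule mapply_cong) (rule Q_expansion[OF i])
    also have "mapply (tr (QI E i)) ?I \<dots> j = mapply (tr (QI E i) \<odot>\<^bsub>?I\<^esub> Bloc D i \<odot>\<^bsub>?I\<^esub> QI E i) {..<?n} (?al v) j"
      unfolding mapply_mprod ..
    also have "\<dots> = (\<Sum>l<?n. if j = l then ?mu j * ?al v l else 0)"
      unfolding mapply_def using Q_diag(2)[OF i j] by (intro sum.cong) auto
    finally show ?thesis using j by simp
  qed
  have "v p = (\<Sum>j\<in>JS D E i \<union> JL D E i. QI E i p j * ?al v j)"
    using Q_expansion[OF i p, of v] unfolding mapply_def JS_JL .
  also have "\<dots> = (\<Sum>j\<in>JS D E i. QI E i p j * ?al v j) + (\<Sum>j\<in>JL D E i. QI E i p j * ?al v j)"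
    by (rule sum.union_disjoint[OF finite_JS finite_JL JS_Int_JL])
  finally have v: "v p = \<dots>" .
  have "R0 (crs v) p = ext i (crs v) p" using R0_ext[OF i] p by blast
  also have "\<dots> = (\<Sum>j\<in>JS D E i \<union> JL D E i. QI E i p j * ?al (ext i (crs v)) j)"
    using Q_expansion[OF i p, of "ext i (crs v)"] unfolding mapply_def JS_JL .
  also have "\<dots> = (\<Sum>j\<in>JS D E i. QI E i p j * ?al (ext i (crs v)) j) + (\<Sum>j\<in>JL D E i. QI E i p j * ?al (ext i (crs v)) j)"
    by (rule sum.union_disjoint[OF finite_JS finite_JL JS_Int_JL])
  also have "(\<Sum>j\<in>JS D E i. QI E i p j * ?al (ext i (crs v)) j) = (\<Sum>j\<in>JS D E i. QI E i p j * ?al v j)"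
    using ext_coord[OF i] by (intro sum.cong) (auto simp: JS_def crs_def)
  also have "(\<Sum>j\<in>JL D E i. QI E i p j * ?al (ext i (crs v)) j) = (\<Sum>j\<in>JL D E i. QI E i p j * (- ?g j / ?mu j))"
    using ext_coord[OF i, of _ "crs v"] JS_Int_JL by (intro sum.cong) (auto simp: JS_def JL_def crs_def)
  finally have R: "R0 (crs v) p = (\<Sum>j\<in>JS D E i. QI E i p j * ?al v j) + (\<Sum>j\<in>JL D E i. QI E i p j * (- ?g j / ?mu j))" .
  have "mapply (BL D E i) ?I (mapply (Bmat D) (nodes D) v) p = (\<Sum>j\<in>JL D E i. QI E i p j * (1 / ?mu j * (?g j + ?mu j * ?al v j)))"
    unfolding mapply_BL[OF i] unfolding mapply_def[of "QI E i"] using t by (intro sum.cong) (auto simp: JL_def)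
  moreover have "(\<Sum>j\<in>JL D E i. QI E i p j * (- ?g j / ?mu j)) + (\<Sum>j\<in>JL D E i. QI E i p j * (1 / ?mu j * (?g j + ?mu j * ?al v j)))
    = (\<Sum>j\<in>JL D E i. QI E i p j * ?al v j)"
    unfolding sum.distrib[symmetric] using mu_L[OF i] by (intro sum.cong) (auto simp: field_simps)
  ultimately show ?thesis unfolding v R by (simp add: add.assoc)
qed

section \<open>The preconditioned operator\<close>

definition PB :: "('a \<Rightarrow> complex) \<Rightarrow> 'a \<Rightarrow> complex"
  where "PB v = mapply (P3inv D E) (nodes D) (mapply (Bmat D) (nodes D) v)"

text \<open>The vector w of the overview: the outcome of the coarse solve minus the coarse component
  of \<open>v\<close>.\<close>

definition coarse_error_vec :: "('a \<Rightarrow> complex) \<Rightarrow> 'a cidx \<Rightarrow> complex"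
  where "coarse_error_vec v x = mapply (minv (X0 D E) (BP3 D E)) (X0 D E) (mapply (tr (R0T D E)) (nodes D) (mapply (Bmat D) (nodes D) v)) x - crs v x"

text \<open>The extension of the coarse component together with the local solves restores
  \<open>v\<close>: by \<open>BL_residual\<close> in the interiors, and trivially on the interface,
  where no local solve acts. Only the extension of the coarse error is left over.\<close>

lemma PB_eq: assumes p: "p \<in> nodes D" shows "PB v p = v p + R0 (coarse_error_vec v) p"
proof -
  let ?f = "mapply (Bmat D) (nodes D) v"
  let ?y = "mapply (minv (X0 D E) (BP3 D E)) (X0 D E) (mapply (tr (R0T D E)) (nodes D) ?f)"
  let ?L = "\<lambda>i. tr (restr (nodes_I D i)) \<odot>\<^bsub>nodes_I D i\<^esub>
         (QI E i \<odot>\<^bsub>JL D E i\<^esub> minv (JL D E i) (Bi D E i) \<odot>\<^bsub>JL D E i\<^esub> tr (QI E i))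
         \<odot>\<^bsub>nodes_I D i\<^esub> restr (nodes_I D i)"
  have L: "mapply (?L i) (nodes D) ?f p = (if p \<in> nodes_I D i then mapply (BL D E i) (nodes_I D i) ?f p else 0)" for i
  proof -
    have "nodes_I D i \<subseteq> nodes D" unfolding nodes_I_def by blast
    then have "mapply (BL D E i) (nodes_I D i) (mapply (restr (nodes_I D i)) (nodes D) ?f) = mapply (BL D E i) (nodes_I D i) ?f"
      using mapply_restr[OF finite_nodes] by (intro mapply_cong) simp
    then show ?thesis unfolding BL_def[symmetric] by (simp add: mapply_mprod mapply_tr_restr[OF finite_node_sets(2)])
  qed
  have "mapply (R0T D E \<odot>\<^bsub>X0 D E\<^esub> minv (X0 D E) (BP3 D E) \<odot>\<^bsub>X0 D E\<^esub> tr (R0T D E)) (nodes D) ?f = R0 ?y"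
    by (simp only: mapply_mprod)
  then have PB: "PB v p = R0 ?y p + (\<Sum>i<nsub D. if p \<in> nodes_I D i then mapply (BL D E i) (nodes_I D i) ?f p else 0)"
    unfolding PB_def P3inv_def mapply_plus mapply_sum L by simp
  have w: "R0 (coarse_error_vec v) p = R0 ?y p - R0 (crs v) p"
  proof -
    have "coarse_error_vec v = (\<lambda>x. ?y x - crs v x)" using coarse_error_vec_def by blast
    then show ?thesis by (simp add: mapply_diff)
  qed
  from p consider "p \<in> nodes_skel D" | i where "i < nsub D" "p \<in> nodes_I D i" using nodes_decomp by blast
  then have "R0 (crs v) p + (\<Sum>i<nsub D. if p \<in> nodes_I D i then mapply (BL D E i) (nodes_I D i) ?f p else 0) = v p"
  proof cases
    case 1
    then have "p \<notin> nodes_I D i" if "i < nsub D" for i using nodes_I_skel[OF that] by blast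
    then show ?thesis using R0_skel[OF 1] by (simp add: crs_def)
  next
    case (2 i)
    have "(\<Sum>j<nsub D. if p \<in> nodes_I D j then mapply (BL D E j) (nodes_I D j) ?f p else 0) =
      (\<Sum>j<nsub D. if j = i then mapply (BL D E i) (nodes_I D i) ?f p else 0)"
      using nodes_I_disjoint[OF 2(1)] 2(2) by (intro sum.cong) auto
    then show ?thesis using BL_residual[OF 2] 2(1) by simp
  qed
  then show ?thesis unfolding PB w by (simp add: algebra_simps)
qed

lemma P3inv_B_eq: "P3inv_B D E v = fe_fun D (PB v)"
  unfolding P3inv_B_def PB_def ..

lemma PB_scale: "PB (\<lambda>x. a * v x) = (\<lambda>x. a * PB v x)"
  unfolding PB_def mapply_scale ..

lemma continuous_PB: "continuous_on K (\<lambda>c. PB (fe_fun D c) p)"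
proof -
  have "PB (fe_fun D c) = PB c" for c
    unfolding PB_def using fe_fun_node by (simp cong: mapply_cong)
  moreover have "continuous_on K (\<lambda>c. PB c p)"
    unfolding PB_def by (intro continuous_mapply continuous_on_coordinate)
  ultimately show ?thesis by simp
qed

end

section \<open>Consequences of the inf-sup condition\<close>

locale helmholtz_infsup = helmholtz_selection D \<sigma> E for D :: "'a::euclidean_space helmholtz" and \<sigma> and E +
  fixes \<gamma> :: real
  assumes inf_sup_le: "ereal \<gamma> \<le> inf_sup D" and gap: "0 < \<gamma> - (2 * etaRe E + 2 * mesh_size D * wavenumber D * etaIm E)"
begin

lemma inf_sup_bound:
  assumes u: "u \<in> Vh D" and M: "0 \<le> M" and b: "\<And>v. v \<in> Vh D \<Longrightarrow> cmod (b_form D u v) \<le> M * H_norm D (Omega D) v"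
  shows "\<gamma> * H_norm D (Omega D) u \<le> M"
proof (cases "u = 0")
  case True
  then have "H_norm D (Omega D) u = nn (\<lambda>_. 0)" using fe_fun_id[OF u] by (simp add: zero_fun_def)
  also have "\<dots> = 0" using nn_en[of "\<lambda>_. 0"] by (simp add: en_def energy_def dot_def)
  finally show ?thesis using M by simp
next
  case False
  have pos: "0 < H_norm D (Omega D) v" if "v \<in> Vh D - {0}" for v
    using that H_norm_Omega_eq_0[of v] H_ip_norm(2)[OF meshed_Omega, of v] by force
  have "ereal \<gamma> \<le> (SUP v\<in>Vh D - {0}. ereal (cmod (b_form D u v) / (H_norm D (Omega D) u * H_norm D (Omega D) v)))"
    using order_trans[OF inf_sup_le[unfolded inf_sup_def] INF_lower[of u "Vh D - {0}"]] u False by blast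
  also have "\<dots> \<le> ereal (M / H_norm D (Omega D) u)"
  proof (rule SUP_least)
    fix v assume v: "v \<in> Vh D - {0}"
    show "ereal (cmod (b_form D u v) / (H_norm D (Omega D) u * H_norm D (Omega D) v)) \<le> ereal (M / H_norm D (Omega D) u)"
      using b[of v] pos[OF v] pos[of u] u False v by (simp add: field_simps)
  qed
  finally show ?thesis using pos[of u] u False by (simp add: field_simps)
qed

text \<open>
  Here the error \<open>w\<close> of the inexact coarse solve is controlled: by \<open>galerkin\<close> only the perturbation
  \<open>B0 - BP3\<close> of the coarse matrix enters \<open>b(R0 w, \<cdot>)\<close>.
\<close>

lemma coarse_error_bound:
  assumes eq: "\<And>x. x \<in> X0 D E \<Longrightarrow> mapply (BP3 D E) (X0 D E) w x = mapply B0 (X0 D E) (crs v) x - mapply (BP3 D E) (X0 D E) (crs v) x"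
  shows "\<gamma> * nn (R0 w) \<le> \<delta> * (nn (R0 w) + nn v)"
proof (rule inf_sup_bound[OF fe_fun_Vh])
  have d: "0 \<le> \<delta>" using eta mesh_size_nonneg wavenumber_pos by simp
  show "0 \<le> \<delta> * (nn (R0 w) + nn v)" using d nn_nonneg by simp
  fix f assume "f \<in> Vh D"
  then have f: "f = fe_fun D f" using fe_fun_id by simp
  \<comment> \<open>The form conjugates its second argument while \<open>dot\<close> does not, so
    the nodal test vector is the conjugate, which has the same norm by
    \<open>nn_cnj\<close>.\<close>
  let ?z = "\<lambda>p. cnj (f p)"
  let ?X = "X0 D E"
  have cw: "mapply A ?X (crs (R0 w)) = mapply A ?X w" for A using crs_R0 by (rule mapply_cong)
  have "b_form D (fe_fun D (R0 w)) f = dot (nodes D) ?z (mapply (Bmat D) (nodes D) (R0 w))"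
    by (subst f) (simp add: b_form_nodal dot_Bmat)
  also have "\<dots> = dot ?X (crs ?z) (mapply B0 ?X w)" by (rule galerkin)
  \<comment> \<open>Since \<open>crs\<close> inverts the extension, \<open>w\<close> is itself the
    coarse component of \<open>R0 w\<close>. The equation for \<open>w\<close> then expresses its
    \<open>BP3\<close> term through \<open>v\<close>, so that both brackets are perturbation terms
    covered by \<open>coarse_estimate\<close>.\<close>
  also have "\<dots> = (dot ?X (crs ?z) (mapply B0 ?X (crs (R0 w))) - dot ?X (crs ?z) (mapply (BP3 D E) ?X (crs (R0 w))))
      + (dot ?X (crs ?z) (mapply B0 ?X (crs v)) - dot ?X (crs ?z) (mapply (BP3 D E) ?X (crs v)))"
  proof -
    have "dot ?X (crs ?z) (mapply (BP3 D E) ?X w) = dot ?X (crs ?z) (mapply B0 ?X (crs v)) - dot ?X (crs ?z) (mapply (BP3 D E) ?X (crs v))"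
      unfolding dot_diff_right[symmetric] using eq by (intro dot_cong) auto
    then show ?thesis unfolding cw by simp
  qed
  finally have "cmod (b_form D (fe_fun D (R0 w)) f) \<le> \<delta> * (nn ?z * nn (R0 w)) + \<delta> * (nn ?z * nn v)"
    using order_trans[OF norm_triangle_ineq add_mono[OF coarse_estimate[of ?z "R0 w"] coarse_estimate[of ?z v]]] by simp
  then show "cmod (b_form D (fe_fun D (R0 w)) f) \<le> \<delta> * (nn (R0 w) + nn v) * H_norm D (Omega D) f"
    unfolding nn_cnj f[symmetric] by (simp add: algebra_simps)
qed

lemma coarse_error:
  assumes "\<And>x. x \<in> X0 D E \<Longrightarrow> mapply (BP3 D E) (X0 D E) w x = mapply B0 (X0 D E) (crs v) x - mapply (BP3 D E) (X0 D E) (crs v) x"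
  shows "nn (R0 w) \<le> \<delta> / (\<gamma> - \<delta>) * nn v"
proof -
  have "(\<gamma> - \<delta>) * nn (R0 w) \<le> \<delta> * nn v" using coarse_error_bound[OF assms] by (simp add: algebra_simps)
  then show ?thesis using gap by (simp add: field_simps)
qed

text \<open>A kernel vector satisfies the error equation with \<open>v\<close> zero, so
  \<open>coarse_error\<close> gives its extension norm zero, and a vector is recovered from its
  extension by taking coarse components.\<close>

lemma BP3_inj:
  assumes "\<And>x. x \<in> X0 D E \<Longrightarrow> mapply (BP3 D E) (X0 D E) w x = 0"
  shows "\<forall>x\<in>X0 D E. w x = 0"
proof
  fix x assume x: "x \<in> X0 D E"
  have c0: "crs (\<lambda>_. 0) = (\<lambda>_. 0)"
    unfolding crs_def by (auto simp: eigcoord_def mapply_def fun_eq_iff split: sum.split)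
  have "nn (\<lambda>_. 0) = 0" using nn_en[of "\<lambda>_. 0"] by (simp add: en_def energy_def dot_def)
  then have "nn (R0 w) \<le> 0"
    using coarse_error[of w "\<lambda>_. 0"] assms by (simp add: c0 mapply_def)
  then have "R0 w p = 0" if "p \<in> nodes D" for p using nn_eq_0[of "R0 w" p] nn_nonneg[of "R0 w"] that by simp
  then have R: "R0 w p = 0" if "p \<in> nodes_skel D \<or> (\<exists>i<nsub D. p \<in> nodes_I D i)" for p using nodes_decomp that by blast
  from x consider p where "x = Inl p" "p \<in> nodes_skel D" | i j where "x = Inr (i, j)" "i < nsub D" "j \<in> JS D E i"
    unfolding X0_def by blast
  then show "w x = 0"
  proof cases
    case 1 then show ?thesis using R[of p] R0_skel[of p w] by simp
  next
    case (2 i j)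
    have "eigcoord (nodes_I D i) (Hloc D i) (phiI E i) (R0 w) = eigcoord (nodes_I D i) (Hloc D i) (phiI E i) (\<lambda>_. 0)"
      using R 2(2) by (intro eigcoord_cong) blast
    then show ?thesis using crs_R0[OF x, of w] 2(1) unfolding crs_def by (simp add: eigcoord_def mapply_def)
  qed
qed

text \<open>\<open>BP3_inj\<close> makes the chosen \<open>minv\<close> a genuine inverse, and
  \<open>R0_adjoint\<close> rewrites its right-hand side, so the error vector satisfies the
  hypothesis of \<open>coarse_error\<close>.\<close>

lemma nn_coarse_error: "nn (R0 (coarse_error_vec v)) \<le> \<delta> / (\<gamma> - \<delta>) * nn v"
proof (rule coarse_error)
  fix x assume x: "x \<in> X0 D E"
  let ?r = "mapply (tr (R0T D E)) (nodes D) (mapply (Bmat D) (nodes D) v)"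
  have "coarse_error_vec v = (\<lambda>x. mapply (minv (X0 D E) (BP3 D E)) (X0 D E) ?r x - crs v x)"
    using coarse_error_vec_def by blast
  moreover have "mapply (BP3 D E) (X0 D E) (mapply (minv (X0 D E) (BP3 D E)) (X0 D E) ?r) x = ?r x"
    by (rule mapply_minv[OF finite_X0 _ x]) (rule BP3_inj)
  ultimately show "mapply (BP3 D E) (X0 D E) (coarse_error_vec v) x = mapply B0 (X0 D E) (crs v) x - mapply (BP3 D E) (X0 D E) (crs v) x"
    using R0_adjoint[OF x] by (simp add: mapply_diff)
qed

lemma preconditioner_perturbation:
  assumes v: "v \<in> Vh D"
  obtains r where "r \<in> Vh D" "P3inv_B D E v = (\<lambda>x. v x + r x)" "nrm r \<le> \<delta> / (\<gamma> - \<delta>) * nrm v"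
proof -
  let ?r = "fe_fun D (R0 (coarse_error_vec v))"
  have "P3inv_B D E v = fe_fun D (\<lambda>p. v p + R0 (coarse_error_vec v) p)"
    unfolding P3inv_B_eq using PB_eq by (rule fe_fun_cong)
  then have "P3inv_B D E v = (\<lambda>x. v x + ?r x)" unfolding fe_fun_add fe_fun_id[OF v] .
  moreover have "nrm ?r \<le> \<delta> / (\<gamma> - \<delta>) * nrm v" using nn_coarse_error[of v] unfolding fe_fun_id[OF v] .
  ultimately show ?thesis using that fe_fun_Vh by blast
qed

lemma norm_bound:
  assumes v: "v \<in> Vh D - {0}" shows "nrm (P3inv_B D E v) / nrm v \<le> 1 + \<delta> / (\<gamma> - \<delta>)"
proof -
  obtain r where r: "r \<in> Vh D" "P3inv_B D E v = (\<lambda>x. v x + r x)" "nrm r \<le> \<delta> / (\<gamma> - \<delta>) * nrm v"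
    using preconditioner_perturbation v by blast
  have pos: "0 < nrm v" using H_norm_Omega_eq_0[of v] nrm_nonneg[of v] v by force
  have "nrm (P3inv_B D E v) \<le> nrm v + nrm r" unfolding r(2) using v r(1) by (intro nrm_triangle) auto
  also have "\<dots> \<le> (1 + \<delta> / (\<gamma> - \<delta>)) * nrm v" using r(3) by (simp add: ring_distribs)
  finally show ?thesis by (subst pos_divide_le_eq[OF pos])
qed

lemma ip_bound:
  assumes v: "v \<in> Vh D - {0}" shows "1 - \<delta> / (\<gamma> - \<delta>) \<le> cmod (ip v (P3inv_B D E v)) / (nrm v)\<^sup>2"
proof -
  obtain r where r: "r \<in> Vh D" "P3inv_B D E v = (\<lambda>x. v x + r x)" "nrm r \<le> \<delta> / (\<gamma> - \<delta>) * nrm v"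
    using preconditioner_perturbation v by blast
  have V: "v \<in> Vh D" using v by blast
  have pos: "0 < nrm v" using H_norm_Omega_eq_0[of v] nrm_nonneg[of v] v by force
  have "ip v (P3inv_B D E v) = complex_of_real ((nrm v)\<^sup>2) + ip v r"
    unfolding r(2) using ip_sesq(2)[OF V r(1) V, of 1 1] ip_norm[OF V] by simp
  then have "(nrm v)\<^sup>2 \<le> cmod (ip v (P3inv_B D E v)) + cmod (ip v r)"
    using norm_triangle_ineq4[of "ip v (P3inv_B D E v)" "ip v r"] by (simp add: norm_power del: of_real_power)
  moreover have "cmod (ip v r) \<le> \<delta> / (\<gamma> - \<delta>) * (nrm v)\<^sup>2"
  proof -
    have "cmod (ip v r) \<le> nrm v * nrm r" by (rule ip_cauchy_schwarz[OF V r(1)])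
    also have "\<dots> \<le> nrm v * (\<delta> / (\<gamma> - \<delta>) * nrm v)" using r(3) pos by (intro mult_left_mono) auto
    finally show ?thesis by (simp add: power2_eq_square mult_ac)
  qed
  ultimately have "(1 - \<delta> / (\<gamma> - \<delta>)) * (nrm v)\<^sup>2 \<le> cmod (ip v (P3inv_B D E v))" by (simp add: left_diff_distrib)
  then show ?thesis using pos by (subst pos_le_divide_eq) auto
qed

section \<open>Attainment of the two quotients\<close>

lemma P3inv_B_scale: "P3inv_B D E (\<lambda>x. a * v x) = (\<lambda>x. a * P3inv_B D E v x)"
  unfolding P3inv_B_eq PB_scale fe_fun_scale ..

lemma sphere_nrm_nonzero: "c \<in> sphere_nodal \<Longrightarrow> nrm (fe_fun D c) \<noteq> 0"
  using sphere_nodal_Vh[of c] H_norm_Omega_eq_0[of "fe_fun D c"] by auto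

lemma norm_ratio_attained:
  "\<exists>v\<in>Vh D - {0}. is_arg_max (\<lambda>w. nrm (P3inv_B D E w) / nrm w) (\<lambda>w. w \<in> Vh D - {0}) v"
proof (rule attains_on_Vh(1))
  show "continuous_on sphere_nodal (\<lambda>c. nrm (P3inv_B D E (fe_fun D c)) / nrm (fe_fun D c))"
    unfolding P3inv_B_eq using sphere_nrm_nonzero
    by (intro continuous_on_divide nrm_continuous continuous_PB continuous_on_coordinate) auto
  fix s :: real and w assume w: "w \<in> Vh D" "0 < s"
  have "P3inv_B D E w \<in> Vh D" unfolding P3inv_B_eq by (rule fe_fun_Vh)
  then show "nrm (P3inv_B D E (\<lambda>x. complex_of_real s * w x)) / nrm (\<lambda>x. complex_of_real s * w x) = nrm (P3inv_B D E w) / nrm w"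
    unfolding P3inv_B_scale using w by (simp add: nrm_scale)
qed

lemma ip_ratio_attained:
  "\<exists>v\<in>Vh D - {0}. is_arg_min (\<lambda>w. cmod (ip w (P3inv_B D E w)) / (nrm w)\<^sup>2) (\<lambda>w. w \<in> Vh D - {0}) v"
proof (rule attains_on_Vh(2))
  show "continuous_on sphere_nodal (\<lambda>c. cmod (ip (fe_fun D c) (P3inv_B D E (fe_fun D c))) / (nrm (fe_fun D c))\<^sup>2)"
    unfolding P3inv_B_eq using sphere_nrm_nonzero
    by (intro continuous_on_divide continuous_on_norm continuous_on_power ip_continuous nrm_continuous continuous_PB continuous_on_coordinate) auto
  fix s :: real and w assume w: "w \<in> Vh D" "0 < s"
  have "P3inv_B D E w \<in> Vh D" unfolding P3inv_B_eq by (rule fe_fun_Vh)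
  then show "cmod (ip (\<lambda>x. complex_of_real s * w x) (P3inv_B D E (\<lambda>x. complex_of_real s * w x))) / (nrm (\<lambda>x. complex_of_real s * w x))\<^sup>2
      = cmod (ip w (P3inv_B D E w)) / (nrm w)\<^sup>2"
    unfolding P3inv_B_scale using w by (simp add: nrm_scale ip_scale norm_mult power_mult_distrib norm_power)
qed

end

text \<open>Maximum and minimum are expressed through an extremal \<open>v\<close>, which makes
  their existence part of the claim; the bounds themselves are proved for every nonzero
  function.\<close>

theorem theorem5p3:
  fixes D :: "'a::euclidean_space helmholtz" and E :: "'a selection"
    and k0 \<sigma> \<gamma> \<gamma>2 C :: real
  assumes "DIM('a) = 2 \<or> DIM('a) = 3"
    and "helmholtz_setting \<sigma> D"
    and "0 < k0" and "k0 \<le> wavenumber D"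
    and "0 < \<gamma>" and "ereal \<gamma> \<le> inf_sup D"
    and "0 < beta E" and "etaRe E \<in> {0<..<1}" and "etaIm E \<in> {0<..<1}"
    and "is_selection D E"
    and "\<gamma>2 = \<gamma> - 2 * etaRe E - 2 * mesh_size D * wavenumber D * etaIm E"
    and "0 < \<gamma>2"
    and "C = (2 * etaRe E + 2 * mesh_size D * wavenumber D * etaIm E) / \<gamma>2"
  shows "(\<exists>v\<in>Vh D - {0}.
            is_arg_max (\<lambda>w. H_norm D (Omega D) (P3inv_B D E w) / H_norm D (Omega D) w)
              (\<lambda>w. w \<in> Vh D - {0}) v \<and>
            H_norm D (Omega D) (P3inv_B D E v) / H_norm D (Omega D) v \<le> 1 + C) \<and>
         (C < 1 \<longrightarrow>
          (\<exists>v\<in>Vh D - {0}.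
            is_arg_min (\<lambda>w. cmod (H_ip D (Omega D) w (P3inv_B D E w)) / (H_norm D (Omega D) w)\<^sup>2)
              (\<lambda>w. w \<in> Vh D - {0}) v \<and>
            cmod (H_ip D (Omega D) v (P3inv_B D E v)) / (H_norm D (Omega D) v)\<^sup>2 \<ge> 1 - C))"
proof -
  interpret helmholtz_infsup D \<sigma> E \<gamma>
    using assms by unfold_locales auto
  have C: "C = (2 * etaRe E + 2 * mesh_size D * wavenumber D * etaIm E) / (\<gamma> - (2 * etaRe E + 2 * mesh_size D * wavenumber D * etaIm E))"
    using assms(11,13) by (simp add: algebra_simps)
  show ?thesis
    unfolding C using norm_ratio_attained ip_ratio_attained norm_bound ip_bound by blast
qed

end
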